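(* Let $\Gamma$ be a discrete group, let $(T_n)$ be an ergodic sequence in $\Gamma$ and let $(Y,\nu)$ be a probability measure preserving $\Gamma$-space. Suppose that $A$ is a subset of $\Gamma$ and $B$ is a Borel subset of $Y$ with \[ \overline{d}_{(T_n)}(A) = \alpha > 0 \quad\text{and}\quad \nu(B) = \beta > 0. \] Then, for every $0 \leq r < \beta$, there exist $a \in A$ and $S \subset \widehat{\Gamma}_{\mathrm{FD}} \setminus \{[\mathrm{id}]\}$ with $|S| \leq \frac{17(1-\alpha^2)}{d_\Gamma \alpha^2 (\beta-r)^2}$ such that \[ \big\{ \gamma \in \Gamma : \nu(AB \cap \gamma B) > \beta r \big\} \supset a \, U_{S,\frac{\beta-r}{2}}, \] where $d_\Gamma$ denotes the smallest dimension of a non-trivial unitary $\Gamma$-representation. If $d_\Gamma = \infty$, that is to say, if $\Gamma$ does not admit any non-trivial finite-dimensional unitary representations, or if $\alpha = 1$, then $\nu(AB) = 1$.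
   Context: For a finite-dimensional unitary $\Gamma$-representation $(\mathcal{W},\sigma)$ define the semi-norm $|\gamma|_\sigma = \sup\{ \|\sigma(\gamma)w-w\|_{\mathcal{W}} : \|w\|_{\mathcal{W}} = 1\}$ for $\gamma \in \Gamma$; it depends only on the unitary equivalence class of $\sigma$. $\widehat{\Gamma}_{\mathrm{FD}}$ denotes the set of unitary equivalence classes of finite-dimensional irreducible unitary $\Gamma$-representations, and $[\mathrm{id}]$ is the class of the trivial (one-dimensional) representation. For a finite set $S \subset \widehat{\Gamma}_{\mathrm{FD}}$ and $\varepsilon > 0$, the Bohr set $U_{S,\varepsilon}$ is \[ U_{S,\varepsilon} = \{ \gamma \in \Gamma : |\gamma|_\sigma < \varepsilon \text{ for all } \sigma \in S\} \] (so $U_{\emptyset,\varepsilon}=\Gamma$). When $d_\Gamma=\infty$, the bound on $|S|$ is read as $0$. For a sequence $(T_n)$ of finite subsets of $\Gamma$ and $A \subset \Gamma$, the upper asymptotic density of $A$ along $(T_n)$ is $\overline{d}_{(T_n)}(A) = \limsup_n \frac{|A \cap T_n|}{|T_n|}$. A sequence $(T_n)$ of finite subsets of $\Gamma$ is called ergodic if for every unitary $\Gamma$-representation $(\mathcal{H},\pi)$ and every $u \in \mathcal{H}$, $\frac{1}{|T_n|}\sum_{\gamma \in T_n} \pi(\gamma)u \to P_\pi u$ in the weak topology on $\mathcal{H}$, where $P_\pi$ is the orthogonal projection onto the subspace $\mathcal{H}^\pi$ of $\pi(\Gamma)$-fixed vectors. For $A \subset \Gamma$ and $B \subset Y$, $AB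 = \bigcup_{a \in A} aB$; and $aU = \{a u : u \in U\}$ for $U\subset\Gamma$.
   Formalization: The last sentence (ν(AB)=1 if d_Γ=∞ or α=1) is proved only for ergodic actions on (Y,ν); without ergodicity it fails, e.g. for the trivial action of Γ=A=Z with 0<ν(B)<1, where AB=B. The first claim is for all p.m.p. spaces. *)

theory Defs
  imports "HOL-Probability.Probability" "HOL-Algebra.Group_Action" "HOL-Library.Function_Algebras"
begin

section \<open>Complex Hilbert spaces\<close>

text \<open>
  The distribution has no complex inner product spaces, and the notions below quantify over all
  Hilbert spaces inside a formula, so a Hilbert space is given by a carrier: a linear subspace of
  the vector space of all functions \<open>'i \<Rightarrow> complex\<close> (pointwise operations), with an
  \<^emph>\<open>arbitrary\<close> complete inner product, linear in the second argument.
  Every complex vector space whose dimension does not exceed that of \<open>'i \<Rightarrow> complex\<close> is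
  isomorphic to such a subspace.
\<close>

definition cscale :: "complex \<Rightarrow> ('i \<Rightarrow> complex) \<Rightarrow> 'i \<Rightarrow> complex" where
  "cscale c f = (\<lambda>x. c * f x)"

interpretation cvs: vector_space cscale
  by unfold_locales (simp_all add: cscale_def fun_eq_iff algebra_simps)

record 'i hilbert =
  vecs :: "('i \<Rightarrow> complex) set"
  ip :: "('i \<Rightarrow> complex) \<Rightarrow> ('i \<Rightarrow> complex) \<Rightarrow> complex"

definition hnorm :: "('i, 'r) hilbert_scheme \<Rightarrow> ('i \<Rightarrow> complex) \<Rightarrow> real" where
  "hnorm H v = sqrt (Re (ip H v v))"

locale complex_hilbert =
  fixes H :: "('i, 'r) hilbert_scheme"
  assumes subspace_vecs: "cvs.subspace (vecs H)"
    and ip_add: "\<lbrakk>u \<in> vecs H; v \<in> vecs H; w \<in> vecs H\<rbrakk> \<Longrightarrow> ip H u (v + w) = ip H u v + ip H u w"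
    and ip_scale: "\<lbrakk>u \<in> vecs H; v \<in> vecs H\<rbrakk> \<Longrightarrow> ip H u (cscale c v) = c * ip H u v"
    and ip_cnj: "\<lbrakk>u \<in> vecs H; v \<in> vecs H\<rbrakk> \<Longrightarrow> ip H v u = cnj (ip H u v)"
    and ip_pos: "\<lbrakk>v \<in> vecs H; v \<noteq> 0\<rbrakk> \<Longrightarrow> Re (ip H v v) > 0"
    and complete:
      "\<lbrakk>\<And>n. X n \<in> vecs H; \<forall>e>0. \<exists>N. \<forall>m\<ge>N. \<forall>n\<ge>N. hnorm H (X m - X n) < e\<rbrakk>
        \<Longrightarrow> \<exists>v\<in>vecs H. (\<lambda>n. hnorm H (X n - v)) \<longlonglongrightarrow> 0"

definition weakly_converges ::
    "('i, 'r) hilbert_scheme \<Rightarrow> (nat \<Rightarrow> 'i \<Rightarrow> complex) \<Rightarrow> ('i \<Rightarrow> complex) \<Rightarrow> bool" where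
  "weakly_converges H X x \<longleftrightarrow> (\<forall>v\<in>vecs H. (\<lambda>n. ip H v (X n)) \<longlonglongrightarrow> ip H v x)"

definition orth_proj ::
    "('i, 'r) hilbert_scheme \<Rightarrow> ('i \<Rightarrow> complex) set \<Rightarrow> ('i \<Rightarrow> complex) \<Rightarrow> 'i \<Rightarrow> complex" where
  "orth_proj H F u = (THE w. w \<in> F \<and> (\<forall>v\<in>F. ip H v (u - w) = 0))"

definition hdim :: "('i, 'r) hilbert_scheme \<Rightarrow> enat" where
  "hdim H = (if \<exists>B. finite B \<and> cvs.span B = vecs H then enat (cvs.dim (vecs H)) else \<infinity>)"


section \<open>Unitary representations\<close>

record ('g, 'i) urep = "'i hilbert" +
  act :: "'g \<Rightarrow> ('i \<Rightarrow> complex) \<Rightarrow> 'i \<Rightarrow> complex"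

text \<open>Surjectivity of each \<open>act R g\<close> follows from the group laws.\<close>

locale unitary_rep = group G + complex_hilbert R
  for G :: "('g, 'm) monoid_scheme" and R :: "('g, 'i) urep" +
  assumes act_closed: "\<lbrakk>g \<in> carrier G; v \<in> vecs R\<rbrakk> \<Longrightarrow> act R g v \<in> vecs R"
    and act_add: "\<lbrakk>g \<in> carrier G; v \<in> vecs R; w \<in> vecs R\<rbrakk>
                    \<Longrightarrow> act R g (v + w) = act R g v + act R g w"
    and act_scale: "\<lbrakk>g \<in> carrier G; v \<in> vecs R\<rbrakk> \<Longrightarrow> act R g (cscale c v) = cscale c (act R g v)"
    and act_ip: "\<lbrakk>g \<in> carrier G; v \<in> vecs R; w \<in> vecs R\<rbrakk>
                    \<Longrightarrow> ip R (act R g v) (act R g w) = ip R v w"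
    and act_one: "v \<in> vecs R \<Longrightarrow> act R \<one>\<^bsub>G\<^esub> v = v"
    and act_mult: "\<lbrakk>g \<in> carrier G; h \<in> carrier G; v \<in> vecs R\<rbrakk>
                    \<Longrightarrow> act R (g \<otimes>\<^bsub>G\<^esub> h) v = act R g (act R h v)"

definition fixed_vecs :: "('g, 'm) monoid_scheme \<Rightarrow> ('g, 'i) urep \<Rightarrow> ('i \<Rightarrow> complex) set" where
  "fixed_vecs G R = {v \<in> vecs R. \<forall>g\<in>carrier G. act R g v = v}"

definition nontrivial_rep :: "('g, 'm) monoid_scheme \<Rightarrow> ('g, 'i) urep \<Rightarrow> bool" where
  "nontrivial_rep G R \<longleftrightarrow> (\<exists>g\<in>carrier G. \<exists>v\<in>vecs R. act R g v \<noteq> v)"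

definition unitarily_equivalent ::
    "('g, 'm) monoid_scheme \<Rightarrow> ('g, 'i) urep \<Rightarrow> ('g, 'i) urep \<Rightarrow> bool" where
  "unitarily_equivalent G R R' \<longleftrightarrow>
     (\<exists>U. bij_betw U (vecs R) (vecs R') \<and>
        (\<forall>v\<in>vecs R. \<forall>w\<in>vecs R. U (v + w) = U v + U w) \<and>
        (\<forall>c. \<forall>v\<in>vecs R. U (cscale c v) = cscale c (U v)) \<and>
        (\<forall>v\<in>vecs R. \<forall>w\<in>vecs R. ip R' (U v) (U w) = ip R v w) \<and>
        (\<forall>g\<in>carrier G. \<forall>v\<in>vecs R. U (act R g v) = act R' g (U v)))"

text \<open>
  A type cannot be quantified over inside a formula, so ``every unitary representation of \<open>G\<close>''
  means every one carried by functions on \<open>'g \<times> nat\<close>.  Up to unitary equivalence this is every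
  representation on a Hilbert space of orthonormal dimension at most \<open>max(|'g|, \<aleph>\<^sub>0)\<close>; in particular
  every finite-dimensional and every cyclic one, and for countable \<open>G\<close> every separable one.
  The ergodicity condition below concerns one vector at a time (apart from the test
  vectors, which may be projected), hence only the cyclic subrepresentation it generates.
\<close>

type_synonym 'g rep = "('g, 'g \<times> nat) urep"

definition ergodic_sequence :: "('g, 'm) monoid_scheme \<Rightarrow> (nat \<Rightarrow> 'g set) \<Rightarrow> bool" where
  "ergodic_sequence G T \<longleftrightarrow>
     (\<forall>n. finite (T n) \<and> T n \<subseteq> carrier G) \<and>
     (\<forall>R :: 'g rep. unitary_rep G R \<longrightarrow>
        (\<forall>u\<in>vecs R. weakly_converges R
           (\<lambda>n. cscale (1 / of_nat (card (T n))) (\<Sum>\<gamma>\<in>T n. act R \<gamma> u))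
           (orth_proj R (fixed_vecs G R) u)))"

text \<open>The infimum of the empty set is \<open>\<infinity>\<close>.\<close>

definition min_nontrivial_dim :: "('g, 'm) monoid_scheme \<Rightarrow> enat" where
  "min_nontrivial_dim G = Inf {hdim R | R :: 'g rep. unitary_rep G R \<and> nontrivial_rep G R}"


section \<open>The finite-dimensional dual and Bohr sets\<close>

text \<open>Subspaces of finite-dimensional spaces are closed, so closedness is not required of \<open>W\<close>.\<close>

definition fd_irreps :: "('g, 'm) monoid_scheme \<Rightarrow> 'g rep set" where
  "fd_irreps G = {R. unitary_rep G R \<and> hdim R < \<infinity> \<and> vecs R \<noteq> {0} \<and>
     (\<forall>W. cvs.subspace W \<and> W \<subseteq> vecs R \<and> (\<forall>g\<in>carrier G. act R g ` W \<subseteq> W)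
        \<longrightarrow> W = {0} \<or> W = vecs R)}"

definition unitary_equiv_rel :: "('g, 'm) monoid_scheme \<Rightarrow> 'g rep rel" where
  "unitary_equiv_rel G =
     {(R, R'). R \<in> fd_irreps G \<and> R' \<in> fd_irreps G \<and> unitarily_equivalent G R R'}"

definition fd_dual :: "('g, 'm) monoid_scheme \<Rightarrow> 'g rep set set" where
  "fd_dual G = fd_irreps G // unitary_equiv_rel G"

text \<open>The trivial representation on the line of constant functions.\<close>

definition trivial_rep :: "('g, 'm) monoid_scheme \<Rightarrow> 'g rep" where
  "trivial_rep G = \<lparr>vecs = range (\<lambda>c _. c),
                    ip = (\<lambda>v w. cnj (v (\<one>\<^bsub>G\<^esub>, 0)) * w (\<one>\<^bsub>G\<^esub>, 0)),
                    act = (\<lambda>_ v. v)\<rparr>"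

definition trivial_class :: "('g, 'm) monoid_scheme \<Rightarrow> 'g rep set" where
  "trivial_class G = unitary_equiv_rel G `` {trivial_rep G}"

definition rep_seminorm :: "('g, 'i) urep \<Rightarrow> 'g \<Rightarrow> real" where
  "rep_seminorm R \<gamma> = Sup {hnorm R (act R \<gamma> w - w) | w. w \<in> vecs R \<and> hnorm R w = 1}"

text \<open>
  \<open>S\<close> is a set of equivalence classes; the seminorm is the same for all \<open>R\<close> in a class
  \<open>\<sigma>\<close>, and classes are nonempty, so quantifying over \<open>R \<in> \<sigma>\<close> just evaluates it at \<open>\<sigma>\<close>.
\<close>

definition bohr_set :: "('g, 'm) monoid_scheme \<Rightarrow> 'g rep set set \<Rightarrow> real \<Rightarrow> 'g set" where
  "bohr_set G S \<epsilon> = {\<gamma> \<in> carrier G. \<forall>\<sigma>\<in>S. \<forall>R\<in>\<sigma>. rep_seminorm R \<gamma> < \<epsilon>}"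


section \<open>Density and measure preserving actions\<close>

definition upper_density :: "(nat \<Rightarrow> 'g set) \<Rightarrow> 'g set \<Rightarrow> ereal" where
  "upper_density T A = limsup (\<lambda>n. ereal (real (card (A \<inter> T n)) / real (card (T n))))"

locale pmp_space = group_action G "space M" \<phi> + prob_space M
  for G :: "('g, 'm) monoid_scheme" and M :: "'y measure" and \<phi> :: "'g \<Rightarrow> 'y \<Rightarrow> 'y" +
  assumes measurable_act: "g \<in> carrier G \<Longrightarrow> \<phi> g \<in> measurable M M"
    and preserves_measure: "g \<in> carrier G \<Longrightarrow> distr M M (\<phi> g) = M"

text \<open>
  A group with an ergodic sequence is countable, and for countable groups strict invariance and
  invariance up to null sets give the same notion.
\<close>

definition ergodic_action ::
    "('g, 'm) monoid_scheme \<Rightarrow> 'y measure \<Rightarrow> ('g \<Rightarrow> 'y \<Rightarrow> 'y) \<Rightarrow> bool" where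
  "ergodic_action G M \<phi> \<longleftrightarrow>
     (\<forall>E\<in>sets M. (\<forall>g\<in>carrier G. \<phi> g ` E = E) \<longrightarrow> measure M E = 0 \<or> measure M E = 1)"

definition translates :: "('g \<Rightarrow> 'y \<Rightarrow> 'y) \<Rightarrow> 'g set \<Rightarrow> 'y set \<Rightarrow> 'y set" where
  "translates \<phi> A B = (\<Union>a\<in>A. \<phi> a ` B)"

end

theory Submission
  imports Defs "HOL-Complex_Analysis.Great_Picard" "HOL-Algebra.Generated_Groups"
begin

text \<open>
  Let \<open>\<xi>\<close> be the indicator function of \<open>B\<close>, a vector of the unitary representation on \<open>L\<^sup>2(Y)\<close>.
  Since \<open>\<nu>(AB \<inter> \<gamma>B)\<close> is at least the average of \<open>\<langle>\<gamma>\<xi>, a\<xi>\<rangle>\<close> over \<open>a \<in> A \<inter> T n\<close>, it suffices to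
  bound the limit of these averages from below. Split \<open>\<xi> = \<psi> + \<rho>\<close>, where \<open>\<psi>\<close> lies in a
  finite-dimensional invariant subspace and the mean of \<open>|\<langle>w, \<gamma>\<rho>\<rangle>|\<^sup>2\<close> is small: as long as this
  mean is not small, the mean of the operators \<open>\<gamma>\<rho> \<otimes> (\<gamma>\<rho>)\<^sup>*\<close> is compact and commutes with the
  group, and its top eigenspace enlarges the finite-dimensional part. The limit is then essentially
  \<open>f \<gamma> = \<langle>\<gamma>\<xi>, q\<rangle>\<close>, where \<open>q\<close> is the limit of the averages of \<open>a\<psi>\<close>. The mean of \<open>f\<close> over \<open>A\<close> is
  \<open>\<parallel>q\<parallel>\<^sup>2\<close>, about \<open>\<beta>\<^sup>2\<close> or more, which yields a good \<open>a \<in> A\<close>. Decompose \<open>\<psi>\<close> and \<open>q\<close> into irreducible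
  components. By Bessel's inequality and Schur's orthogonality relations, applied to the indicator
  function of \<open>A\<close>, only few classes have a component of \<open>q\<close> larger than \<open>(\<beta> - r)/4\<close> times that
  of \<open>\<psi>\<close>; these form \<open>S\<close>. If \<open>u\<close> moves the vectors of the representations in \<open>S\<close> by less than
  \<open>(\<beta> - r)/2\<close>, then \<open>f (a u)\<close> differs from \<open>f a\<close> by at most \<open>\<beta>(\<beta> - r)/2\<close>.
\<close>

lemma cscale_apply [simp]: "cscale c f x = c * f x"
  by (simp add: cscale_def)

lemma sum_fun_apply: "(\<Sum>i\<in>I. f i) x = (\<Sum>i\<in>I. (f i x :: complex))"
  by (induction I rule: infinite_finite_induct) auto

lemma cmod_sq: "(complex_of_real (cmod z))\<^sup>2 = z * cnj z"
  using complex_norm_square[of z] by simp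

section \<open>Semi-inner products\<close>

locale semi_ip =
  fixes V :: "('i \<Rightarrow> complex) set" and s :: "('i \<Rightarrow> complex) \<Rightarrow> ('i \<Rightarrow> complex) \<Rightarrow> complex"
  assumes subspace_V: "cvs.subspace V"
    and s_add_right: "\<lbrakk>u \<in> V; v \<in> V; w \<in> V\<rbrakk> \<Longrightarrow> s u (v + w) = s u v + s u w"
    and s_scale_right: "\<lbrakk>u \<in> V; v \<in> V\<rbrakk> \<Longrightarrow> s u (cscale c v) = c * s u v"
    and s_cnj: "\<lbrakk>u \<in> V; v \<in> V\<rbrakk> \<Longrightarrow> s v u = cnj (s u v)"
    and s_nonneg: "v \<in> V \<Longrightarrow> Re (s v v) \<ge> 0"
begin

lemma V_zero [simp]: "0 \<in> V"
  and V_add [simp]: "\<lbrakk>u \<in> V; v \<in> V\<rbrakk> \<Longrightarrow> u + v \<in> V"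
  and V_scale [simp]: "u \<in> V \<Longrightarrow> cscale c u \<in> V"
  and V_diff [simp]: "\<lbrakk>u \<in> V; v \<in> V\<rbrakk> \<Longrightarrow> u - v \<in> V"
  and V_minus [simp]: "u \<in> V \<Longrightarrow> - u \<in> V"
  by (simp_all add: subspace_V cvs.subspace_0 cvs.subspace_add cvs.subspace_scale
      cvs.subspace_diff cvs.subspace_neg)

lemma V_sum [simp]: "(\<And>i. i \<in> I \<Longrightarrow> f i \<in> V) \<Longrightarrow> (\<Sum>i\<in>I. f i) \<in> V"
  using cvs.subspace_sum[OF subspace_V] by blast

lemma s_add_left: "\<lbrakk>u \<in> V; v \<in> V; w \<in> V\<rbrakk> \<Longrightarrow> s (u + v) w = s u w + s v w"
  using s_cnj[of w "u + v"] s_add_right[of w u v] s_cnj[of w u] s_cnj[of w v] by simp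

lemma s_scale_left: "\<lbrakk>u \<in> V; v \<in> V\<rbrakk> \<Longrightarrow> s (cscale c u) v = cnj c * s u v"
  using s_cnj[of v "cscale c u"] s_scale_right[of v u c] s_cnj[of v u] by simp

lemma s_zero_right [simp]: "u \<in> V \<Longrightarrow> s u 0 = 0"
  using s_scale_right[of u 0 0] by simp

lemma s_zero_left [simp]: "u \<in> V \<Longrightarrow> s 0 u = 0"
  using s_scale_left[of 0 u 0] by simp

lemma s_diff_right: "\<lbrakk>u \<in> V; v \<in> V; w \<in> V\<rbrakk> \<Longrightarrow> s u (v - w) = s u v - s u w"
  using s_add_right[of u "v - w" w] by simp

lemma s_diff_left: "\<lbrakk>u \<in> V; v \<in> V; w \<in> V\<rbrakk> \<Longrightarrow> s (u - v) w = s u w - s v w"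
  using s_add_left[of "u - v" v w] by simp

lemma s_minus_right [simp]: "\<lbrakk>u \<in> V; v \<in> V\<rbrakk> \<Longrightarrow> s u (- v) = - s u v"
  using s_diff_right[of u 0 v] by simp

lemma s_sum_right: "\<lbrakk>u \<in> V; \<And>i. i \<in> I \<Longrightarrow> f i \<in> V\<rbrakk> \<Longrightarrow> s u (\<Sum>i\<in>I. f i) = (\<Sum>i\<in>I. s u (f i))"
  by (induction I rule: infinite_finite_induct) (auto simp: s_add_right)

lemma s_sum_left: "\<lbrakk>u \<in> V; \<And>i. i \<in> I \<Longrightarrow> f i \<in> V\<rbrakk> \<Longrightarrow> s (\<Sum>i\<in>I. f i) u = (\<Sum>i\<in>I. s (f i) u)"
  by (induction I rule: infinite_finite_induct) (auto simp: s_add_left)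

lemma s_self: "v \<in> V \<Longrightarrow> s v v = of_real (Re (s v v))"
  using s_cnj[of v v] by (simp add: complex_eq_iff)

definition nrm :: "('i \<Rightarrow> complex) \<Rightarrow> real" where "nrm v = sqrt (Re (s v v))"

lemma nrm_nonneg [simp]: "v \<in> V \<Longrightarrow> 0 \<le> nrm v"
  by (simp add: nrm_def s_nonneg)

lemma nrm_sq: "v \<in> V \<Longrightarrow> (nrm v)\<^sup>2 = Re (s v v)"
  by (simp add: nrm_def s_nonneg)

lemma nrm_zero [simp]: "nrm 0 = 0"
  by (simp add: nrm_def)

lemma s_self_nrm: "v \<in> V \<Longrightarrow> s v v = of_real ((nrm v)\<^sup>2)"
  using s_self nrm_sq by simp

lemma nrm_scale: "v \<in> V \<Longrightarrow> nrm (cscale c v) = cmod c * nrm v"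
proof -
  assume v: "v \<in> V"
  have "s (cscale c v) (cscale c v) = of_real ((cmod c)\<^sup>2) * s v v"
    using v by (simp add: s_scale_left s_scale_right cmod_sq mult_ac)
  then show ?thesis
    by (simp add: nrm_def real_sqrt_mult)
qed

lemma nrm_add_sq:
  assumes "u \<in> V" "v \<in> V"
  shows "(nrm (u + v))\<^sup>2 = (nrm u)\<^sup>2 + 2 * Re (s u v) + (nrm v)\<^sup>2"
  using assms s_cnj[of u v] by (simp add: nrm_sq s_add_left s_add_right)

lemma nrm_diff_sq:
  assumes "u \<in> V" "v \<in> V"
  shows "(nrm (u - v))\<^sup>2 = (nrm u)\<^sup>2 - 2 * Re (s u v) + (nrm v)\<^sup>2"
  using assms s_cnj[of u v] by (simp add: nrm_sq s_diff_left s_diff_right)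

lemma cauchy_schwarz:
  assumes u: "u \<in> V" and v: "v \<in> V"
  shows "cmod (s u v) \<le> nrm u * nrm v"
proof -
  define a b c where "a = (nrm u)\<^sup>2" and "b = cmod (s u v)" and "c = (nrm v)\<^sup>2"
  have ac: "a \<ge> 0" "c \<ge> 0" by (auto simp: a_def c_def)
  have key: "0 \<le> a - 2 * l * b\<^sup>2 + l\<^sup>2 * b\<^sup>2 * c" for l :: real
  proof -
    define z where "z = of_real (- l) * cnj (s u v)"
    have 1: "s u (cscale z v) = of_real (- l * b\<^sup>2)"
      using u v by (simp add: s_scale_right z_def b_def cmod_sq mult_ac)
    have 2: "(nrm (cscale z v))\<^sup>2 = l\<^sup>2 * b\<^sup>2 * c"
      using v by (subst nrm_scale) (simp_all add: z_def b_def c_def norm_mult power_mult_distrib)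
    have "0 \<le> (nrm (u + cscale z v))\<^sup>2" by simp
    also have "\<dots> = a - 2 * l * b\<^sup>2 + l\<^sup>2 * b\<^sup>2 * c"
      using nrm_add_sq[of u "cscale z v"] u v 1 2 by (simp add: a_def)
    finally show ?thesis .
  qed
  have "b\<^sup>2 \<le> a * c"
  proof (cases "c = 0")
    case True
    show ?thesis
    proof (rule ccontr)
      assume "\<not> ?thesis"
      then have "b\<^sup>2 > 0" using True by simp
      then show False using key[of "(a + 1) / (2 * b\<^sup>2)"] True by (simp add: field_simps)
    qed
  next
    case False
    then have "c > 0" using ac by simp
    have "0 \<le> a - 2 * (1 / c) * b\<^sup>2 + (1 / c)\<^sup>2 * b\<^sup>2 * c" by (rule key)
    also have "\<dots> = a - b\<^sup>2 / c" using \<open>c > 0\<close> by (simp add: field_simps power2_eq_square)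
    finally show ?thesis using \<open>c > 0\<close> by (simp add: field_simps)
  qed
  then have "b\<^sup>2 \<le> (nrm u * nrm v)\<^sup>2" by (simp add: a_def c_def power_mult_distrib)
  then show ?thesis
    unfolding b_def by (rule power2_le_imp_le) (simp add: u v)
qed

lemma nrm_triangle:
  assumes "u \<in> V" "v \<in> V"
  shows "nrm (u + v) \<le> nrm u + nrm v"
proof -
  have "(nrm (u + v))\<^sup>2 \<le> (nrm u)\<^sup>2 + 2 * (nrm u * nrm v) + (nrm v)\<^sup>2"
    using nrm_add_sq[OF assms] cauchy_schwarz[OF assms] complex_Re_le_cmod[of "s u v"] by linarith
  also have "\<dots> = (nrm u + nrm v)\<^sup>2" by (simp add: power2_sum)
  finally show ?thesis by (rule power2_le_imp_le) (simp add: assms)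
qed

lemma nrm_minus_commute: "\<lbrakk>u \<in> V; v \<in> V\<rbrakk> \<Longrightarrow> nrm (u - v) = nrm (v - u)"
  by (simp add: nrm_def s_diff_left s_diff_right)

lemma nrm_triangle3:
  assumes "u \<in> V" "v \<in> V" "w \<in> V"
  shows "nrm (u - w) \<le> nrm (u - v) + nrm (v - w)"
  using nrm_triangle[of "u - v" "v - w"] assms by simp

lemma nrm_triangle_diff:
  assumes "u \<in> V" "v \<in> V"
  shows "\<bar>nrm u - nrm v\<bar> \<le> nrm (u - v)"
  using nrm_triangle[of "u - v" v] nrm_triangle[of "v - u" u] assms nrm_minus_commute[of u v]
  by simp

lemma parallelogram:
  assumes "u \<in> V" "v \<in> V"
  shows "(nrm (u + v))\<^sup>2 + (nrm (u - v))\<^sup>2 = 2 * (nrm u)\<^sup>2 + 2 * (nrm v)\<^sup>2"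
  using nrm_add_sq[OF assms] nrm_diff_sq[OF assms] by simp

lemma s_diff_bound:
  assumes "u \<in> V" "v \<in> V" "u' \<in> V" "v' \<in> V"
  shows "cmod (s u v - s u' v') \<le> nrm (u - u') * nrm v + nrm u' * nrm (v - v')"
proof -
  have "s u v - s u' v' = s (u - u') v + s u' (v - v')"
    using assms by (simp add: s_diff_left s_diff_right)
  then show ?thesis
    using assms cauchy_schwarz[of "u - u'" v] cauchy_schwarz[of u' "v - v'"]
      norm_triangle_ineq[of "s (u - u') v" "s u' (v - v')"] by simp
qed

lemma s_tendsto:
  assumes "\<And>n. X n \<in> V" "\<And>n. Y n \<in> V" "u \<in> V" "v \<in> V"
    and "(\<lambda>n. nrm (X n - u)) \<longlonglongrightarrow> 0" "(\<lambda>n. nrm (Y n - v)) \<longlonglongrightarrow> 0"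
  shows "(\<lambda>n. s (X n) (Y n)) \<longlonglongrightarrow> s u v"
proof -
  have "(\<lambda>n. nrm (X n - u) * nrm (Y n) + nrm u * nrm (Y n - v)) \<longlonglongrightarrow> 0 * nrm v + nrm u * 0"
  proof (intro tendsto_intros assms)
    have "(\<lambda>n. nrm (Y n) - nrm v) \<longlonglongrightarrow> 0"
      by (rule Lim_null_comparison[OF _ assms(6)]) (auto intro!: always_eventually nrm_triangle_diff assms)
    then show "(\<lambda>n. nrm (Y n)) \<longlonglongrightarrow> nrm v"
      by (simp add: LIM_zero_iff)
  qed
  then have "(\<lambda>n. nrm (X n - u) * nrm (Y n) + nrm u * nrm (Y n - v)) \<longlonglongrightarrow> 0" by simp
  then have "(\<lambda>n. s (X n) (Y n) - s u v) \<longlonglongrightarrow> 0"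
    by (rule Lim_null_comparison[rotated]) (auto intro!: always_eventually s_diff_bound assms)
  then show ?thesis by (simp add: LIM_zero_iff)
qed

end

section \<open>Completion of a semi-inner product space\<close>

text \<open>
  A vector \<open>v\<close> is encoded by its inner products with a total family \<open>e\<close>; the completion then
  consists of the pointwise limits of Cauchy sequences, as in a reproducing kernel Hilbert space.
\<close>

locale hilbert_completion = semi_ip V s
  for V :: "('i \<Rightarrow> complex) set" and s +
  fixes e :: "'i \<Rightarrow> 'i \<Rightarrow> complex"
  assumes e_V [simp]: "e i \<in> V" and span_e: "V \<subseteq> cvs.span (range e)"
begin

definition cauchy_seq :: "(nat \<Rightarrow> 'i \<Rightarrow> complex) \<Rightarrow> bool" where
  "cauchy_seq X \<longleftrightarrow> (\<forall>n. X n \<in> V) \<and> (\<forall>\<epsilon>>0. \<exists>N. \<forall>m\<ge>N. \<forall>n\<ge>N. nrm (X m - X n) < \<epsilon>)"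

definition represents :: "(nat \<Rightarrow> 'i \<Rightarrow> complex) \<Rightarrow> ('i \<Rightarrow> complex) \<Rightarrow> bool" where
  "represents X f \<longleftrightarrow> cauchy_seq X \<and> (\<forall>i. (\<lambda>n. s (e i) (X n)) \<longlonglongrightarrow> f i)"

definition emb :: "('i \<Rightarrow> complex) \<Rightarrow> 'i \<Rightarrow> complex" where
  "emb v = (\<lambda>i. s (e i) v)"

definition limits :: "('i \<Rightarrow> complex) set" where
  "limits = {f. \<exists>X. represents X f}"

definition rep_seq :: "('i \<Rightarrow> complex) \<Rightarrow> nat \<Rightarrow> 'i \<Rightarrow> complex" where
  "rep_seq f = (SOME X. represents X f)"

definition lip :: "('i \<Rightarrow> complex) \<Rightarrow> ('i \<Rightarrow> complex) \<Rightarrow> complex" where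
  "lip f g = lim (\<lambda>n. s (rep_seq f n) (rep_seq g n))"

lemma cauchy_seq_V: "cauchy_seq X \<Longrightarrow> X n \<in> V"
  by (simp add: cauchy_seq_def)

lemma cauchy_seq_E:
  assumes "cauchy_seq X" "\<epsilon> > 0"
  obtains N where "\<And>m n. m \<ge> N \<Longrightarrow> n \<ge> N \<Longrightarrow> nrm (X m - X n) < \<epsilon>"
  using assms unfolding cauchy_seq_def by blast

lemma cauchy_seq_nrm:
  assumes "cauchy_seq X"
  shows "convergent (\<lambda>n. nrm (X n))"
proof (rule Cauchy_convergent, rule metric_CauchyI)
  fix \<epsilon> :: real assume "\<epsilon> > 0"
  then obtain N where N: "\<And>m n. m \<ge> N \<Longrightarrow> n \<ge> N \<Longrightarrow> nrm (X m - X n) < \<epsilon>"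
    using cauchy_seq_E[OF assms] by blast
  have "dist (nrm (X m)) (nrm (X n)) < \<epsilon>" if "m \<ge> N" "n \<ge> N" for m n
    using N[OF that] nrm_triangle_diff[of "X m" "X n"] cauchy_seq_V[OF assms]
    by (simp add: dist_real_def)
  then show "\<exists>N. \<forall>m\<ge>N. \<forall>n\<ge>N. dist (nrm (X m)) (nrm (X n)) < \<epsilon>" by blast
qed

lemma cauchy_seq_bounded:
  assumes "cauchy_seq X"
  obtains B where "B > 0" "\<And>n. nrm (X n) \<le> B"
proof -
  have "Bseq (\<lambda>n. nrm (X n))" by (rule convergent_imp_Bseq[OF cauchy_seq_nrm[OF assms]])
  then obtain B where "B > 0" "\<And>n. norm (nrm (X n)) \<le> B" by (auto simp: Bseq_def)
  then show ?thesis using that[of B] by (metis abs_le_D1 real_norm_def)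
qed

lemma cauchy_seq_s:
  assumes X: "cauchy_seq X" and Y: "cauchy_seq Y"
  shows "convergent (\<lambda>n. s (X n) (Y n))"
proof (rule Cauchy_convergent, rule metric_CauchyI)
  fix \<epsilon> :: real assume \<epsilon>: "\<epsilon> > 0"
  obtain B where B: "B > 0" "\<And>n. nrm (X n) \<le> B" using cauchy_seq_bounded[OF X] by blast
  obtain C where C: "C > 0" "\<And>n. nrm (Y n) \<le> C" using cauchy_seq_bounded[OF Y] by blast
  obtain N where N: "\<And>m n. m \<ge> N \<Longrightarrow> n \<ge> N \<Longrightarrow> nrm (X m - X n) < \<epsilon> / (2 * C)"
    using cauchy_seq_E[OF X, of "\<epsilon> / (2 * C)"] \<epsilon> C by (metis divide_pos_pos mult_pos_pos zero_less_numeral)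
  obtain M where M: "\<And>m n. m \<ge> M \<Longrightarrow> n \<ge> M \<Longrightarrow> nrm (Y m - Y n) < \<epsilon> / (2 * B)"
    using cauchy_seq_E[OF Y, of "\<epsilon> / (2 * B)"] \<epsilon> B by (metis divide_pos_pos mult_pos_pos zero_less_numeral)
  have "dist (s (X m) (Y m)) (s (X n) (Y n)) < \<epsilon>" if "m \<ge> max M N" "n \<ge> max M N" for m n
  proof -
    have V: "X m \<in> V" "X n \<in> V" "Y m \<in> V" "Y n \<in> V"
      using X Y cauchy_seq_V by blast+
    have "dist (s (X m) (Y m)) (s (X n) (Y n)) \<le> nrm (X m - X n) * nrm (Y m) + nrm (X n) * nrm (Y m - Y n)"
      unfolding dist_norm using V by (intro s_diff_bound) auto
    also have "\<dots> \<le> nrm (X m - X n) * C + B * nrm (Y m - Y n)"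
      using V B C by (intro add_mono mult_left_mono mult_right_mono) auto
    also have "\<dots> < \<epsilon> / (2 * C) * C + B * (\<epsilon> / (2 * B))"
      using that N M B C by (intro add_strict_mono mult_strict_left_mono mult_strict_right_mono) auto
    also have "\<dots> = \<epsilon>" using B C by (simp add: field_simps)
    finally show ?thesis .
  qed
  then show "\<exists>N. \<forall>m\<ge>N. \<forall>n\<ge>N. dist (s (X m) (Y m)) (s (X n) (Y n)) < \<epsilon>" by blast
qed

lemma cauchy_seq_add:
  assumes X: "cauchy_seq X" and Y: "cauchy_seq Y"
  shows "cauchy_seq (\<lambda>n. X n + Y n)"
  unfolding cauchy_seq_def
proof (intro conjI allI impI)
  show "X n + Y n \<in> V" for n using X Y cauchy_seq_V by auto
  fix \<epsilon> :: real assume \<epsilon>: "\<epsilon> > 0"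
  obtain N where N: "\<And>m n. m \<ge> N \<Longrightarrow> n \<ge> N \<Longrightarrow> nrm (X m - X n) < \<epsilon> / 2"
    using cauchy_seq_E[OF X, of "\<epsilon> / 2"] \<epsilon> by auto
  obtain M where M: "\<And>m n. m \<ge> M \<Longrightarrow> n \<ge> M \<Longrightarrow> nrm (Y m - Y n) < \<epsilon> / 2"
    using cauchy_seq_E[OF Y, of "\<epsilon> / 2"] \<epsilon> by auto
  have "nrm (X m + Y m - (X n + Y n)) < \<epsilon>" if "m \<ge> max M N" "n \<ge> max M N" for m n
  proof -
    have "nrm ((X m - X n) + (Y m - Y n)) \<le> nrm (X m - X n) + nrm (Y m - Y n)"
      using X Y cauchy_seq_V by (intro nrm_triangle) auto
    also have "\<dots> < \<epsilon>" using N[of m n] M[of m n] that by simp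
    finally show ?thesis by (simp add: algebra_simps)
  qed
  then show "\<exists>N. \<forall>m\<ge>N. \<forall>n\<ge>N. nrm (X m + Y m - (X n + Y n)) < \<epsilon>" by blast
qed

lemma cauchy_seq_scale:
  assumes X: "cauchy_seq X"
  shows "cauchy_seq (\<lambda>n. cscale c (X n))"
  unfolding cauchy_seq_def
proof (intro conjI allI impI)
  show "cscale c (X n) \<in> V" for n using X cauchy_seq_V by auto
  fix \<epsilon> :: real assume \<epsilon>: "\<epsilon> > 0"
  have c: "cmod c + 1 > 0" by (simp add: add_nonneg_pos)
  obtain N where N: "\<And>m n. m \<ge> N \<Longrightarrow> n \<ge> N \<Longrightarrow> nrm (X m - X n) < \<epsilon> / (cmod c + 1)"
    using cauchy_seq_E[OF X, of "\<epsilon> / (cmod c + 1)"] \<epsilon> c by (metis divide_pos_pos)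
  have "nrm (cscale c (X m) - cscale c (X n)) < \<epsilon>" if "m \<ge> N" "n \<ge> N" for m n
  proof -
    have V: "X m - X n \<in> V" using X cauchy_seq_V by auto
    have "nrm (cscale c (X m) - cscale c (X n)) = cmod c * nrm (X m - X n)"
      using nrm_scale[OF V, of c] by (simp add: cvs.scale_right_diff_distrib)
    also have "\<dots> \<le> (cmod c + 1) * nrm (X m - X n)"
      using V by (intro mult_right_mono) auto
    also have "\<dots> < \<epsilon>" using N[OF that] c by (simp add: field_simps)
    finally show ?thesis .
  qed
  then show "\<exists>N. \<forall>m\<ge>N. \<forall>n\<ge>N. nrm (cscale c (X m) - cscale c (X n)) < \<epsilon>" by blast
qed

lemma cauchy_seq_const: "v \<in> V \<Longrightarrow> cauchy_seq (\<lambda>_. v)"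
  by (simp add: cauchy_seq_def)

lemma represents_add:
  "\<lbrakk>represents X f; represents Y g\<rbrakk> \<Longrightarrow> represents (\<lambda>n. X n + Y n) (f + g)"
  by (auto simp: represents_def cauchy_seq_add s_add_right cauchy_seq_V intro!: tendsto_add)

lemma represents_scale: "represents X f \<Longrightarrow> represents (\<lambda>n. cscale c (X n)) (cscale c f)"
  by (auto simp: represents_def cauchy_seq_scale s_scale_right cauchy_seq_V intro!: tendsto_mult_left)

lemma represents_diff:
  "\<lbrakk>represents X f; represents Y g\<rbrakk> \<Longrightarrow> represents (\<lambda>n. X n - Y n) (f - g)"
  using represents_add[OF _ represents_scale[of Y g "-1"], of X f] by simp

lemma represents_emb: "v \<in> V \<Longrightarrow> represents (\<lambda>_. v) (emb v)"
  by (simp add: represents_def emb_def cauchy_seq_const)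

lemma represents_V: "represents X f \<Longrightarrow> X n \<in> V"
  by (simp add: represents_def cauchy_seq_def)

lemma represents_zero:
  assumes X: "represents X 0"
  shows "(\<lambda>n. nrm (X n)) \<longlonglongrightarrow> 0"
proof -
  have XV: "X n \<in> V" for n using represents_V[OF X] .
  have cX: "cauchy_seq X" using X by (simp add: represents_def)
  let ?S = "{v \<in> V. (\<lambda>n. s v (X n)) \<longlonglongrightarrow> 0}"
  have "cvs.subspace ?S"
  proof (rule cvs.subspaceI)
    show "0 \<in> ?S" using XV by simp
    show "x + y \<in> ?S" if "x \<in> ?S" "y \<in> ?S" for x y
      using that XV tendsto_add[of "\<lambda>n. s x (X n)" 0 _ "\<lambda>n. s y (X n)" 0] by (simp add: s_add_left)
    show "cscale c x \<in> ?S" if "x \<in> ?S" for c x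
      using that XV tendsto_mult_left[of "\<lambda>n. s x (X n)" 0 _ "cnj c"] by (simp add: s_scale_left)
  qed
  moreover have "range e \<subseteq> ?S" using X by (auto simp: represents_def)
  ultimately have weak: "(\<lambda>n. s v (X n)) \<longlonglongrightarrow> 0" if "v \<in> V" for v
    using cvs.span_minimal[of "range e" ?S] span_e that by auto
  obtain B where B: "B > 0" "\<And>n. nrm (X n) \<le> B" using cauchy_seq_bounded[OF cX] by blast
  have "(\<lambda>n. (nrm (X n))\<^sup>2) \<longlonglongrightarrow> 0"
  proof (rule LIMSEQ_I)
    fix r :: real assume r: "r > 0"
    obtain N where N: "\<And>m n. m \<ge> N \<Longrightarrow> n \<ge> N \<Longrightarrow> nrm (X m - X n) < r / (2 * B)"
      using cauchy_seq_E[OF cX, of "r / (2 * B)"] r B by (metis divide_pos_pos mult_pos_pos zero_less_numeral)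
    obtain M where M: "\<And>n. n \<ge> M \<Longrightarrow> cmod (s (X N) (X n)) < r / 2"
      using LIMSEQ_D[OF weak[OF XV[of N]], of "r / 2"] r by auto
    have "norm ((nrm (X n))\<^sup>2 - 0) < r" if "n \<ge> max M N" for n
    proof -
      have "(nrm (X n))\<^sup>2 = Re (s (X N) (X n)) + Re (s (X n - X N) (X n))"
        using XV by (simp add: nrm_sq s_diff_left)
      also have "\<dots> \<le> cmod (s (X N) (X n)) + nrm (X n - X N) * nrm (X n)"
        using XV by (intro add_mono complex_Re_le_cmod order_trans[OF complex_Re_le_cmod cauchy_schwarz]) auto
      also have "\<dots> \<le> cmod (s (X N) (X n)) + nrm (X n - X N) * B"
        using XV B by (intro add_left_mono mult_left_mono) auto
      also have "\<dots> < r / 2 + r / (2 * B) * B"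
        using M[of n] N[of n N] that B by (intro add_strict_mono mult_strict_right_mono) auto
      also have "\<dots> = r" using B by simp
      finally show ?thesis by simp
    qed
    then show "\<exists>no. \<forall>n\<ge>no. norm ((nrm (X n))\<^sup>2 - 0) < r" by blast
  qed
  from tendsto_real_sqrt[OF this] show ?thesis using XV by (simp add: real_sqrt_abs)
qed

lemma represents_rep_seq: "f \<in> limits \<Longrightarrow> represents (rep_seq f) f"
  unfolding limits_def rep_seq_def mem_Collect_eq
  by (rule someI_ex[where P="\<lambda>X. represents X f"])

lemma lip_tendsto:
  assumes X: "represents X f" and Y: "represents Y g"
  shows "(\<lambda>n. s (X n) (Y n)) \<longlonglongrightarrow> lip f g"
proof -
  define X' where "X' = rep_seq f"
  define Y' where "Y' = rep_seq g"
  have X': "represents X' f" and Y': "represents Y' g"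
    using X Y represents_rep_seq by (auto simp: limits_def X'_def Y'_def)
  have V: "X n \<in> V" "X' n \<in> V" "Y n \<in> V" "Y' n \<in> V" for n
    using X X' Y Y' represents_V by blast+
  have "(\<lambda>n. s (X' n) (Y' n)) \<longlonglongrightarrow> lip f g"
    using cauchy_seq_s[of X' Y'] X' Y'
    by (simp add: lip_def X'_def Y'_def represents_def convergent_LIMSEQ_iff)
  moreover have "(\<lambda>n. s (X n) (Y n) - s (X' n) (Y' n)) \<longlonglongrightarrow> 0"
  proof (rule Lim_null_comparison)
    show "\<forall>\<^sub>F n in sequentially. cmod (s (X n) (Y n) - s (X' n) (Y' n))
        \<le> nrm (X n - X' n) * nrm (Y n) + nrm (X' n) * nrm (Y n - Y' n)"
      using V by (intro always_eventually allI s_diff_bound) auto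
    have 1: "(\<lambda>n. nrm (X n - X' n)) \<longlonglongrightarrow> 0" "(\<lambda>n. nrm (Y n - Y' n)) \<longlonglongrightarrow> 0"
      using represents_zero represents_diff[OF X X'] represents_diff[OF Y Y'] by simp_all
    obtain a b where "(\<lambda>n. nrm (Y n)) \<longlonglongrightarrow> a" "(\<lambda>n. nrm (X' n)) \<longlonglongrightarrow> b"
      using cauchy_seq_nrm X' Y unfolding represents_def convergent_def by blast
    from tendsto_add[OF tendsto_mult[OF 1(1) this(1)] tendsto_mult[OF this(2) 1(2)]]
    show "(\<lambda>n. nrm (X n - X' n) * nrm (Y n) + nrm (X' n) * nrm (Y n - Y' n)) \<longlonglongrightarrow> 0" by simp
  qed
  ultimately show ?thesis by (rule Lim_transform)
qed

lemma lip_eqI: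
  "\<lbrakk>represents X f; represents Y g; (\<lambda>n. s (X n) (Y n)) \<longlonglongrightarrow> l\<rbrakk> \<Longrightarrow> lip f g = l"
  using lip_tendsto LIMSEQ_unique by blast

lemma emb_limits [simp]: "v \<in> V \<Longrightarrow> emb v \<in> limits"
  using represents_emb by (auto simp: limits_def)

lemma lip_emb: "\<lbrakk>u \<in> V; v \<in> V\<rbrakk> \<Longrightarrow> lip (emb u) (emb v) = s u v"
  by (rule lip_eqI[OF represents_emb represents_emb]) auto

lemma lip_emb_e:
  assumes "f \<in> limits"
  shows "lip (emb (e i)) f = f i"
  using represents_rep_seq[OF assms] by (intro lip_eqI[OF represents_emb]) (auto simp: represents_def)

sublocale lims: semi_ip limits lip
proof
  show "cvs.subspace limits"
  proof (rule cvs.subspaceI)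
    have "emb 0 = 0" by (auto simp: emb_def)
    then show "0 \<in> limits" using emb_limits[of 0] by simp
  qed (auto simp: limits_def intro: represents_add represents_scale)
  fix u v assume u: "u \<in> limits" and v: "v \<in> limits"
  note reps = represents_rep_seq[OF u] represents_rep_seq[OF v]
  have V: "rep_seq u n \<in> V" "rep_seq v n \<in> V" for n
    using reps represents_V by auto
  show "lip u (v + w) = lip u v + lip u w" if w: "w \<in> limits" for w
  proof (rule lip_eqI[OF reps(1) represents_add[OF reps(2) represents_rep_seq[OF w]]])
    have "rep_seq w n \<in> V" for n using represents_rep_seq[OF w] represents_V by auto
    then show "(\<lambda>n. s (rep_seq u n) (rep_seq v n + rep_seq w n)) \<longlonglongrightarrow> lip u v + lip u w"
      using V tendsto_add[OF lip_tendsto[OF reps] lip_tendsto[OF reps(1) represents_rep_seq[OF w]]]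
      by (simp add: s_add_right)
  qed
  show "lip u (cscale c v) = c * lip u v" for c
    using V tendsto_mult_left[OF lip_tendsto[OF reps], of c]
    by (intro lip_eqI[OF reps(1) represents_scale[OF reps(2)]]) (simp add: s_scale_right)
  show "lip v u = cnj (lip u v)"
    using V tendsto_cnj[OF lip_tendsto[OF reps]]
    by (intro lip_eqI[OF reps(2,1)]) (simp add: s_cnj[symmetric])
next
  fix v assume v: "v \<in> limits"
  note r = represents_rep_seq[OF v]
  show "Re (lip v v) \<ge> 0"
    using tendsto_Re[OF lip_tendsto[OF r r]] represents_V[OF r]
    by (intro tendsto_lowerbound[where F=sequentially]) (auto intro!: always_eventually s_nonneg)
qed

lemma represents_nrm:
  assumes "represents X f"
  shows "(\<lambda>n. nrm (X n)) \<longlonglongrightarrow> lims.nrm f"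
  unfolding nrm_def lims.nrm_def by (intro tendsto_real_sqrt tendsto_Re lip_tendsto assms)

lemma represents_approx:
  assumes X: "represents X f"
  shows "(\<lambda>m. lims.nrm (f - emb (X m))) \<longlonglongrightarrow> 0"
proof (rule LIMSEQ_I)
  have XV: "X n \<in> V" for n using represents_V[OF X] .
  have f: "f \<in> limits" using X by (auto simp: limits_def)
  fix r :: real assume r: "r > 0"
  obtain N where N: "\<And>m n. m \<ge> N \<Longrightarrow> n \<ge> N \<Longrightarrow> nrm (X m - X n) < r / 2"
    using cauchy_seq_E[of X "r / 2"] X r unfolding represents_def by auto
  have "norm (lims.nrm (f - emb (X m)) - 0) < r" if m: "m \<ge> N" for m
  proof -
    have "(\<lambda>n. nrm (X n - X m)) \<longlonglongrightarrow> lims.nrm (f - emb (X m))"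
      by (rule represents_nrm[OF represents_diff[OF X represents_emb[OF XV]]])
    then have "lims.nrm (f - emb (X m)) \<le> r / 2"
      by (rule tendsto_upperbound) (use N m in \<open>auto simp: eventually_sequentially intro!: exI[of _ N] less_imp_le\<close>)
    then show ?thesis using r f XV by simp
  qed
  then show "\<exists>no. \<forall>n\<ge>no. norm (lims.nrm (f - emb (X n)) - 0) < r" by blast
qed

lemma limits_approx:
  assumes "f \<in> limits" "\<epsilon> > 0"
  obtains v where "v \<in> V" "lims.nrm (f - emb v) < \<epsilon>"
proof -
  have r: "represents (rep_seq f) f" using assms represents_rep_seq by auto
  obtain N where N: "\<forall>n\<ge>N. norm (lims.nrm (f - emb (rep_seq f n)) - 0) < \<epsilon>"
    using LIMSEQ_D[OF represents_approx[OF r] assms(2)] by blast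
  have "lims.nrm (f - emb (rep_seq f N)) < \<epsilon>"
    using N[rule_format, OF order_refl] by (simp add: abs_less_iff)
  then show ?thesis using that represents_V[OF r] by blast
qed

lemma emb_diff: "\<lbrakk>u \<in> V; v \<in> V\<rbrakk> \<Longrightarrow> emb u - emb v = emb (u - v)"
  by (auto simp: emb_def fun_eq_iff s_diff_right)

lemma nrm_emb: "v \<in> V \<Longrightarrow> lims.nrm (emb v) = nrm v"
  by (simp add: lims.nrm_def nrm_def lip_emb)

lemma limits_pos:
  assumes f: "f \<in> limits" "f \<noteq> 0"
  shows "Re (lip f f) > 0"
proof (rule ccontr)
  assume "\<not> ?thesis"
  then have "lims.nrm f = 0" using lims.s_nonneg[OF f(1)] by (simp add: lims.nrm_def)
  then have "cmod (f i) \<le> 0" for i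
    using lims.cauchy_schwarz[of "emb (e i)" f] lip_emb_e[OF f(1), of i] f by simp
  then show False using f by (auto simp: fun_eq_iff)
qed

lemma limits_complete:
  assumes F: "\<And>n. F n \<in> limits" and cau: "\<forall>\<epsilon>>0. \<exists>N. \<forall>m\<ge>N. \<forall>n\<ge>N. lims.nrm (F m - F n) < \<epsilon>"
  shows "\<exists>f\<in>limits. (\<lambda>n. lims.nrm (F n - f)) \<longlonglongrightarrow> 0"
proof -
  have "\<exists>v. v \<in> V \<and> lims.nrm (F n - emb v) < inverse (real (Suc n))" for n
  proof -
    have "inverse (real (Suc n)) > 0" by simp
    from limits_approx[OF F[of n] this] show ?thesis by blast
  qed
  then obtain c where cV: "\<And>n. c n \<in> V" and c: "\<And>n. lims.nrm (F n - emb (c n)) < inverse (real (Suc n))"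
    by metis
  have lim: "(\<lambda>n. lims.nrm (F n - emb (c n))) \<longlonglongrightarrow> 0"
    by (rule Lim_null_comparison[OF _ LIMSEQ_inverse_real_of_nat])
      (use c F cV in \<open>auto intro!: always_eventually less_imp_le\<close>)
  have cc: "cauchy_seq c"
    unfolding cauchy_seq_def
  proof (intro conjI allI impI cV)
    fix \<epsilon> :: real assume \<epsilon>: "\<epsilon> > 0"
    obtain N where N: "\<And>m n. m \<ge> N \<Longrightarrow> n \<ge> N \<Longrightarrow> lims.nrm (F m - F n) < \<epsilon> / 3"
      using cau \<epsilon> by (meson divide_pos_pos zero_less_numeral)
    obtain M where M: "\<And>n. n \<ge> M \<Longrightarrow> lims.nrm (F n - emb (c n)) < \<epsilon> / 3"
      using LIMSEQ_D[OF lim, of "\<epsilon> / 3"] \<epsilon> F cV by auto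
    have "nrm (c m - c n) < \<epsilon>" if "m \<ge> max M N" "n \<ge> max M N" for m n
    proof -
      have "nrm (c m - c n) = lims.nrm (emb (c m) - emb (c n))"
        using cV by (simp add: emb_diff nrm_emb)
      also have "\<dots> \<le> lims.nrm (emb (c m) - F m) + (lims.nrm (F m - F n) + lims.nrm (F n - emb (c n)))"
        using F cV lims.nrm_triangle3[of "emb (c m)" "F m" "emb (c n)"]
          lims.nrm_triangle3[of "F m" "F n" "emb (c n)"] by simp
      also have "\<dots> < \<epsilon> / 3 + (\<epsilon> / 3 + \<epsilon> / 3)"
        using that M N F cV lims.nrm_minus_commute[of "emb (c m)" "F m"]
        by (intro add_strict_mono) auto
      finally show ?thesis by simp
    qed
    then show "\<exists>N. \<forall>m\<ge>N. \<forall>n\<ge>N. nrm (c m - c n) < \<epsilon>" by blast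
  qed
  define f where "f = (\<lambda>i. lim (\<lambda>n. s (e i) (c n)))"
  have rep: "represents c f"
    using cc cauchy_seq_s[OF cauchy_seq_const[OF e_V] cc]
    by (auto simp: represents_def f_def convergent_LIMSEQ_iff)
  then have f: "f \<in> limits" by (auto simp: limits_def)
  have "(\<lambda>n. lims.nrm (F n - f)) \<longlonglongrightarrow> 0"
  proof (rule Lim_null_comparison)
    show "\<forall>\<^sub>F n in sequentially. norm (lims.nrm (F n - f))
        \<le> lims.nrm (F n - emb (c n)) + lims.nrm (f - emb (c n))"
      using F f cV lims.nrm_triangle3[of "F _" "emb (c _)" f] lims.nrm_minus_commute[of "emb (c _)" f]
      by (intro always_eventually) auto
    show "(\<lambda>n. lims.nrm (F n - emb (c n)) + lims.nrm (f - emb (c n))) \<longlonglongrightarrow> 0"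
      using tendsto_add[OF lim represents_approx[OF rep]] by simp
  qed
  then show ?thesis using f by blast
qed

end

section \<open>Hilbert spaces from positive semidefinite kernels\<close>

definition unit_vec :: "'i \<Rightarrow> 'i \<Rightarrow> complex" where
  "unit_vec i = (\<lambda>j. if j = i then 1 else 0)"

definition fin_supp :: "('i \<Rightarrow> complex) set" where
  "fin_supp = {c. finite {i. c i \<noteq> 0}}"

lemma unit_vec_fin_supp: "unit_vec i \<in> fin_supp"
proof -
  have "{j. unit_vec i j \<noteq> 0} \<subseteq> {i}" by (auto simp: unit_vec_def)
  then show ?thesis by (simp add: fin_supp_def finite_subset)
qed

lemma subspace_fin_supp: "cvs.subspace (fin_supp :: ('i \<Rightarrow> complex) set)"
proof (rule cvs.subspaceI)
  show "x + y \<in> fin_supp" if "x \<in> fin_supp" "y \<in> fin_supp" for x y :: "'i \<Rightarrow> complex"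
    using that
    by (auto simp: fin_supp_def intro: finite_subset[of _ "{i. x i \<noteq> 0} \<union> {i. y i \<noteq> 0}"])
  show "cscale c x \<in> fin_supp" if "x \<in> fin_supp" for c and x :: "'i \<Rightarrow> complex"
    using that by (auto simp: fin_supp_def intro: finite_subset[of _ "{i. x i \<noteq> 0}"])
qed (simp add: fin_supp_def)

lemma fin_supp_expand:
  assumes "finite F" "{i. c i \<noteq> 0} \<subseteq> F"
  shows "c = (\<Sum>i\<in>F. cscale (c i) (unit_vec i))"
proof
  fix x
  have "(\<Sum>i\<in>F. cscale (c i) (unit_vec i)) x = (\<Sum>i\<in>F. if i = x then c x else 0)"
    unfolding sum_fun_apply by (intro sum.cong) (auto simp: unit_vec_def)
  also have "\<dots> = c x" using assms by (auto simp: sum.delta)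
  finally show "c x = (\<Sum>i\<in>F. cscale (c i) (unit_vec i)) x" by simp
qed

locale psd_kernel =
  fixes k :: "'i \<Rightarrow> 'i \<Rightarrow> complex"
  assumes k_cnj: "k j i = cnj (k i j)"
    and k_nonneg: "finite F \<Longrightarrow> Re (\<Sum>i\<in>F. \<Sum>j\<in>F. cnj (c i) * c j * k i j) \<ge> 0"
begin

definition kip :: "('i \<Rightarrow> complex) \<Rightarrow> ('i \<Rightarrow> complex) \<Rightarrow> complex" where
  "kip c d = (\<Sum>i | c i \<noteq> 0. \<Sum>j | d j \<noteq> 0. cnj (c i) * d j * k i j)"

lemma kip_eq:
  assumes "finite F" "{i. c i \<noteq> 0} \<subseteq> F" "finite F'" "{i. d i \<noteq> 0} \<subseteq> F'"
  shows "kip c d = (\<Sum>i\<in>F. \<Sum>j\<in>F'. cnj (c i) * d j * k i j)"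
proof -
  have "kip c d = (\<Sum>i | c i \<noteq> 0. \<Sum>j\<in>F'. cnj (c i) * d j * k i j)"
    unfolding kip_def using assms by (intro sum.cong refl sum.mono_neutral_left) auto
  also have "\<dots> = (\<Sum>i\<in>F. \<Sum>j\<in>F'. cnj (c i) * d j * k i j)"
    using assms by (intro sum.mono_neutral_left) auto
  finally show ?thesis .
qed

sublocale ksp: hilbert_completion fin_supp kip unit_vec
proof
  show "cvs.subspace fin_supp" by (rule subspace_fin_supp)
  show "unit_vec i \<in> fin_supp" for i by (rule unit_vec_fin_supp)
  show "kip u (v + w) = kip u v + kip u w"
    if "u \<in> fin_supp" "v \<in> fin_supp" "w \<in> fin_supp" for u v w
  proof -
    let ?F = "{i. u i \<noteq> 0}" and ?F' = "{i. v i \<noteq> 0} \<union> {i. w i \<noteq> 0}"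
    have fin: "finite ?F" "finite ?F'" using that by (auto simp: fin_supp_def)
    have 1: "kip u v = (\<Sum>i\<in>?F. \<Sum>j\<in>?F'. cnj (u i) * v j * k i j)" by (rule kip_eq[OF fin(1) _ fin(2)]) auto
    have 2: "kip u w = (\<Sum>i\<in>?F. \<Sum>j\<in>?F'. cnj (u i) * w j * k i j)" by (rule kip_eq[OF fin(1) _ fin(2)]) auto
    have 3: "kip u (v + w) = (\<Sum>i\<in>?F. \<Sum>j\<in>?F'. cnj (u i) * (v + w) j * k i j)" by (rule kip_eq[OF fin(1) _ fin(2)]) auto
    show ?thesis unfolding 1 2 3 by (simp add: sum.distrib algebra_simps)
  qed
  show "kip u (cscale c v) = c * kip u v" if "u \<in> fin_supp" "v \<in> fin_supp" for u v c
  proof -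
    let ?F = "{i. u i \<noteq> 0}" and ?F' = "{i. v i \<noteq> 0}"
    have fin: "finite ?F" "finite ?F'" using that by (auto simp: fin_supp_def)
    have 3: "kip u (cscale c v) = (\<Sum>i\<in>?F. \<Sum>j\<in>?F'. cnj (u i) * (cscale c v) j * k i j)" by (rule kip_eq[OF fin(1) _ fin(2)]) auto
    show ?thesis unfolding 3 by (simp add: kip_def sum_distrib_left mult_ac)
  qed
  show "kip v u = cnj (kip u v)" for u v
    unfolding kip_def cnj_sum complex_cnj_mult complex_cnj_cnj k_cnj[symmetric]
    by (subst sum.swap) (simp add: mult_ac)
  show "0 \<le> Re (kip v v)" if "v \<in> fin_supp" for v
    unfolding kip_def using that by (intro k_nonneg) (auto simp: fin_supp_def)
  show "(fin_supp :: ('i \<Rightarrow> complex) set) \<subseteq> cvs.span (range unit_vec)"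
  proof
    fix c :: "'i \<Rightarrow> complex" assume "c \<in> fin_supp"
    then have eq: "c = (\<Sum>i | c i \<noteq> 0. cscale (c i) (unit_vec i))"
      by (intro fin_supp_expand) (auto simp: fin_supp_def)
    show "c \<in> cvs.span (range unit_vec)"
      by (subst eq) (intro cvs.span_sum cvs.span_scale cvs.span_base, auto)
  qed
qed

lemma kip_unit_vec: "kip (unit_vec i) (unit_vec j) = k i j"
  by (subst kip_eq[of "{i}" _ "{j}"]) (auto simp: unit_vec_def)

lemma kip_unit_vec_left: "c \<in> fin_supp \<Longrightarrow> kip (unit_vec i) c = (\<Sum>j | c j \<noteq> 0. c j * k i j)"
  by (subst kip_eq[of "{i}" _ "{j. c j \<noteq> 0}"]) (auto simp: unit_vec_def fin_supp_def)

end

locale invariant_kernel = group G + psd_kernel k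
  for G :: "('g, 'm) monoid_scheme" (structure) and k :: "'g \<times> nat \<Rightarrow> 'g \<times> nat \<Rightarrow> complex" +
  assumes k_outside: "x \<notin> carrier G \<Longrightarrow> k (x, n) j = 0"
    and k_invariant: "\<lbrakk>g \<in> carrier G; x \<in> carrier G; y \<in> carrier G\<rbrakk>
          \<Longrightarrow> k (g \<otimes> x, n) (g \<otimes> y, m) = k (x, n) (y, m)"
begin

definition shift :: "'g \<Rightarrow> ('g \<times> nat \<Rightarrow> complex) \<Rightarrow> 'g \<times> nat \<Rightarrow> complex" where
  "shift g f = (\<lambda>(x, n). if x \<in> carrier G then f (inv g \<otimes> x, n) else 0)"

lemma shift_add: "shift g (u + v) = shift g u + shift g v"
  and shift_diff: "shift g (u - v) = shift g u - shift g v"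
  and shift_scale: "shift g (cscale c u) = cscale c (shift g u)"
  by (auto simp: shift_def fun_eq_iff)

lemma shift_sum: "shift g (\<Sum>i\<in>I. f i) = (\<Sum>i\<in>I. shift g (f i))"
proof (induction I rule: infinite_finite_induct)
  case (insert x F)
  have "shift g (sum f (insert x F)) = shift g (f x + sum f F)"
    using insert(1,2) by (subst sum.insert) auto
  with insert show ?case by (simp only: shift_add) (subst sum.insert, auto)
qed (auto simp: shift_def fun_eq_iff)

lemma shift_unit_vec:
  assumes g: "g \<in> carrier G"
  shows "shift g (unit_vec (x, n)) = (if x \<in> carrier G then unit_vec (g \<otimes> x, n) else 0)"
proof
  fix p :: "'g \<times> nat"
  obtain y m where p: "p = (y, m)" by fastforce
  have "y \<in> carrier G \<Longrightarrow> inv g \<otimes> y = x \<longleftrightarrow> x \<in> carrier G \<and> y = g \<otimes> x"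
    using g by (metis inv_closed inv_solve_left l_inv m_closed)
  then show "shift g (unit_vec (x, n)) p = (if x \<in> carrier G then unit_vec (g \<otimes> x, n) else 0) p"
    using g by (auto simp: shift_def unit_vec_def p)
qed

lemma shift_fin_supp [simp]:
  assumes g: "g \<in> carrier G" and c: "c \<in> fin_supp"
  shows "shift g c \<in> fin_supp"
proof -
  have "c = (\<Sum>i | c i \<noteq> 0. cscale (c i) (unit_vec i))"
    using c by (intro fin_supp_expand) (auto simp: fin_supp_def)
  then have "shift g c = (\<Sum>i | c i \<noteq> 0. cscale (c i) (shift g (unit_vec i)))"
    by (metis (mono_tags, lifting) shift_scale shift_sum sum.cong)
  also have "\<dots> \<in> fin_supp"
    using g by (intro ksp.V_sum ksp.V_scale) (auto simp: shift_unit_vec split: prod.splits)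
  finally show ?thesis .
qed

lemma kip_shift:
  assumes g: "g \<in> carrier G" and c: "c \<in> fin_supp" and d: "d \<in> fin_supp"
  shows "kip (shift g c) (shift g d) = kip c d"
proof -
  have basic: "kip (shift g (unit_vec i)) (shift g (unit_vec j)) = k i j" for i j
  proof -
    obtain x n y m where ij: "i = (x, n)" "j = (y, m)" by (metis surj_pair)
    have "y \<notin> carrier G \<Longrightarrow> k i (y, m) = 0" using k_cnj[of i "(y, m)"] k_outside by simp
    then show ?thesis
      using g k_outside[of x n j] k_invariant[of g x y n m]
      by (auto simp: ij shift_unit_vec kip_unit_vec)
  qed
  have expand: "c' = (\<Sum>i | c' i \<noteq> 0. cscale (c' i) (unit_vec i))" if "c' \<in> fin_supp" for c' :: "'g \<times> nat \<Rightarrow> complex"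
    using that by (intro fin_supp_expand) (auto simp: fin_supp_def)
  have sh: "shift g c' = (\<Sum>i | c' i \<noteq> 0. cscale (c' i) (shift g (unit_vec i)))" if "c' \<in> fin_supp" for c'
    using expand[OF that] by (metis (mono_tags, lifting) shift_scale shift_sum sum.cong)
  have V: "shift g (unit_vec i) \<in> fin_supp" for i
    using g unit_vec_fin_supp by simp
  have "kip (shift g c) (shift g d) = (\<Sum>i | c i \<noteq> 0. cnj (c i) * kip (shift g (unit_vec i)) (shift g d))"
    unfolding sh[OF c] using V g d by (subst ksp.s_sum_left) (simp_all add: ksp.s_scale_left)
  also have "\<dots> = (\<Sum>i | c i \<noteq> 0. cnj (c i) * (\<Sum>j | d j \<noteq> 0. d j * k i j))"
    unfolding sh[OF d] using V
    by (intro sum.cong refl) (simp add: ksp.s_sum_right ksp.s_scale_right basic)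
  also have "\<dots> = kip c d" by (simp add: kip_def sum_distrib_left mult_ac)
  finally show ?thesis .
qed

lemma nrm_shift: "\<lbrakk>g \<in> carrier G; c \<in> fin_supp\<rbrakk> \<Longrightarrow> ksp.nrm (shift g c) = ksp.nrm c"
  by (simp add: ksp.nrm_def kip_shift)

lemma kip_outside: "\<lbrakk>x \<notin> carrier G; c \<in> fin_supp\<rbrakk> \<Longrightarrow> kip (unit_vec (x, n)) c = 0"
  by (simp add: kip_unit_vec_left k_outside)

lemma represents_shift:
  assumes g: "g \<in> carrier G" and X: "ksp.represents X f"
  shows "ksp.represents (\<lambda>n. shift g (X n)) (shift g f)"
  unfolding ksp.represents_def
proof (intro conjI allI)
  have V: "X n \<in> fin_supp" for n using ksp.represents_V[OF X] .
  show "ksp.cauchy_seq (\<lambda>n. shift g (X n))"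
    using X V g by (simp add: ksp.represents_def ksp.cauchy_seq_def shift_diff[symmetric] nrm_shift)
  fix i :: "'g \<times> nat"
  obtain x m where i: "i = (x, m)" by fastforce
  show "(\<lambda>n. kip (unit_vec i) (shift g (X n))) \<longlonglongrightarrow> shift g f i"
  proof (cases "x \<in> carrier G")
    case True
    have "shift g (unit_vec (inv g \<otimes> x, m)) = unit_vec i"
      using g True by (simp add: shift_unit_vec i m_assoc[symmetric])
    then have "kip (unit_vec i) (shift g (X n)) = kip (unit_vec (inv g \<otimes> x, m)) (X n)" for n
      using kip_shift[OF g unit_vec_fin_supp V, of "(inv g \<otimes> x, m)" n] by simp
    then show ?thesis
      using X True by (simp add: ksp.represents_def i shift_def)
  next
    case False
    then have "kip (unit_vec i) (shift g (X n)) = 0" for n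
      using kip_outside[OF False shift_fin_supp[OF g V]] by (simp add: i)
    then show ?thesis using False by (simp add: i shift_def)
  qed
qed

definition krep :: "'g rep" where
  "krep = \<lparr>vecs = ksp.limits, ip = ksp.lip, act = shift\<rparr>"

lemma limits_outside:
  assumes "f \<in> ksp.limits" "x \<notin> carrier G"
  shows "f (x, n) = 0"
proof -
  have "(\<lambda>m. kip (unit_vec (x, n)) (ksp.rep_seq f m)) \<longlonglongrightarrow> f (x, n)"
    using ksp.represents_rep_seq[OF assms(1)] by (simp add: ksp.represents_def)
  then show ?thesis
    using assms ksp.represents_V[OF ksp.represents_rep_seq[OF assms(1)]]
    by (simp add: kip_outside LIMSEQ_const_iff)
qed

lemma hnorm_krep: "hnorm krep = ksp.lims.nrm"
  by (simp add: fun_eq_iff hnorm_def krep_def ksp.lims.nrm_def)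

lemma unitary_rep_krep: "unitary_rep G krep"
proof -
  have "complex_hilbert krep"
  proof
    show "\<exists>v\<in>vecs krep. (\<lambda>n. hnorm krep (X n - v)) \<longlonglongrightarrow> 0"
      if "\<And>n. X n \<in> vecs krep" "\<forall>e>0. \<exists>N. \<forall>m\<ge>N. \<forall>n\<ge>N. hnorm krep (X m - X n) < e" for X
      using that ksp.limits_complete[of X] unfolding hnorm_krep by (simp add: krep_def)
  qed (auto simp: krep_def ksp.lims.subspace_V ksp.lims.s_add_right ksp.lims.s_scale_right
      ksp.limits_pos intro: ksp.lims.s_cnj)
  moreover have "unitary_rep_axioms G krep"
  proof
    fix g v assume g: "g \<in> carrier G" and "v \<in> vecs krep"
    then have v: "v \<in> ksp.limits" by (simp add: krep_def)
    note rv = ksp.represents_rep_seq[OF v]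
    show "act krep g v \<in> vecs krep"
      using represents_shift[OF g rv] by (auto simp: krep_def ksp.limits_def)
    show "act krep g (v + w) = act krep g v + act krep g w" for w
      by (simp add: krep_def shift_add)
    show "act krep g (cscale c v) = cscale c (act krep g v)" for c
      by (simp add: krep_def shift_scale)
    show "ip krep (act krep g v) (act krep g w) = ip krep v w" if "w \<in> vecs krep" for w
    proof -
      have rw: "ksp.represents (ksp.rep_seq w) w"
        using that by (intro ksp.represents_rep_seq) (simp add: krep_def)
      show ?thesis
        using ksp.lip_tendsto[OF rv rw] ksp.represents_V[OF rv] ksp.represents_V[OF rw] g
        by (simp add: krep_def kip_shift ksp.lip_eqI[OF represents_shift[OF g rv] represents_shift[OF g rw]])
    qed
    show "act krep (g \<otimes> h) v = act krep g (act krep h v)" if "h \<in> carrier G" for h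
      using g that by (auto simp: krep_def shift_def fun_eq_iff inv_mult_group m_assoc)
  next
    fix v assume "v \<in> vecs krep"
    then show "act krep \<one> v = v"
      using limits_outside[of v] by (auto simp: krep_def shift_def fun_eq_iff)
  qed
  ultimately show ?thesis
    by (intro unitary_rep.intro) (simp_all add: is_group)
qed

definition kvec :: "nat \<Rightarrow> 'g \<times> nat \<Rightarrow> complex" where
  "kvec n = ksp.emb (unit_vec (\<one>, n))"

lemma emb_scale: "v \<in> fin_supp \<Longrightarrow> ksp.emb (cscale c v) = cscale c (ksp.emb v)"
  by (auto simp: ksp.emb_def fun_eq_iff ksp.s_scale_right)

lemma emb_sum: "(\<And>i. i \<in> I \<Longrightarrow> f i \<in> fin_supp) \<Longrightarrow> ksp.emb (\<Sum>i\<in>I. f i) = (\<Sum>i\<in>I. ksp.emb (f i))"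
  by (auto simp: ksp.emb_def fun_eq_iff ksp.s_sum_right sum_fun_apply)

lemma act_kvec: "g \<in> carrier G \<Longrightarrow> act krep g (kvec n) = ksp.emb (unit_vec (g, n))"
proof -
  assume g: "g \<in> carrier G"
  have "ksp.represents (\<lambda>_. shift g (unit_vec (\<one>, n))) (act krep g (kvec n))"
    using represents_shift[OF g ksp.represents_emb[OF unit_vec_fin_supp]] by (simp add: krep_def kvec_def)
  then have 1: "ksp.represents (\<lambda>_. unit_vec (g, n)) (act krep g (kvec n))"
    using g by (simp add: shift_unit_vec)
  show ?thesis
    using 1 ksp.represents_emb[OF unit_vec_fin_supp, of "(g, n)"]
    by (auto simp: ksp.represents_def fun_eq_iff LIMSEQ_const_iff)
qed

end

theorem (in invariant_kernel) rep_of_kernel: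
  obtains R :: "'g rep" and \<xi> where "unitary_rep G R" "\<And>n. \<xi> n \<in> vecs R"
    "\<And>x y n m. \<lbrakk>x \<in> carrier G; y \<in> carrier G\<rbrakk> \<Longrightarrow> ip R (act R x (\<xi> n)) (act R y (\<xi> m)) = k (x, n) (y, m)"
    "\<And>f \<epsilon>. \<lbrakk>f \<in> vecs R; \<epsilon> > 0\<rbrakk> \<Longrightarrow> \<exists>F c. finite F \<and> F \<subseteq> carrier G \<times> UNIV \<and>
        hnorm R (f - (\<Sum>(x, n)\<in>F. cscale (c (x, n)) (act R x (\<xi> n)))) < \<epsilon>"
proof (rule that[of krep kvec])
  show "unitary_rep G krep" by (rule unitary_rep_krep)
  show "kvec n \<in> vecs krep" for n by (simp add: krep_def kvec_def)
  show "ip krep (act krep x (kvec n)) (act krep y (kvec m)) = k (x, n) (y, m)"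
    if "x \<in> carrier G" "y \<in> carrier G" for x y n m
    using that by (simp add: act_kvec) (simp add: krep_def ksp.lip_emb kip_unit_vec)
  fix f \<epsilon> assume "f \<in> vecs krep" "\<epsilon> > (0 :: real)"
  then obtain v where v: "v \<in> fin_supp" "ksp.lims.nrm (f - ksp.emb v) < \<epsilon>"
    using ksp.limits_approx[of f \<epsilon>] by (auto simp: krep_def)
  define F where "F = {i. v i \<noteq> 0} \<inter> carrier G \<times> UNIV"
  have fin: "finite {i. v i \<noteq> 0}" using v by (simp add: fin_supp_def)
  have "v = (\<Sum>i | v i \<noteq> 0. cscale (v i) (unit_vec i))"
    using fin by (intro fin_supp_expand) auto
  then have "ksp.emb v = ksp.emb (\<Sum>i | v i \<noteq> 0. cscale (v i) (unit_vec i))" by simp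
  also have "\<dots> = (\<Sum>i | v i \<noteq> 0. cscale (v i) (ksp.emb (unit_vec i)))"
    by (simp add: emb_sum emb_scale)
  also have "\<dots> = (\<Sum>i\<in>F. cscale (v i) (ksp.emb (unit_vec i)))"
  proof (rule sum.mono_neutral_right[OF fin])
    show "\<forall>i\<in>{i. v i \<noteq> 0} - F. cscale (v i) (ksp.emb (unit_vec i)) = 0"
    proof
      fix i assume "i \<in> {i. v i \<noteq> 0} - F"
      then obtain x n where i: "i = (x, n)" "x \<notin> carrier G" by (cases i) (auto simp: F_def)
      have "kip (unit_vec j) (unit_vec i) = 0" for j
        using ksp.s_cnj[of "unit_vec i" "unit_vec j"] i by (simp add: kip_outside unit_vec_fin_supp)
      then show "cscale (v i) (ksp.emb (unit_vec i)) = 0" by (auto simp: ksp.emb_def fun_eq_iff)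
    qed
  qed (auto simp: F_def)
  also have "\<dots> = (\<Sum>(x, n)\<in>F. cscale (v (x, n)) (act krep x (kvec n)))"
    by (intro sum.cong refl) (auto simp: F_def act_kvec)
  finally have "hnorm krep (f - (\<Sum>(x, n)\<in>F. cscale (v (x, n)) (act krep x (kvec n)))) < \<epsilon>"
    using v(2) by (simp add: hnorm_krep)
  then show "\<exists>F c. finite F \<and> F \<subseteq> carrier G \<times> UNIV \<and>
        hnorm krep (f - (\<Sum>(x, n)\<in>F. cscale (c (x, n)) (act krep x (kvec n)))) < \<epsilon>"
    using fin by (intro exI[of _ F] exI[of _ v]) (auto simp: F_def)
qed

section \<open>Hilbert space geometry\<close>

sublocale complex_hilbert \<subseteq> semi_ip "vecs H" "ip H"
  rewrites "semi_ip.nrm (ip H) = hnorm H"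
proof -
  show "semi_ip (vecs H) (ip H)"
  proof
    show "0 \<le> Re (ip H v v)" if "v \<in> vecs H" for v
    proof (cases "v = 0")
      case True
      have "0 \<in> vecs H" by (rule cvs.subspace_0[OF subspace_vecs])
      then have "ip H 0 (cscale 0 0) = 0 * ip H 0 0" by (intro ip_scale)
      then show ?thesis using True by simp
    qed (use ip_pos that less_imp_le in blast)
  qed (fact subspace_vecs ip_add ip_scale ip_cnj)+
  then show "semi_ip.nrm (ip H) = hnorm H"
    by (simp add: fun_eq_iff semi_ip.nrm_def hnorm_def)
qed

definition orthonormal :: "('i, 'r) hilbert_scheme \<Rightarrow> ('i \<Rightarrow> complex) set \<Rightarrow> bool" where
  "orthonormal H E \<longleftrightarrow> finite E \<and> E \<subseteq> vecs H \<and> (\<forall>e\<in>E. \<forall>e'\<in>E. ip H e e' = (if e = e' then 1 else 0))"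

definition proj :: "('i, 'r) hilbert_scheme \<Rightarrow> ('i \<Rightarrow> complex) set \<Rightarrow> ('i \<Rightarrow> complex) \<Rightarrow> 'i \<Rightarrow> complex" where
  "proj H E v = (\<Sum>e\<in>E. cscale (ip H e v) e)"

context complex_hilbert
begin

lemma hnorm_eq_0: "v \<in> vecs H \<Longrightarrow> hnorm H v = 0 \<longleftrightarrow> v = 0"
  using ip_pos[of v] nrm_zero by (cases "v = 0") (simp, simp add: hnorm_def)

lemma ip_ext:
  assumes "u \<in> vecs H" "v \<in> vecs H" "\<And>w. w \<in> vecs H \<Longrightarrow> ip H w u = ip H w v"
  shows "u = v"
proof -
  have "ip H (u - v) (u - v) = 0" using assms by (simp add: s_diff_right)
  then have "u - v = 0" using ip_pos[of "u - v"] assms by force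
  then show ?thesis by simp
qed

lemma hnorm_tendsto_imp_ip:
  assumes "\<And>n. X n \<in> vecs H" "v \<in> vecs H" "u \<in> vecs H" "(\<lambda>n. hnorm H (X n - v)) \<longlonglongrightarrow> 0"
  shows "(\<lambda>n. ip H u (X n)) \<longlonglongrightarrow> ip H u v"
  using s_tendsto[of "\<lambda>_. u" X u v] assms by simp

lemma hnorm_tendsto:
  assumes "\<And>n. X n \<in> vecs H" "v \<in> vecs H" "(\<lambda>n. hnorm H (X n - v)) \<longlonglongrightarrow> 0"
  shows "(\<lambda>n. hnorm H (X n)) \<longlonglongrightarrow> hnorm H v"
  unfolding hnorm_def by (intro tendsto_real_sqrt tendsto_Re s_tendsto assms)

theorem projection:
  assumes F: "cvs.subspace F" "F \<subseteq> vecs H"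
    and closed: "\<And>X v. \<lbrakk>\<And>n. X n \<in> F; v \<in> vecs H; (\<lambda>n. hnorm H (X n - v)) \<longlonglongrightarrow> 0\<rbrakk> \<Longrightarrow> v \<in> F"
    and u: "u \<in> vecs H"
  obtains w where "w \<in> F" "\<And>v. v \<in> F \<Longrightarrow> ip H v (u - w) = 0"
proof -
  define d where "d = Inf ((\<lambda>w. (hnorm H (u - w))\<^sup>2) ` F)"
  have F0: "0 \<in> F" using F cvs.subspace_0 by blast
  have bdd: "bdd_below ((\<lambda>w. (hnorm H (u - w))\<^sup>2) ` F)" by (rule bdd_belowI[of _ 0]) auto
  have d_le: "d \<le> (hnorm H (u - w))\<^sup>2" if "w \<in> F" for w
    unfolding d_def using bdd that by (intro cInf_lower) auto
  have "\<exists>w\<in>F. (hnorm H (u - w))\<^sup>2 < d + inverse (real (Suc n))" for n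
  proof -
    have "d < d + inverse (real (Suc n))" by simp
    then show ?thesis unfolding d_def using F0 bdd by (subst (asm) cInf_less_iff) auto
  qed
  then obtain w where wF: "\<And>n. w n \<in> F" and w: "\<And>n. (hnorm H (u - w n))\<^sup>2 < d + inverse (real (Suc n))"
    by metis
  have wV: "w n \<in> vecs H" for n using wF F by blast
  have gap: "(hnorm H (w m - w n))\<^sup>2 \<le> 2 * inverse (real (Suc m)) + 2 * inverse (real (Suc n))" for m n
  proof -
    let ?c = "cscale (1/2) (w m + w n)"
    have "w m + w n \<in> F" "?c \<in> F" using F wF by (auto intro: cvs.subspace_add cvs.subspace_scale)
    have eq: "(u - w m) + (u - w n) = cscale 2 (u - ?c)"
      by (auto simp: fun_eq_iff algebra_simps)
    have "(hnorm H (cscale 2 (u - ?c)))\<^sup>2 = 4 * (hnorm H (u - ?c))\<^sup>2"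
      using u wV by (subst nrm_scale) (auto simp: power_mult_distrib)
    moreover have "(u - w m) - (u - w n) = w n - w m" by simp
    ultimately have "4 * (hnorm H (u - ?c))\<^sup>2 + (hnorm H (w n - w m))\<^sup>2
        = 2 * (hnorm H (u - w m))\<^sup>2 + 2 * (hnorm H (u - w n))\<^sup>2"
      using parallelogram[of "u - w m" "u - w n"] u wV eq by simp
    then show ?thesis
      using d_le[OF \<open>?c \<in> F\<close>] w[of m] w[of n] nrm_minus_commute[OF wV wV, of n m] by simp
  qed
  have "\<forall>e>0. \<exists>N. \<forall>m\<ge>N. \<forall>n\<ge>N. hnorm H (w m - w n) < e"
  proof (intro allI impI)
    fix e :: real assume e: "e > 0"
    then obtain N where N: "inverse (real (Suc N)) < e\<^sup>2 / 4"
      using reals_Archimedean[of "e\<^sup>2 / 4"] by auto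
    have "hnorm H (w m - w n) < e" if "m \<ge> N" "n \<ge> N" for m n
    proof -
      have "inverse (real (Suc m)) \<le> inverse (real (Suc N))" "inverse (real (Suc n)) \<le> inverse (real (Suc N))"
        using that by (simp_all add: le_imp_inverse_le)
      then have "(hnorm H (w m - w n))\<^sup>2 < e\<^sup>2" using gap[of m n] N by linarith
      then show ?thesis using e power2_less_imp_less[of "hnorm H (w m - w n)" e] by simp
    qed
    then show "\<exists>N. \<forall>m\<ge>N. \<forall>n\<ge>N. hnorm H (w m - w n) < e" by blast
  qed
  from complete[OF wV this] obtain p where p: "p \<in> vecs H" "(\<lambda>n. hnorm H (w n - p)) \<longlonglongrightarrow> 0"
    by blast
  have pF: "p \<in> F" by (rule closed[OF wF p])
  have pd: "(hnorm H (u - p))\<^sup>2 \<le> d"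
  proof -
    have "(\<lambda>n. hnorm H ((u - w n) - (u - p))) \<longlonglongrightarrow> 0"
      using p nrm_minus_commute[OF wV p(1)] by (simp add: algebra_simps)
    then have "(\<lambda>n. (hnorm H (u - w n))\<^sup>2) \<longlonglongrightarrow> (hnorm H (u - p))\<^sup>2"
      using u p wV by (intro tendsto_power hnorm_tendsto) auto
    moreover have "(\<lambda>n. d + inverse (real (Suc n))) \<longlonglongrightarrow> d + 0"
      by (intro tendsto_add tendsto_const LIMSEQ_inverse_real_of_nat)
    ultimately show ?thesis
      using w by (intro LIMSEQ_le[where Y="\<lambda>n. d + inverse (real (Suc n))"]) (auto intro: less_imp_le)
  qed
  have "ip H v (u - p) = 0" if v: "v \<in> F" for v
  proof (rule ccontr)
    assume "\<not> ?thesis"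
    define b where "b = ip H v (u - p)"
    have b: "cmod b > 0" using \<open>\<not> _\<close> by (simp add: b_def)
    have vV: "v \<in> vecs H" using v F by blast
    define l where "l = inverse ((hnorm H v)\<^sup>2 + 1)"
    have hv: "(hnorm H v)\<^sup>2 + 1 > 0" by (simp add: add_nonneg_pos)
    then have "l * ((hnorm H v)\<^sup>2 + 1) = 1" "l > 0" by (simp_all add: l_def)
    then have l: "l > 0" "l * (hnorm H v)\<^sup>2 < 1" by (simp_all add: algebra_simps)
    have ring: "y - 2 * (l * c) + l * (l * h) * c = y - l * c * (2 - l * h)" for y c h :: real
      by (simp add: algebra_simps)
    define z where "z = cscale (of_real l * b) v"
    have z: "z \<in> vecs H" using vV by (simp add: z_def)
    have 1: "(hnorm H ((u - p) - z))\<^sup>2 = (hnorm H (u - p))\<^sup>2 - 2 * Re (ip H (u - p) z) + (hnorm H z)\<^sup>2"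
      using u p z by (intro nrm_diff_sq) auto
    have 2: "ip H (u - p) z = of_real (l * (cmod b)\<^sup>2)"
      using u p vV ip_cnj[of v "u - p"] by (simp add: z_def s_scale_right b_def[symmetric] cmod_sq)
    have 3: "(hnorm H z)\<^sup>2 = l * (l * (hnorm H v)\<^sup>2) * (cmod b)\<^sup>2"
      unfolding z_def using vV l
      by (subst nrm_scale) (auto simp: norm_mult power_mult_distrib power2_eq_square)
    have "(hnorm H ((u - p) - z))\<^sup>2 = (hnorm H (u - p))\<^sup>2 - l * (cmod b)\<^sup>2 * (2 - l * (hnorm H v)\<^sup>2)"
      unfolding 1 2 3 Re_complex_of_real by (rule ring)
    moreover have "l * (cmod b)\<^sup>2 * (2 - l * (hnorm H v)\<^sup>2) > 0" using l b by (intro mult_pos_pos) auto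
    moreover have "d \<le> (hnorm H (u - (p + z)))\<^sup>2"
      unfolding z_def using F v pF by (intro d_le) (auto intro: cvs.subspace_add cvs.subspace_scale)
    ultimately show False using pd by (simp add: diff_diff_eq)
  qed
  then show ?thesis using that pF by blast
qed

lemma orth_proj_eq:
  assumes F: "cvs.subspace F" "F \<subseteq> vecs H" and u: "u \<in> vecs H"
    and w: "w \<in> F" "\<And>v. v \<in> F \<Longrightarrow> ip H v (u - w) = 0"
  shows "orth_proj H F u = w"
  unfolding orth_proj_def
proof (rule the_equality)
  fix w' assume w': "w' \<in> F \<and> (\<forall>v\<in>F. ip H v (u - w') = 0)"
  have d: "w' - w \<in> F" using F w w' by (auto intro: cvs.subspace_diff)
  have V: "w \<in> vecs H" "w' \<in> vecs H" "w' - w \<in> vecs H" using F w w' d by auto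
  have "w' - w = (u - w) - (u - w')" by simp
  then have "ip H (w' - w) (w' - w) = ip H (w' - w) (u - w) - ip H (w' - w) (u - w')"
    using V u by (metis s_diff_right V_diff)
  also have "\<dots> = 0" using w(2)[OF d] w' d by simp
  finally have "w' - w = 0" using ip_pos[OF V(3)] by force
  then show "w' = w" by simp
qed (use w in blast)

lemma orthonormal_vecs: "\<lbrakk>orthonormal H E; e \<in> E\<rbrakk> \<Longrightarrow> e \<in> vecs H"
  by (auto simp: orthonormal_def)

lemma orthonormal_finite: "orthonormal H E \<Longrightarrow> finite E"
  by (simp add: orthonormal_def)

lemma orthonormal_ip: "\<lbrakk>orthonormal H E; e \<in> E; e' \<in> E\<rbrakk> \<Longrightarrow> ip H e e' = (if e = e' then 1 else 0)"
  by (simp add: orthonormal_def)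

lemma orthonormal_hnorm: "\<lbrakk>orthonormal H E; e \<in> E\<rbrakk> \<Longrightarrow> hnorm H e = 1"
  by (simp add: orthonormal_def hnorm_def)

lemma span_vecs: "E \<subseteq> vecs H \<Longrightarrow> cvs.span E \<subseteq> vecs H"
  using cvs.span_minimal subspace_vecs by blast

lemma orthonormal_span_vecs: "\<lbrakk>orthonormal H E; v \<in> cvs.span E\<rbrakk> \<Longrightarrow> v \<in> vecs H"
  using span_vecs by (auto simp: orthonormal_def)

lemma proj_span: "proj H E v \<in> cvs.span E"
  unfolding proj_def by (intro cvs.span_sum cvs.span_scale cvs.span_base)

lemma proj_vecs: "orthonormal H E \<Longrightarrow> proj H E v \<in> vecs H"
  using proj_span orthonormal_span_vecs by blast

lemma ip_proj:
  assumes E: "orthonormal H E" and e: "e \<in> E"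
  shows "ip H e (proj H E v) = ip H e v"
proof -
  have "ip H e (proj H E v) = (\<Sum>e'\<in>E. ip H e' v * ip H e e')"
    unfolding proj_def using E e
    by (subst s_sum_right) (auto simp: orthonormal_vecs s_scale_right)
  also have "\<dots> = (\<Sum>e'\<in>E. if e' = e then ip H e v else 0)"
    using E e by (intro sum.cong) (auto simp: orthonormal_ip)
  also have "\<dots> = ip H e v" using E e by (simp add: orthonormal_finite)
  finally show ?thesis .
qed

lemma ip_span_eq_0:
  assumes "v \<in> vecs H" "E \<subseteq> vecs H" "\<And>e. e \<in> E \<Longrightarrow> ip H e v = 0" "w \<in> cvs.span E"
  shows "ip H w v = 0"
proof -
  have "cvs.subspace {w \<in> vecs H. ip H w v = 0}"
    using assms by (intro cvs.subspaceI) (auto simp: s_add_left s_scale_left)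
  then have "cvs.span E \<subseteq> {w \<in> vecs H. ip H w v = 0}"
    using assms by (intro cvs.span_minimal) auto
  then show ?thesis using assms by auto
qed

lemma proj_orth:
  assumes E: "orthonormal H E" and v: "v \<in> vecs H" and w: "w \<in> cvs.span E"
  shows "ip H w (v - proj H E v) = 0"
  using assms by (intro ip_span_eq_0[OF _ _ _ w])
    (auto simp: proj_vecs s_diff_right orthonormal_vecs ip_proj)

lemma proj_id:
  assumes E: "orthonormal H E" and v: "v \<in> cvs.span E"
  shows "proj H E v = v"
proof -
  have V: "v \<in> vecs H" using assms orthonormal_span_vecs by blast
  have d: "v - proj H E v \<in> cvs.span E" by (intro cvs.span_diff v proj_span)
  from proj_orth[OF E V d] have "v - proj H E v = 0"
    using ip_pos[of "v - proj H E v"] V proj_vecs[OF E] by force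
  then show ?thesis by simp
qed

lemma parseval:
  assumes E: "orthonormal H E" and v: "v \<in> vecs H" and w: "w \<in> cvs.span E"
  shows "ip H w v = (\<Sum>e\<in>E. cnj (ip H e w) * ip H e v)"
proof -
  have "ip H w v = ip H (proj H E w) v" using proj_id[OF E w] by simp
  also have "\<dots> = (\<Sum>e\<in>E. cnj (ip H e w) * ip H e v)"
    unfolding proj_def using E v by (subst s_sum_left) (auto simp: orthonormal_vecs s_scale_left)
  finally show ?thesis .
qed

lemma hnorm_span_sq:
  assumes E: "orthonormal H E" and w: "w \<in> cvs.span E"
  shows "(hnorm H w)\<^sup>2 = (\<Sum>e\<in>E. (cmod (ip H e w))\<^sup>2)"
proof -
  have V: "w \<in> vecs H" using assms orthonormal_span_vecs by blast
  have "complex_of_real ((hnorm H w)\<^sup>2) = of_real (\<Sum>e\<in>E. (cmod (ip H e w))\<^sup>2)"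
    unfolding s_self_nrm[OF V, symmetric] parseval[OF E V w] by (simp add: cmod_sq mult.commute)
  then show ?thesis by (simp only: of_real_eq_iff)
qed

lemma hnorm_proj_sq:
  assumes E: "orthonormal H E"
  shows "(hnorm H (proj H E v))\<^sup>2 = (\<Sum>e\<in>E. (cmod (ip H e v))\<^sup>2)"
  unfolding hnorm_span_sq[OF E proj_span] by (intro sum.cong) (auto simp: ip_proj[OF E])

lemma pythagoras:
  assumes "u \<in> vecs H" "v \<in> vecs H" "ip H u v = 0"
  shows "(hnorm H (u + v))\<^sup>2 = (hnorm H u)\<^sup>2 + (hnorm H v)\<^sup>2"
  using nrm_add_sq[of u v] assms by simp

lemma hnorm_proj_pythagoras:
  assumes E: "orthonormal H E" and v: "v \<in> vecs H"
  shows "(hnorm H v)\<^sup>2 = (hnorm H (proj H E v))\<^sup>2 + (hnorm H (v - proj H E v))\<^sup>2"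
  using pythagoras[of "proj H E v" "v - proj H E v"] proj_vecs[OF E] v proj_orth[OF E v proj_span]
  by simp

lemma bessel:
  assumes E: "orthonormal H E" and v: "v \<in> vecs H"
  shows "(\<Sum>e\<in>E. (cmod (ip H e v))\<^sup>2) \<le> (hnorm H v)\<^sup>2"
  using hnorm_proj_pythagoras[OF assms] hnorm_proj_sq[OF E, of v] by simp

lemma orthonormal_independent:
  assumes E: "orthonormal H E"
  shows "cvs.independent E"
proof
  assume "cvs.dependent E"
  then obtain e where e: "e \<in> E" "e \<in> cvs.span (E - {e})" unfolding cvs.dependent_def by blast
  have "ip H e e = 0"
    using E e by (intro ip_span_eq_0[OF _ _ _ e(2)]) (auto simp: orthonormal_vecs orthonormal_ip)
  then show False using E e by (simp add: orthonormal_ip)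
qed

lemma dim_orthonormal: "orthonormal H E \<Longrightarrow> cvs.dim (cvs.span E) = card E"
  using orthonormal_independent cvs.dim_span_eq_card_independent by blast

lemma orthonormal_insert:
  assumes E: "orthonormal H E" and v: "v \<in> vecs H" "v \<notin> cvs.span E"
  defines "e \<equiv> cscale (1 / of_real (hnorm H (v - proj H E v))) (v - proj H E v)"
  shows "e \<notin> cvs.span E" "orthonormal H (insert e E)"
proof -
  let ?u = "v - proj H E v"
  have u: "?u \<in> vecs H" using E v proj_vecs by simp
  have "?u \<noteq> 0" using v proj_span[of E v] by auto
  then have n: "hnorm H ?u > 0" using u hnorm_eq_0 nrm_nonneg[OF u] by fastforce
  show ne: "e \<notin> cvs.span E"
  proof
    assume "e \<in> cvs.span E"
    then have "cscale (of_real (hnorm H ?u)) e \<in> cvs.span E" by (rule cvs.span_scale)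
    also have "cscale (of_real (hnorm H ?u)) e = ?u" using n by (simp add: e_def)
    finally have "?u + proj H E v \<in> cvs.span E" using proj_span by (rule cvs.span_add)
    then show False using v by simp
  qed
  have eV: "e \<in> vecs H" using u by (simp add: e_def)
  have "hnorm H e = 1" unfolding e_def using u n by (subst nrm_scale) (auto simp: norm_divide)
  then have 1: "ip H e e = 1" using s_self_nrm[OF eV] by simp
  have z: "ip H e' e = 0" if "e' \<in> E" for e'
    using E v u that proj_orth[OF E v(1) cvs.span_base[OF that]]
    by (simp add: e_def s_scale_right orthonormal_vecs)
  have z': "ip H e e' = 0" if "e' \<in> E" for e'
    using z[OF that] ip_cnj[OF _ eV, of e'] E that by (simp add: orthonormal_vecs)
  have "e \<notin> E" using ne cvs.span_base by blast
  then show "orthonormal H (insert e E)"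
    using E eV 1 z z' by (auto simp: orthonormal_def)
qed

lemma ex_orthonormal_basis:
  assumes W: "cvs.subspace W" "W \<subseteq> vecs H"
    and bound: "\<And>E. \<lbrakk>orthonormal H E; E \<subseteq> W\<rbrakk> \<Longrightarrow> card E \<le> N"
  obtains E where "orthonormal H E" "cvs.span E = W"
proof -
  define P where "P n \<longleftrightarrow> (\<exists>E. orthonormal H E \<and> E \<subseteq> W \<and> card E = n)" for n
  have "P 0" unfolding P_def by (intro exI[of _ "{}"]) (auto simp: orthonormal_def)
  moreover have "\<forall>n. P n \<longrightarrow> n \<le> N" using bound by (auto simp: P_def)
  ultimately obtain n where n: "P n" "\<And>m. P m \<Longrightarrow> m \<le> n"
    using GreatestI_nat[of P 0 N] Greatest_le_nat[of P _ N] by blast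
  then obtain E where E: "orthonormal H E" "E \<subseteq> W" "card E = n" by (auto simp: P_def)
  have sub: "cvs.span E \<subseteq> W" using E W by (intro cvs.span_minimal)
  have "v \<in> cvs.span E" if "v \<in> W" for v
  proof (rule ccontr)
    assume nv: "v \<notin> cvs.span E"
    define e where "e = cscale (1 / of_real (hnorm H (v - proj H E v))) (v - proj H E v)"
    have "v \<in> vecs H" using that W by blast
    note e = orthonormal_insert[OF E(1) this nv, folded e_def]
    have "e \<in> W" unfolding e_def using W that sub proj_span[of E v]
      by (intro cvs.subspace_scale cvs.subspace_diff) auto
    moreover have "card (insert e E) = Suc n"
      using E e cvs.span_base[of e E] by (simp add: orthonormal_finite card_insert_if) blast
    ultimately have "P (Suc n)" unfolding P_def using e E by (intro exI[of _ "insert e E"]) auto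
    then show False using n(2) by fastforce
  qed
  then show ?thesis using that E sub by blast
qed

lemma ex_orthonormal_basis_span:
  assumes "finite B" "B \<subseteq> vecs H" "cvs.subspace W" "W \<subseteq> cvs.span B"
  obtains E where "orthonormal H E" "cvs.span E = W"
proof (rule ex_orthonormal_basis[of W "card B"])
  show "W \<subseteq> vecs H" using assms span_vecs by blast
  show "card E \<le> card B" if "orthonormal H E" "E \<subseteq> W" for E
    using cvs.independent_span_bound[OF assms(1) orthonormal_independent[OF that(1)]] that assms
    by blast
qed (use assms in auto)

lemma complex_hilbert_span:
  assumes E: "orthonormal H E" and r: "vecs H' = cvs.span E" "ip H' = ip H"
  shows "complex_hilbert H'"
proof
  have sub: "cvs.span E \<subseteq> vecs H" using E orthonormal_span_vecs by blast
  have hn: "hnorm H' = hnorm H" by (simp add: fun_eq_iff hnorm_def r)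
  show "cvs.subspace (vecs H')" by (simp add: r)
  show "ip H' u (v + w) = ip H' u v + ip H' u w" if "u \<in> vecs H'" "v \<in> vecs H'" "w \<in> vecs H'" for u v w
    using that sub by (simp add: r s_add_right subset_iff)
  show "ip H' u (cscale c v) = c * ip H' u v" if "u \<in> vecs H'" "v \<in> vecs H'" for u v c
    using that sub by (simp add: r s_scale_right subset_iff)
  show "ip H' v u = cnj (ip H' u v)" if "u \<in> vecs H'" "v \<in> vecs H'" for u v
    unfolding r using that sub by (intro ip_cnj) (auto simp: r)
  show "0 < Re (ip H' v v)" if "v \<in> vecs H'" "v \<noteq> 0" for v
    using that sub ip_pos by (simp add: r subset_iff)
  show "\<exists>v\<in>vecs H'. (\<lambda>n. hnorm H' (X n - v)) \<longlonglongrightarrow> 0"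
    if X: "\<And>n. X n \<in> vecs H'" and cau: "\<forall>e>0. \<exists>N. \<forall>m\<ge>N. \<forall>n\<ge>N. hnorm H' (X m - X n) < e" for X
  proof -
    have XS: "X n \<in> cvs.span E" for n using X r by simp
    have XV: "X n \<in> vecs H" for n using XS sub by blast
    obtain v where v: "v \<in> vecs H" "(\<lambda>n. hnorm H (X n - v)) \<longlonglongrightarrow> 0"
      using complete[of X, OF XV] cau hn by auto
    have le: "hnorm H (v - proj H E v) \<le> hnorm H (X n - v)" for n
    proof (rule power2_le_imp_le)
      have "X n - proj H E v \<in> cvs.span E" using XS proj_span by (rule cvs.span_diff)
      then have "ip H (X n - proj H E v) (- (v - proj H E v)) = 0"
        using proj_orth[OF E v(1)] XV v proj_vecs[OF E]
        by (subst s_minus_right) (simp_all del: minus_diff_eq)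
      from pythagoras[OF _ _ this]
      have "(hnorm H (X n - v))\<^sup>2 = (hnorm H (X n - proj H E v))\<^sup>2 + (hnorm H (- (v - proj H E v)))\<^sup>2"
        using XV v proj_vecs[OF E] by simp
      also have "hnorm H (- (v - proj H E v)) = hnorm H (v - proj H E v)"
        using v proj_vecs[OF E] nrm_minus_commute by simp
      finally have eq: "(hnorm H (X n - v))\<^sup>2 = (hnorm H (X n - proj H E v))\<^sup>2 + (hnorm H (v - proj H E v))\<^sup>2" .
      show "(hnorm H (v - proj H E v))\<^sup>2 \<le> (hnorm H (X n - v))\<^sup>2"
        unfolding eq by (simp only: le_add_same_cancel2 zero_le_power2)
      show "0 \<le> hnorm H (X n - v)" using XV v by simp
    qed
    have "hnorm H (v - proj H E v) \<le> 0"
      by (rule tendsto_lowerbound[OF v(2)]) (auto intro: always_eventually le)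
    moreover have "hnorm H (v - proj H E v) \<ge> 0" using v proj_vecs[OF E] by simp
    ultimately have "v - proj H E v = 0"
      using hnorm_eq_0[of "v - proj H E v"] v proj_vecs[OF E] by simp
    then have "v \<in> cvs.span E" using proj_span[of E v] by simp
    then show ?thesis using v hn r by auto
  qed
qed

lemma hdim_span:
  assumes E: "orthonormal H E" and "vecs H' = cvs.span E"
  shows "hdim H' = enat (card E)"
  using assms dim_orthonormal[OF E] orthonormal_finite[OF E] by (auto simp: hdim_def)

end

section \<open>Finite-dimensional subrepresentations\<close>

context complex_hilbert
begin

lemma orthonormal_Un:
  assumes E: "orthonormal H E" and F: "orthonormal H F"
    and EF: "\<And>e f. \<lbrakk>e \<in> E; f \<in> F\<rbrakk> \<Longrightarrow> ip H e f = 0"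
  shows "orthonormal H (E \<union> F)" "E \<inter> F = {}"
proof -
  show disj: "E \<inter> F = {}"
    using EF orthonormal_ip[OF E] by fastforce
  have FE: "ip H f e = 0" if "e \<in> E" "f \<in> F" for e f
    using EF[OF that] ip_cnj[of e f] that E F by (simp add: orthonormal_vecs)
  show "orthonormal H (E \<union> F)"
    using E F EF FE disj by (auto simp: orthonormal_def)
qed

lemma proj_add:
  assumes "orthonormal H E" "u \<in> vecs H" "v \<in> vecs H"
  shows "proj H E (u + v) = proj H E u + proj H E v"
proof -
  have "proj H E (u + v) = (\<Sum>e\<in>E. cscale (ip H e u) e + cscale (ip H e v) e)"
    unfolding proj_def using assms
    by (intro sum.cong refl) (simp add: s_add_right orthonormal_vecs cvs.scale_left_distrib)
  then show ?thesis by (simp only: proj_def sum.distrib)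
qed

lemma proj_eq_0:
  assumes "\<And>e. e \<in> E \<Longrightarrow> ip H e v = 0"
  shows "proj H E v = 0"
  unfolding proj_def using assms by (intro sum.neutral) simp

lemma proj_unique:
  assumes E: "orthonormal H E" and v: "v \<in> vecs H" and w: "w \<in> cvs.span E"
    and orth: "\<And>e. e \<in> E \<Longrightarrow> ip H e (v - w) = 0"
  shows "proj H E v = w"
proof -
  have wV: "w \<in> vecs H" using E w orthonormal_span_vecs by blast
  have "proj H E (w + (v - w)) = proj H E w + proj H E (v - w)"
    using E wV v by (intro proj_add) auto
  then show ?thesis using proj_id[OF E w] proj_eq_0[of E "v - w", OF orth] by simp
qed

lemma schur_product:
  assumes fin: "finite F" and A: "\<And>i. i \<in> F \<Longrightarrow> A i \<in> vecs H" and B: "\<And>i. i \<in> F \<Longrightarrow> B i \<in> vecs H"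
  shows "Re (\<Sum>i\<in>F. \<Sum>j\<in>F. cnj (c i) * c j * (ip H (A i) (A j) * cnj (ip H (B i) (B j)))) \<ge> 0"
proof -
  obtain U where U: "orthonormal H U" "cvs.span U = cvs.span (B ` F)"
    using ex_orthonormal_basis_span[of "B ` F" "cvs.span (B ` F)"] fin B by auto
  have UV: "u \<in> vecs H" if "u \<in> U" for u using U that orthonormal_vecs by blast
  define x where "x u = (\<Sum>i\<in>F. cscale (c i * cnj (ip H u (B i))) (A i))" for u
  have xV: "x u \<in> vecs H" for u unfolding x_def using A by (intro V_sum) auto
  have exp: "cnj (ip H (B i) (B j)) = (\<Sum>u\<in>U. ip H u (B i) * cnj (ip H u (B j)))" if "i \<in> F" "j \<in> F" for i j
    using parseval[OF U(1) B[OF that(2)], of "B i"] U(2) that by (simp add: cvs.span_base)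
  have "(\<Sum>i\<in>F. \<Sum>j\<in>F. cnj (c i) * c j * (ip H (A i) (A j) * cnj (ip H (B i) (B j))))
      = (\<Sum>i\<in>F. \<Sum>j\<in>F. \<Sum>u\<in>U. (cnj (c i) * ip H u (B i)) * ((c j * cnj (ip H u (B j))) * ip H (A i) (A j)))"
    by (intro sum.cong refl) (simp add: exp sum_distrib_left mult_ac)
  also have "\<dots> = (\<Sum>i\<in>F. \<Sum>u\<in>U. \<Sum>j\<in>F. (cnj (c i) * ip H u (B i)) * ((c j * cnj (ip H u (B j))) * ip H (A i) (A j)))"
    by (intro sum.cong refl sum.swap)
  also have "\<dots> = (\<Sum>u\<in>U. \<Sum>i\<in>F. \<Sum>j\<in>F. (cnj (c i) * ip H u (B i)) * ((c j * cnj (ip H u (B j))) * ip H (A i) (A j)))"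
    by (rule sum.swap)
  also have "\<dots> = (\<Sum>u\<in>U. ip H (x u) (x u))"
  proof (rule sum.cong[OF refl])
    fix u
    have "ip H (x u) (x u) = (\<Sum>i\<in>F. (cnj (c i) * ip H u (B i)) * ip H (A i) (x u))"
      using A xV by (subst x_def) (simp add: s_sum_left s_scale_left)
    also have "\<dots> = (\<Sum>i\<in>F. \<Sum>j\<in>F. (cnj (c i) * ip H u (B i)) * ((c j * cnj (ip H u (B j))) * ip H (A i) (A j)))"
      using A by (intro sum.cong refl) (simp add: x_def s_sum_right s_scale_right sum_distrib_left)
    finally show "(\<Sum>i\<in>F. \<Sum>j\<in>F. (cnj (c i) * ip H u (B i)) * ((c j * cnj (ip H u (B j))) * ip H (A i) (A j)))
        = ip H (x u) (x u)" by simp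
  qed
  finally show ?thesis using xV by (simp add: s_nonneg sum_nonneg)
qed

lemma hnorm_diff_combination:
  assumes "finite I" "p \<in> vecs H" "\<And>i. i \<in> I \<Longrightarrow> \<eta> i \<in> vecs H"
    and "ip H p p = \<theta>" "\<And>i. i \<in> I \<Longrightarrow> ip H (\<eta> i) p = \<theta>"
    and "\<And>i j. \<lbrakk>i \<in> I; j \<in> I\<rbrakk> \<Longrightarrow> ip H (\<eta> i) (\<eta> j) = K i j"
  shows "(hnorm H (p - (\<Sum>i\<in>I. cscale (c i) (\<eta> i))))\<^sup>2
    = Re \<theta> - 2 * Re (\<Sum>i\<in>I. cnj (c i) * \<theta>) + Re (\<Sum>i\<in>I. \<Sum>j\<in>I. cnj (c i) * (c j * K i j))"
proof -
  define s where "s = (\<Sum>i\<in>I. cscale (c i) (\<eta> i))"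
  have sV: "s \<in> vecs H" unfolding s_def using assms by (intro V_sum) auto
  have 1: "ip H s p = (\<Sum>i\<in>I. cnj (c i) * \<theta>)"
    unfolding s_def using assms by (simp add: s_sum_left s_scale_left)
  have "ip H s s = (\<Sum>i\<in>I. cnj (c i) * ip H (\<eta> i) s)"
    using assms sV by (subst s_def) (simp add: s_sum_left s_scale_left)
  also have "\<dots> = (\<Sum>i\<in>I. \<Sum>j\<in>I. cnj (c i) * (c j * K i j))"
    unfolding s_def using assms by (intro sum.cong refl) (simp add: s_sum_right s_scale_right sum_distrib_left)
  finally have 2: "ip H s s = (\<Sum>i\<in>I. \<Sum>j\<in>I. cnj (c i) * (c j * K i j))" .
  have 3: "Re (ip H p s) = Re (ip H s p)" using ip_cnj[OF assms(2) sV] by simp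
  show ?thesis
    unfolding s_def[symmetric] nrm_diff_sq[OF assms(2) sV] 3 unfolding nrm_sq[OF sV] nrm_sq[OF assms(2)] assms(4) 1 2 ..
qed

end

definition invariant_frame :: "('g, 'm) monoid_scheme \<Rightarrow> ('g, 'i) urep \<Rightarrow> ('i \<Rightarrow> complex) set \<Rightarrow> bool" where
  "invariant_frame G R E \<longleftrightarrow> orthonormal R E \<and> (\<forall>g\<in>carrier G. \<forall>v\<in>cvs.span E. act R g v \<in> cvs.span E)"

definition irreducible_frame :: "('g, 'm) monoid_scheme \<Rightarrow> ('g, 'i) urep \<Rightarrow> ('i \<Rightarrow> complex) set \<Rightarrow> bool" where
  "irreducible_frame G R E \<longleftrightarrow> invariant_frame G R E \<and> E \<noteq> {} \<and>
     (\<forall>W. cvs.subspace W \<and> W \<subseteq> cvs.span E \<and> (\<forall>g\<in>carrier G. act R g ` W \<subseteq> W)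
        \<longrightarrow> W = {0} \<or> W = cvs.span E)"

abbreviation subrep :: "('g, 'i) urep \<Rightarrow> ('i \<Rightarrow> complex) set \<Rightarrow> ('g, 'i) urep" where
  "subrep R E \<equiv> R\<lparr>vecs := cvs.span E\<rparr>"

lemma hnorm_subrep [simp]: "hnorm (subrep R E) = hnorm R"
  by (simp add: fun_eq_iff hnorm_def)

context unitary_rep
begin

lemma act_zero [simp]: "g \<in> carrier G \<Longrightarrow> act R g 0 = 0"
  using act_scale[of g 0 0] by simp

lemma act_diff: "\<lbrakk>g \<in> carrier G; u \<in> vecs R; v \<in> vecs R\<rbrakk> \<Longrightarrow> act R g (u - v) = act R g u - act R g v"
  using act_add[of g "u - v" v] by (simp add: eq_diff_eq)

lemma act_inv_left [simp]: "\<lbrakk>g \<in> carrier G; v \<in> vecs R\<rbrakk> \<Longrightarrow> act R (inv\<^bsub>G\<^esub> g) (act R g v) = v"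
  using act_mult[of "inv\<^bsub>G\<^esub> g" g v] act_one by simp

lemma act_inv_right [simp]: "\<lbrakk>g \<in> carrier G; v \<in> vecs R\<rbrakk> \<Longrightarrow> act R g (act R (inv\<^bsub>G\<^esub> g) v) = v"
  using act_mult[of g "inv\<^bsub>G\<^esub> g" v] act_one by simp

lemma ip_act_left:
  assumes "g \<in> carrier G" "u \<in> vecs R" "v \<in> vecs R"
  shows "ip R (act R g u) v = ip R u (act R (inv\<^bsub>G\<^esub> g) v)"
  using act_ip[of g u "act R (inv\<^bsub>G\<^esub> g) v"] assms by (simp add: act_closed)

lemma hnorm_act [simp]: "\<lbrakk>g \<in> carrier G; v \<in> vecs R\<rbrakk> \<Longrightarrow> hnorm R (act R g v) = hnorm R v"
  by (simp add: hnorm_def act_ip)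

lemma subspace_fixed_vecs: "cvs.subspace (fixed_vecs G R)"
  by (rule cvs.subspaceI) (auto simp: fixed_vecs_def act_add act_scale)

lemma fixed_vecs_closed:
  assumes X: "\<And>n. X n \<in> fixed_vecs G R" and v: "v \<in> vecs R" and lim: "(\<lambda>n. hnorm R (X n - v)) \<longlonglongrightarrow> 0"
  shows "v \<in> fixed_vecs G R"
proof -
  have XV: "X n \<in> vecs R" for n using X by (simp add: fixed_vecs_def)
  have "act R g v = v" if g: "g \<in> carrier G" for g
  proof (rule ip_ext)
    fix w assume w: "w \<in> vecs R"
    have "(\<lambda>n. ip R (act R (inv\<^bsub>G\<^esub> g) w) (X n)) \<longlonglongrightarrow> ip R (act R (inv\<^bsub>G\<^esub> g) w) v"
      using hnorm_tendsto_imp_ip[OF XV v _ lim] w g by (simp add: act_closed)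
    moreover have "ip R (act R (inv\<^bsub>G\<^esub> g) w) (X n) = ip R w (X n)" for n
      using X[of n] w g by (simp add: ip_act_left fixed_vecs_def)
    ultimately have "(\<lambda>n. ip R w (X n)) \<longlonglongrightarrow> ip R (act R (inv\<^bsub>G\<^esub> g) w) v" by simp
    moreover have "(\<lambda>n. ip R w (X n)) \<longlonglongrightarrow> ip R w v"
      by (rule hnorm_tendsto_imp_ip[OF XV v w lim])
    ultimately have "ip R (act R (inv\<^bsub>G\<^esub> g) w) v = ip R w v" by (rule LIMSEQ_unique)
    then show "ip R w (act R g v) = ip R w v" using g v w by (simp add: ip_act_left act_closed)
  qed (use v g act_closed in auto)
  then show ?thesis using v by (simp add: fixed_vecs_def)
qed

lemma orth_proj_fixed:
  assumes u: "u \<in> vecs R"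
  shows "orth_proj R (fixed_vecs G R) u \<in> fixed_vecs G R"
    "\<And>v. v \<in> fixed_vecs G R \<Longrightarrow> ip R v (u - orth_proj R (fixed_vecs G R) u) = 0"
proof -
  have sub: "fixed_vecs G R \<subseteq> vecs R" by (auto simp: fixed_vecs_def)
  obtain w where w: "w \<in> fixed_vecs G R" "\<And>v. v \<in> fixed_vecs G R \<Longrightarrow> ip R v (u - w) = 0"
  proof (rule projection[OF subspace_fixed_vecs sub _ u])
    show "v \<in> fixed_vecs G R" if "\<And>n. X n \<in> fixed_vecs G R" "v \<in> vecs R"
        "(\<lambda>n. hnorm R (X n - v)) \<longlonglongrightarrow> 0" for X v
      using that by (rule fixed_vecs_closed)
  qed (rule that)
  note eq = orth_proj_eq[OF subspace_fixed_vecs sub u w]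
  show "orth_proj R (fixed_vecs G R) u \<in> fixed_vecs G R"
    "\<And>v. v \<in> fixed_vecs G R \<Longrightarrow> ip R v (u - orth_proj R (fixed_vecs G R) u) = 0"
    using w by (simp_all add: eq)
qed

lemma frame_orthonormal: "invariant_frame G R E \<Longrightarrow> orthonormal R E"
  by (simp add: invariant_frame_def)

lemma frame_act: "\<lbrakk>invariant_frame G R E; g \<in> carrier G; v \<in> cvs.span E\<rbrakk> \<Longrightarrow> act R g v \<in> cvs.span E"
  by (simp add: invariant_frame_def)

lemma proj_act:
  assumes E: "invariant_frame G R E" and g: "g \<in> carrier G" and v: "v \<in> vecs R"
  shows "proj R E (act R g v) = act R g (proj R E v)"
proof (rule proj_unique)
  note on = frame_orthonormal[OF E]
  show "ip R e (act R g v - act R g (proj R E v)) = 0" if "e \<in> E" for e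
  proof -
    have eV: "e \<in> vecs R" using on that by (rule orthonormal_vecs)
    have "act R (inv\<^bsub>G\<^esub> g) e \<in> cvs.span E" using E g that by (intro frame_act cvs.span_base) auto
    from proj_orth[OF on v this] show ?thesis
      using ip_act_left[of "inv\<^bsub>G\<^esub> g" e "v - proj R E v"] g v eV proj_vecs[OF on]
      by (simp add: act_diff)
  qed
qed (use assms frame_orthonormal act_closed frame_act proj_span in auto)

lemma unitary_rep_subrep:
  assumes E: "invariant_frame G R E"
  shows "unitary_rep G (subrep R E)"
proof (intro unitary_rep.intro)
  show "group G" by (rule is_group)
  show "complex_hilbert (subrep R E)"
    by (rule complex_hilbert_span[OF frame_orthonormal[OF E]]) simp_all
  have sub: "v \<in> cvs.span E \<Longrightarrow> v \<in> vecs R" for v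
    using orthonormal_span_vecs[OF frame_orthonormal[OF E]] .
  show "unitary_rep_axioms G (subrep R E)"
    using frame_act[OF E] by unfold_locales (auto simp: act_add act_scale act_ip act_one act_mult sub)
qed

lemma hdim_subrep: "invariant_frame G R E \<Longrightarrow> hdim (subrep R E) = enat (card E)"
  by (rule hdim_span[OF frame_orthonormal]) auto

lemma invariant_frameI:
  assumes "orthonormal R E" "\<And>g e. \<lbrakk>g \<in> carrier G; e \<in> E\<rbrakk> \<Longrightarrow> act R g e \<in> cvs.span E"
  shows "invariant_frame G R E"
  unfolding invariant_frame_def
proof (intro conjI ballI)
  fix g v assume g: "g \<in> carrier G" and v: "v \<in> cvs.span E"
  have "cvs.subspace {v \<in> vecs R. act R g v \<in> cvs.span E}"
    using g by (intro cvs.subspaceI) (auto simp: act_add act_scale cvs.span_zero intro: cvs.span_add cvs.span_scale)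
  moreover have "E \<subseteq> {v \<in> vecs R. act R g v \<in> cvs.span E}"
    using assms g orthonormal_vecs by blast
  ultimately show "act R g v \<in> cvs.span E" using cvs.span_minimal v by blast
qed (rule assms)

lemma irreducible_decomposition:
  assumes "invariant_frame G R E"
  obtains \<E> where "finite \<E>" "\<And>F. F \<in> \<E> \<Longrightarrow> irreducible_frame G R F"
    "disjoint \<E>" "orthonormal R (\<Union>\<E>)" "cvs.span (\<Union>\<E>) = cvs.span E"
proof -
  have "\<exists>\<E>. finite \<E> \<and> (\<forall>F\<in>\<E>. irreducible_frame G R F) \<and> disjoint \<E> \<and>
      orthonormal R (\<Union>\<E>) \<and> cvs.span (\<Union>\<E>) = cvs.span E"
    using assms
  proof (induction "card E" arbitrary: E rule: less_induct)
    case less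
    note E = less.prems and on = frame_orthonormal[OF less.prems]
    have sub: "cvs.span E \<subseteq> vecs R" using on orthonormal_span_vecs by blast
    show ?case
    proof (cases "E = {}")
      case True
      then show ?thesis using on by (intro exI[of _ "{}"]) (auto simp: disjoint_def)
    next
      case False
      define P where "P F \<longleftrightarrow> invariant_frame G R F \<and> cvs.span F \<subseteq> cvs.span E \<and> F \<noteq> {}" for F
      have "P E" using E False by (simp add: P_def)
      then obtain F where F: "P F" "\<And>F'. P F' \<Longrightarrow> card F \<le> card F'"
        using ex_has_least_nat[of P E card] by blast
      have Fi: "invariant_frame G R F" "cvs.span F \<subseteq> cvs.span E" "F \<noteq> {}" using F(1) by (auto simp: P_def)
      note onF = frame_orthonormal[OF Fi(1)]
      have irr: "irreducible_frame G R F"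
        unfolding irreducible_frame_def
      proof (intro conjI allI impI Fi)
        fix W assume W: "cvs.subspace W \<and> W \<subseteq> cvs.span F \<and> (\<forall>g\<in>carrier G. act R g ` W \<subseteq> W)"
        obtain F' where F': "orthonormal R F'" "cvs.span F' = W"
          using ex_orthonormal_basis_span[of F W] W orthonormal_finite[OF onF] onF orthonormal_vecs by blast
        have inv: "invariant_frame G R F'" using F' W by (auto simp: invariant_frame_def)
        show "W = {0} \<or> W = cvs.span F"
        proof (cases "F' = {}")
          case False
          have "cvs.span F \<subseteq> W"
          proof
            fix v assume v: "v \<in> cvs.span F"
            show "v \<in> W"
            proof (rule ccontr)
              assume nv: "v \<notin> W"
              define e where "e = cscale (1 / of_real (hnorm R (v - proj R F' v))) (v - proj R F' v)"
              have "v \<in> vecs R" using v Fi sub by blast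
              note e = orthonormal_insert[OF F'(1) this, folded e_def]
              have e: "e \<notin> cvs.span F'" "orthonormal R (insert e F')"
                using e nv F' by auto
              have "e \<in> cvs.span F" unfolding e_def
                using v proj_span[of F' v] F' W by (intro cvs.span_scale cvs.span_diff) auto
              moreover have "F' \<subseteq> cvs.span F" using F' W cvs.span_superset by blast
              ultimately have "card (insert e F') \<le> card F"
                using cvs.independent_span_bound[OF orthonormal_finite[OF onF] orthonormal_independent[OF e(2)]] by simp
              moreover have "e \<notin> F'" using e(1) cvs.span_base by blast
              ultimately have "card F' < card F" using orthonormal_finite[OF F'(1)] by simp
              moreover have "P F'" unfolding P_def using inv False F' W Fi by blast
              ultimately show False using F(2) by fastforce
            qed
          qed
          then show ?thesis using W by blast
        qed (use F' in auto)
      qed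
      define W' where "W' = {v \<in> cvs.span E. \<forall>f\<in>F. ip R f v = 0}"
      have FV: "f \<in> vecs R" if "f \<in> F" for f using onF that by (rule orthonormal_vecs)
      have W': "cvs.subspace W'"
        using FV sub by (intro cvs.subspaceI)
          (auto simp: W'_def cvs.span_zero s_add_right s_scale_right subset_iff intro: cvs.span_add cvs.span_scale)
      obtain E' where E': "orthonormal R E'" "cvs.span E' = W'"
        using ex_orthonormal_basis_span[of E W'] W' orthonormal_finite[OF on] on orthonormal_vecs
        by (auto simp: W'_def)
      have orthF: "ip R f v = 0" if "f \<in> F" "v \<in> cvs.span E'" for f v
        using that E' by (auto simp: W'_def)
      have orthspan: "ip R f v = 0" if "f \<in> cvs.span F" "v \<in> cvs.span E'" for f v
      proof (rule ip_span_eq_0[of v F f])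
        show "v \<in> vecs R" using that(2) sub by (auto simp: E'(2) W'_def)
        show "ip R e v = 0" if "e \<in> F" for e using that \<open>v \<in> cvs.span E'\<close> by (rule orthF)
      qed (use FV that in auto)
      have invE': "invariant_frame G R E'"
        unfolding invariant_frame_def
      proof (intro conjI E' ballI)
        fix g v assume g: "g \<in> carrier G" and v: "v \<in> cvs.span E'"
        have vE: "v \<in> cvs.span E" using v E' by (auto simp: W'_def)
        have "ip R f (act R g v) = 0" if f: "f \<in> F" for f
        proof -
          have "act R (inv\<^bsub>G\<^esub> g) f \<in> cvs.span F"
            using frame_act[OF Fi(1)] g f cvs.span_base by auto
          from orthspan[OF this v] show ?thesis
            using ip_act_left[of "inv\<^bsub>G\<^esub> g" f v] g FV[OF f] vE sub by auto
        qed
        then show "act R g v \<in> cvs.span E'"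
          using frame_act[OF E g vE] E' by (auto simp: W'_def)
      qed
      have un: "orthonormal R (F \<union> E')" "F \<inter> E' = {}"
        using orthonormal_Un[OF onF E'(1)] orthF cvs.span_base by blast+
      have "cvs.span (F \<union> E') = cvs.span E"
      proof
        show "cvs.span (F \<union> E') \<subseteq> cvs.span E"
          using Fi E' cvs.span_superset by (intro cvs.span_minimal) (auto simp: W'_def)
        show "cvs.span E \<subseteq> cvs.span (F \<union> E')"
        proof
          fix v assume v: "v \<in> cvs.span E"
          have vV: "v \<in> vecs R" using v sub by blast
          have "v - proj R F v \<in> cvs.span E'"
            using proj_orth[OF onF vV cvs.span_base] v Fi proj_span[of F v] E'
            by (auto simp: W'_def intro: cvs.span_diff)
          then have "proj R F v + (v - proj R F v) \<in> cvs.span (F \<union> E')"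
            using proj_span[of F v] cvs.span_mono[of F "F \<union> E'"] cvs.span_mono[of E' "F \<union> E'"]
            by (intro cvs.span_add) auto
          then show "v \<in> cvs.span (F \<union> E')" by simp
        qed
      qed note spanU = this
      then have "card (F \<union> E') = card E"
        using dim_orthonormal[OF un(1)] dim_orthonormal[OF on] by simp
      moreover have "card F > 0" using Fi orthonormal_finite[OF onF] by (simp add: card_gt_0_iff)
      ultimately have "card E' < card E"
        using un orthonormal_finite[OF onF] orthonormal_finite[OF E'(1)] by (simp add: card_Un_disjoint)
      from less.hyps[OF this invE'] obtain \<E> where \<E>: "finite \<E>" "\<forall>F\<in>\<E>. irreducible_frame G R F"
        "disjoint \<E>" "orthonormal R (\<Union>\<E>)" "cvs.span (\<Union>\<E>) = cvs.span E'" by blast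
      have orthU: "ip R f e = 0" if "f \<in> F" "e \<in> \<Union>\<E>" for f e
        using orthF[OF that(1)] \<E>(5) cvs.span_base[OF that(2)] by simp
      note unE = orthonormal_Un[OF onF \<E>(4) orthU]
      have "disjoint (insert F \<E>)" using \<E>(3) unE(2) by (auto simp: disjoint_def)
      moreover have "cvs.span (F \<union> \<Union>\<E>) = cvs.span E"
        using spanU \<E>(5) by (simp add: cvs.span_Un)
      ultimately show ?thesis
        using \<E> irr unE by (intro exI[of _ "insert F \<E>"]) auto
    qed
  qed
  then show ?thesis using that by blast
qed

end

section \<open>Averages of matrix coefficients\<close>

definition avg :: "'g set \<Rightarrow> ('g \<Rightarrow> complex) \<Rightarrow> complex" where
  "avg S F = (\<Sum>\<gamma>\<in>S. F \<gamma>) / of_nat (card S)"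

lemma avg_add: "avg S (\<lambda>\<gamma>. F \<gamma> + F' \<gamma>) = avg S F + avg S F'"
  by (simp add: avg_def sum.distrib add_divide_distrib)

lemma avg_diff: "avg S (\<lambda>\<gamma>. F \<gamma> - F' \<gamma>) = avg S F - avg S F'"
  by (simp add: avg_def sum_subtractf diff_divide_distrib)

lemma avg_mult_left: "avg S (\<lambda>\<gamma>. c * F \<gamma>) = c * avg S F"
  by (simp add: avg_def sum_distrib_left)

lemma avg_sum: "avg S (\<lambda>\<gamma>. \<Sum>i\<in>I. F i \<gamma>) = (\<Sum>i\<in>I. avg S (F i))"
  unfolding avg_def by (subst sum.swap) (simp add: sum_divide_distrib)

lemma avg_cnj: "avg S (\<lambda>\<gamma>. cnj (F \<gamma>)) = cnj (avg S F)"
  by (simp add: avg_def)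

lemma avg_cong: "(\<And>\<gamma>. \<gamma> \<in> S \<Longrightarrow> F \<gamma> = F' \<gamma>) \<Longrightarrow> avg S F = avg S F'"
  unfolding avg_def by (simp cong: sum.cong)

lemma avg_const: "\<lbrakk>finite S; S \<noteq> {}\<rbrakk> \<Longrightarrow> avg S (\<lambda>_. c) = c"
  by (simp add: avg_def)

lemma Re_avg: "Re (avg S F) = (\<Sum>\<gamma>\<in>S. Re (F \<gamma>)) / real (card S)"
  by (simp add: avg_def)

lemma cmod_avg_le:
  assumes "\<And>\<gamma>. \<gamma> \<in> S \<Longrightarrow> cmod (F \<gamma>) \<le> B" "B \<ge> 0"
  shows "cmod (avg S F) \<le> B"
proof (cases "finite S \<and> S \<noteq> {}")
  case True
  have "cmod (\<Sum>\<gamma>\<in>S. F \<gamma>) \<le> of_nat (card S) * B" using assms(1) by (rule sum_norm_bound)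
  then show ?thesis using True by (simp add: avg_def norm_divide field_simps card_gt_0_iff)
qed (use assms in \<open>auto simp: avg_def\<close>)

lemma cmod_avg_sq_le:
  shows "(cmod (avg S F))\<^sup>2 \<le> Re (avg S (\<lambda>\<gamma>. F \<gamma> * cnj (F \<gamma>)))"
proof (cases "finite S \<and> S \<noteq> {}")
  case True
  then have c: "real (card S) > 0" by (simp add: card_gt_0_iff)
  have "(cmod (\<Sum>\<gamma>\<in>S. F \<gamma>))\<^sup>2 \<le> (\<Sum>\<gamma>\<in>S. 1 * cmod (F \<gamma>))\<^sup>2"
    by (simp add: norm_sum power_mono)
  also have "\<dots> \<le> (\<Sum>\<gamma>\<in>S. 1\<^sup>2) * (\<Sum>\<gamma>\<in>S. (cmod (F \<gamma>))\<^sup>2)"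
    by (rule Cauchy_Schwarz_ineq_sum)
  also have "\<dots> = real (card S) * (\<Sum>\<gamma>\<in>S. Re (F \<gamma> * cnj (F \<gamma>)))"
    by (simp add: complex_mult_cnj cmod_def)
  finally have "(cmod (\<Sum>\<gamma>\<in>S. F \<gamma>))\<^sup>2 \<le> real (card S) * (\<Sum>\<gamma>\<in>S. Re (F \<gamma> * cnj (F \<gamma>)))" .
  then show ?thesis
    using c by (simp add: avg_def norm_divide power_divide field_simps power2_eq_square)
qed (auto simp: avg_def)

locale ergodic_seq = group G for G :: "('g, 'm) monoid_scheme" (structure) and T :: "nat \<Rightarrow> 'g set" +
  assumes ergodic: "ergodic_sequence G T"
begin

lemma finite_T [simp]: "finite (T n)"
  using ergodic by (simp add: ergodic_sequence_def)

lemma T_carrier: "\<gamma> \<in> T n \<Longrightarrow> \<gamma> \<in> carrier G"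
  using ergodic by (auto simp: ergodic_sequence_def)

lemma ergodic_mean:
  fixes R :: "'g rep"
  assumes R: "unitary_rep G R" and u: "u \<in> vecs R"
  obtains p where "p \<in> fixed_vecs G R" "\<And>w. w \<in> fixed_vecs G R \<Longrightarrow> ip R w (u - p) = 0"
    "ip R p p = ip R u p"
    "\<And>v. v \<in> vecs R \<Longrightarrow> (\<lambda>n. avg (T n) (\<lambda>\<gamma>. ip R v (act R \<gamma> u))) \<longlonglongrightarrow> ip R v p"
proof -
  interpret R: unitary_rep G R by (rule R)
  define p where "p = orth_proj R (fixed_vecs G R) u"
  note p = R.orth_proj_fixed[OF u, folded p_def]
  have pV: "p \<in> vecs R" using p(1) by (simp add: fixed_vecs_def)
  have "ip R p u = ip R p p" using p(2)[OF p(1)] u pV by (simp add: R.s_diff_right)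
  then have "ip R p p = ip R u p" using R.ip_cnj[OF pV u] R.ip_cnj[OF pV pV] by simp
  moreover have "(\<lambda>n. avg (T n) (\<lambda>\<gamma>. ip R v (act R \<gamma> u))) \<longlonglongrightarrow> ip R v p" if v: "v \<in> vecs R" for v
  proof -
    have "(\<lambda>n. ip R v (cscale (1 / of_nat (card (T n))) (\<Sum>\<gamma>\<in>T n. act R \<gamma> u))) \<longlonglongrightarrow> ip R v p"
      using ergodic R u v by (auto simp: ergodic_sequence_def weakly_converges_def p_def)
    also have "(\<lambda>n. ip R v (cscale (1 / of_nat (card (T n))) (\<Sum>\<gamma>\<in>T n. act R \<gamma> u)))
        = (\<lambda>n. avg (T n) (\<lambda>\<gamma>. ip R v (act R \<gamma> u)))"
    proof
      fix n
      have "act R \<gamma> u \<in> vecs R" if "\<gamma> \<in> T n" for \<gamma>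
        using T_carrier[OF that] u by (rule R.act_closed)
      then show "ip R v (cscale (1 / of_nat (card (T n))) (\<Sum>\<gamma>\<in>T n. act R \<gamma> u))
          = avg (T n) (\<lambda>\<gamma>. ip R v (act R \<gamma> u))"
        using v by (simp add: R.s_scale_right R.s_sum_right avg_def)
    qed
    finally show ?thesis .
  qed
  ultimately show ?thesis using that p by blast
qed

lemma fixed_vecs_act: "\<lbrakk>p \<in> fixed_vecs G R; g \<in> carrier G\<rbrakk> \<Longrightarrow> act R g p = p"
  by (simp add: fixed_vecs_def)

lemma fixed_vecs_vecs: "p \<in> fixed_vecs G R \<Longrightarrow> p \<in> vecs R"
  by (simp add: fixed_vecs_def)

lemma ip_act_fixed:
  assumes R: "unitary_rep G R" and "p \<in> fixed_vecs G R" "g \<in> carrier G" "v \<in> vecs R"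
  shows "ip R (act R g v) p = ip R v p"
proof -
  interpret R: unitary_rep G R by (rule R)
  show ?thesis using assms R.ip_act_left[of g v p] by (simp add: fixed_vecs_vecs fixed_vecs_act)
qed

lemma tensor_rep:
  fixes R :: "('g, 'i) urep" and a b :: "nat \<Rightarrow> 'i \<Rightarrow> complex"
  assumes R: "unitary_rep G R" and a: "\<And>n. a n \<in> vecs R" and b: "\<And>n. b n \<in> vecs R"
  obtains R' :: "'g rep" and \<xi> where "unitary_rep G R'" "\<And>n. \<xi> n \<in> vecs R'"
    "\<And>x y n m. \<lbrakk>x \<in> carrier G; y \<in> carrier G\<rbrakk> \<Longrightarrow> ip R' (act R' x (\<xi> n)) (act R' y (\<xi> m))
        = ip R (act R x (a n)) (act R y (a m)) * cnj (ip R (act R x (b n)) (act R y (b m)))"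
    "\<And>f \<epsilon>. \<lbrakk>f \<in> vecs R'; \<epsilon> > 0\<rbrakk> \<Longrightarrow> \<exists>F c. finite F \<and> F \<subseteq> carrier G \<times> UNIV \<and>
        hnorm R' (f - (\<Sum>(x, n)\<in>F. cscale (c (x, n)) (act R' x (\<xi> n)))) < \<epsilon>"
proof -
  interpret R: unitary_rep G R by (rule R)
  define A where "A a i = (case i of (x, n) \<Rightarrow> if x \<in> carrier G then act R x (a n) else 0)"
    for a :: "nat \<Rightarrow> 'i \<Rightarrow> complex" and i
  define k where "k i j = ip R (A a i) (A a j) * cnj (ip R (A b i) (A b j))" for i j
  have A: "A a i \<in> vecs R" "A b i \<in> vecs R" for i
    using a b by (auto simp: A_def R.act_closed split: prod.splits)
  interpret K: invariant_kernel G k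
  proof
    show "k j i = cnj (k i j)" for i j
      using R.ip_cnj[OF A(1) A(1), of i j] R.ip_cnj[OF A(2) A(2), of i j] by (simp add: k_def)
    show "0 \<le> Re (\<Sum>i\<in>F. \<Sum>j\<in>F. cnj (c i) * c j * k i j)" if "finite F" for F c
      unfolding k_def using that A by (intro R.schur_product) auto
    show "k (x, n) j = 0" if "x \<notin> carrier G" for x n j
      using that A by (simp add: k_def A_def[of _ "(x, n)"])
    show "k (g \<otimes> x, n) (g \<otimes> y, m) = k (x, n) (y, m)"
      if "g \<in> carrier G" "x \<in> carrier G" "y \<in> carrier G" for g x y n m
      using that a b by (simp add: k_def A_def R.act_mult R.act_ip R.act_closed)
  qed
  show ?thesis
  proof (rule K.rep_of_kernel)
    fix R' :: "'g rep" and \<xi>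
    assume *: "unitary_rep G R'" "\<And>n. \<xi> n \<in> vecs R'"
      "\<And>x y n m. \<lbrakk>x \<in> carrier G; y \<in> carrier G\<rbrakk> \<Longrightarrow> ip R' (act R' x (\<xi> n)) (act R' y (\<xi> m)) = k (x, n) (y, m)"
      "\<And>f \<epsilon>. \<lbrakk>f \<in> vecs R'; \<epsilon> > 0\<rbrakk> \<Longrightarrow> \<exists>F c. finite F \<and> F \<subseteq> carrier G \<times> UNIV \<and>
        hnorm R' (f - (\<Sum>(x, n)\<in>F. cscale (c (x, n)) (act R' x (\<xi> n)))) < \<epsilon>"
    show thesis
    proof (rule that[OF *(1,2)])
      show "ip R' (act R' x (\<xi> n)) (act R' y (\<xi> m))
        = ip R (act R x (a n)) (act R y (a m)) * cnj (ip R (act R x (b n)) (act R y (b m)))"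
        if "x \<in> carrier G" "y \<in> carrier G" for x y n m
        using *(3)[OF that] that by (simp add: k_def A_def)
    qed (use *(4) in auto)
  qed
qed

definition tmean :: "('g, 'i) urep \<Rightarrow> ('i \<Rightarrow> complex) \<Rightarrow> ('i \<Rightarrow> complex) \<Rightarrow> ('i \<Rightarrow> complex) \<Rightarrow> ('i \<Rightarrow> complex) \<Rightarrow> complex" where
  "tmean R v v' w w' = lim (\<lambda>n. avg (T n) (\<lambda>\<gamma>. ip R w (act R \<gamma> v) * cnj (ip R w' (act R \<gamma> v'))))"

lemma tmean:
  fixes R :: "('g, 'i) urep"
  assumes R: "unitary_rep G R" and v: "v \<in> vecs R" "v' \<in> vecs R" and w: "w \<in> vecs R" "w' \<in> vecs R"
  shows tmean_tendsto: "(\<lambda>n. avg (T n) (\<lambda>\<gamma>. ip R w (act R \<gamma> v) * cnj (ip R w' (act R \<gamma> v')))) \<longlonglongrightarrow> tmean R v v' w w'"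
    and tmean_invariant: "g \<in> carrier G \<Longrightarrow> tmean R v v' (act R g w) (act R g w') = tmean R v v' w w'"
proof -
  interpret R: unitary_rep G R by (rule R)
  let ?F = "\<lambda>g n. avg (T n) (\<lambda>\<gamma>. ip R (act R g w) (act R \<gamma> v) * cnj (ip R (act R g w') (act R \<gamma> v')))"
  define a where "a n = (if n = 0 then v else w)" for n :: nat
  define b where "b n = (if n = 0 then v' else w')" for n :: nat
  have ab: "a n \<in> vecs R" "b n \<in> vecs R" for n using v w by (auto simp: a_def b_def)
  obtain R' :: "'g rep" and \<xi> where R': "unitary_rep G R'" "\<And>n. \<xi> n \<in> vecs R'"
    and ip': "\<And>x y n m. \<lbrakk>x \<in> carrier G; y \<in> carrier G\<rbrakk> \<Longrightarrow> ip R' (act R' x (\<xi> n)) (act R' y (\<xi> m))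
        = ip R (act R x (a n)) (act R y (a m)) * cnj (ip R (act R x (b n)) (act R y (b m)))"
  proof (rule tensor_rep[of R a b, OF R ab], goal_cases)
    case (1 R' \<xi>)
    show ?case by (rule that[of R' \<xi>]) (assumption | rule 1)+
  qed
  interpret R': unitary_rep G R' by (rule R')
  obtain p where p: "p \<in> fixed_vecs G R'"
    "\<And>u. u \<in> vecs R' \<Longrightarrow> (\<lambda>n. avg (T n) (\<lambda>\<gamma>. ip R' u (act R' \<gamma> (\<xi> 0)))) \<longlonglongrightarrow> ip R' u p"
  proof (rule ergodic_mean[OF R'(1) R'(2)[of 0]], goal_cases)
    case (1 p)
    show ?case by (rule that[of p]) (assumption | rule 1)+
  qed
  have lim: "?F g \<longlonglongrightarrow> ip R' (\<xi> 1) p" if g: "g \<in> carrier G" for g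
  proof -
    have "(\<lambda>n. avg (T n) (\<lambda>\<gamma>. ip R' (act R' g (\<xi> 1)) (act R' \<gamma> (\<xi> 0)))) \<longlonglongrightarrow> ip R' (act R' g (\<xi> 1)) p"
      using R'.act_closed[OF g R'(2)] by (rule p(2))
    also have "ip R' (act R' g (\<xi> 1)) p = ip R' (\<xi> 1) p"
      using R'(1) p(1) g R'(2) by (rule ip_act_fixed)
    also have "(\<lambda>n. avg (T n) (\<lambda>\<gamma>. ip R' (act R' g (\<xi> 1)) (act R' \<gamma> (\<xi> 0)))) = ?F g"
      by (intro ext avg_cong) (simp add: ip' g T_carrier a_def b_def)
    finally show ?thesis .
  qed
  have F1: "?F \<one> = (\<lambda>n. avg (T n) (\<lambda>\<gamma>. ip R w (act R \<gamma> v) * cnj (ip R w' (act R \<gamma> v'))))"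
    using w by (simp add: R.act_one)
  have eq: "tmean R v v' w w' = ip R' (\<xi> 1) p"
    unfolding tmean_def F1[symmetric] by (rule limI[OF lim]) simp
  show "(\<lambda>n. avg (T n) (\<lambda>\<gamma>. ip R w (act R \<gamma> v) * cnj (ip R w' (act R \<gamma> v')))) \<longlonglongrightarrow> tmean R v v' w w'"
    using lim[OF one_closed] unfolding F1 eq .
  show "tmean R v v' (act R g w) (act R g w') = tmean R v v' w w'" if "g \<in> carrier G"
    using limI[OF lim[OF that]] unfolding eq by (simp add: tmean_def)
qed

lemma tmean_add_right:
  assumes R: "unitary_rep G R" and v: "v \<in> vecs R" "v' \<in> vecs R"
    and w: "u \<in> vecs R" "x \<in> vecs R" "y \<in> vecs R"
  shows "tmean R v v' u (x + y) = tmean R v v' u x + tmean R v v' u y"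
proof (rule LIMSEQ_unique)
  interpret R: unitary_rep G R by (rule R)
  note lim = tmean_tendsto[OF R v]
  let ?F = "\<lambda>z \<gamma>. ip R u (act R \<gamma> v) * cnj (ip R z (act R \<gamma> v'))"
  show "(\<lambda>n. avg (T n) (?F (x + y))) \<longlonglongrightarrow> tmean R v v' u (x + y)"
    using w by (intro lim) auto
  have "avg (T n) (?F (x + y)) = avg (T n) (?F x) + avg (T n) (?F y)" for n
    unfolding avg_add[symmetric] using w v
    by (intro avg_cong) (simp add: R.s_add_left distrib_left R.act_closed T_carrier)
  then show "(\<lambda>n. avg (T n) (?F (x + y))) \<longlonglongrightarrow> tmean R v v' u x + tmean R v v' u y"
    using w by (simp add: tendsto_add lim)
qed

lemma tmean_scale_right:
  assumes R: "unitary_rep G R" and v: "v \<in> vecs R" "v' \<in> vecs R" and w: "u \<in> vecs R" "x \<in> vecs R"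
  shows "tmean R v v' u (cscale c x) = c * tmean R v v' u x"
proof (rule LIMSEQ_unique)
  interpret R: unitary_rep G R by (rule R)
  note lim = tmean_tendsto[OF R v]
  let ?F = "\<lambda>z \<gamma>. ip R u (act R \<gamma> v) * cnj (ip R z (act R \<gamma> v'))"
  show "(\<lambda>n. avg (T n) (?F (cscale c x))) \<longlonglongrightarrow> tmean R v v' u (cscale c x)"
    using w by (intro lim) auto
  have "avg (T n) (?F (cscale c x)) = c * avg (T n) (?F x)" for n
    unfolding avg_mult_left[symmetric] using w v
    by (intro avg_cong) (simp add: R.s_scale_left R.act_closed T_carrier mult_ac)
  then show "(\<lambda>n. avg (T n) (?F (cscale c x))) \<longlonglongrightarrow> c * tmean R v v' u x"
    using w by (simp add: tendsto_mult_left lim)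
qed

lemma tmean_cnj:
  assumes R: "unitary_rep G R" and v: "v \<in> vecs R" "v' \<in> vecs R" and w: "x \<in> vecs R" "y \<in> vecs R"
  shows "tmean R v' v y x = cnj (tmean R v v' x y)"
proof (rule LIMSEQ_unique[OF tmean_tendsto[OF R v(2,1) w(2,1)]])
  have "avg (T n) (\<lambda>\<gamma>. ip R y (act R \<gamma> v') * cnj (ip R x (act R \<gamma> v)))
     = cnj (avg (T n) (\<lambda>\<gamma>. ip R x (act R \<gamma> v) * cnj (ip R y (act R \<gamma> v'))))" for n
    unfolding avg_cnj[symmetric] by (intro avg_cong) simp
  then show "(\<lambda>n. avg (T n) (\<lambda>\<gamma>. ip R y (act R \<gamma> v') * cnj (ip R x (act R \<gamma> v))))
      \<longlonglongrightarrow> cnj (tmean R v v' x y)"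
    by (simp add: lim_cnj tmean_tendsto[OF R v w])
qed

lemma semi_ip_tmean:
  assumes R: "unitary_rep G R" and v: "v \<in> vecs R"
  shows "semi_ip (vecs R) (tmean R v v)"
proof
  interpret R: unitary_rep G R by (rule R)
  show "cvs.subspace (vecs R)" by (rule R.subspace_vecs)
  show "0 \<le> Re (tmean R v v x x)" if "x \<in> vecs R" for x
    by (rule tendsto_lowerbound[OF tendsto_Re[OF tmean_tendsto[OF R v v that that]]])
      (auto intro!: always_eventually divide_nonneg_nonneg sum_nonneg simp: Re_avg complex_mult_cnj)
qed (fact tmean_add_right[OF R v v] tmean_scale_right[OF R v v] tmean_cnj[OF R v v])+

lemma tmean_bound:
  assumes R: "unitary_rep G R" and v: "v \<in> vecs R" and w: "w \<in> vecs R"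
  shows "Re (tmean R v v w w) \<le> (hnorm R w)\<^sup>2 * (hnorm R v)\<^sup>2"
proof (rule tendsto_upperbound[OF tendsto_Re[OF tmean_tendsto[OF R v v w w]]])
  interpret R: unitary_rep G R by (rule R)
  have "Re (avg (T n) (\<lambda>\<gamma>. ip R w (act R \<gamma> v) * cnj (ip R w (act R \<gamma> v)))) \<le> (hnorm R w)\<^sup>2 * (hnorm R v)\<^sup>2" for n
  proof -
    have "cmod (avg (T n) (\<lambda>\<gamma>. ip R w (act R \<gamma> v) * cnj (ip R w (act R \<gamma> v)))) \<le> (hnorm R w * hnorm R v) * (hnorm R w * hnorm R v)"
    proof (rule cmod_avg_le)
      fix \<gamma> assume "\<gamma> \<in> T n"
      then have g: "\<gamma> \<in> carrier G" by (rule T_carrier)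
      have "cmod (ip R w (act R \<gamma> v)) \<le> hnorm R w * hnorm R v"
        using R.cauchy_schwarz[OF w R.act_closed[OF g v]] g v by simp
      then show "cmod (ip R w (act R \<gamma> v) * cnj (ip R w (act R \<gamma> v))) \<le> (hnorm R w * hnorm R v) * (hnorm R w * hnorm R v)"
        unfolding norm_mult complex_mod_cnj using v w by (intro mult_mono) auto
    qed (use v w in auto)
    then show ?thesis
      using complex_Re_le_cmod order_trans by (fastforce simp: power2_eq_square mult_ac)
  qed
  then show "\<forall>\<^sub>F n in sequentially. Re (avg (T n) (\<lambda>\<gamma>. ip R w (act R \<gamma> v) * cnj (ip R w (act R \<gamma> v)))) \<le> (hnorm R w)\<^sup>2 * (hnorm R v)\<^sup>2"
    by (intro always_eventually allI)
qed simp

lemma sum_tmean_le: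
  assumes R: "unitary_rep G R" and v: "v \<in> vecs R" and E: "orthonormal R E"
  shows "(\<Sum>e\<in>E. Re (tmean R v v e e)) \<le> (hnorm R v)\<^sup>2"
proof (rule tendsto_upperbound)
  interpret R: unitary_rep G R by (rule R)
  let ?F = "\<lambda>e \<gamma>. ip R e (act R \<gamma> v) * cnj (ip R e (act R \<gamma> v))"
  show "(\<lambda>n. \<Sum>e\<in>E. Re (avg (T n) (?F e))) \<longlonglongrightarrow> (\<Sum>e\<in>E. Re (tmean R v v e e))"
    using E by (intro tendsto_sum tendsto_Re tmean_tendsto[OF R v v]) (auto simp: R.orthonormal_vecs)
  have "(\<Sum>e\<in>E. Re (avg (T n) (?F e))) \<le> (hnorm R v)\<^sup>2" for n
  proof -
    have "(\<Sum>e\<in>E. Re (avg (T n) (?F e))) = Re (avg (T n) (\<lambda>\<gamma>. \<Sum>e\<in>E. ?F e \<gamma>))"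
      by (simp add: avg_sum)
    also have "\<dots> \<le> cmod (avg (T n) (\<lambda>\<gamma>. \<Sum>e\<in>E. ?F e \<gamma>))"
      by (rule complex_Re_le_cmod)
    also have "\<dots> \<le> (hnorm R v)\<^sup>2"
    proof (rule cmod_avg_le)
      fix \<gamma> assume "\<gamma> \<in> T n"
      then have g: "\<gamma> \<in> carrier G" by (rule T_carrier)
      have "(\<Sum>e\<in>E. ?F e \<gamma>) = of_real (\<Sum>e\<in>E. (cmod (ip R e (act R \<gamma> v)))\<^sup>2)"
        by (simp add: cmod_sq)
      then have "cmod (\<Sum>e\<in>E. ?F e \<gamma>) = (\<Sum>e\<in>E. (cmod (ip R e (act R \<gamma> v)))\<^sup>2)"
        by (simp only: norm_of_real) (simp add: sum_nonneg)
      also have "\<dots> \<le> (hnorm R (act R \<gamma> v))\<^sup>2"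
        using E g v by (intro R.bessel) (auto simp: R.act_closed)
      finally show "cmod (\<Sum>e\<in>E. ?F e \<gamma>) \<le> (hnorm R v)\<^sup>2"
        using g v by simp
    qed simp
    finally show ?thesis .
  qed
  then show "\<forall>\<^sub>F n in sequentially. (\<Sum>e\<in>E. Re (avg (T n) (?F e))) \<le> (hnorm R v)\<^sup>2"
    by (intro always_eventually allI)
qed simp

text \<open>
  The mean of \<open>\<gamma>r \<otimes> \<gamma>r\<^sup>*\<close> is a vector of the tensor product representation, hence a norm limit of
  finite combinations of orbit vectors: the form it defines is approximated by forms of finite rank.
\<close>

lemma tmean_finite_rank_approx:
  fixes R :: "('g, 'i) urep"
  assumes R: "unitary_rep G R" and r: "r \<in> vecs R" and \<epsilon>: "\<epsilon> > 0"
  obtains F :: "('g \<times> nat) set" and c where "finite F" "F \<subseteq> carrier G \<times> UNIV"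
    "\<And>w w'. \<lbrakk>w \<in> vecs R; w' \<in> vecs R\<rbrakk> \<Longrightarrow>
       cmod (tmean R r r w w' - (\<Sum>i\<in>F. c i * (ip R w (act R (fst i) r) * cnj (ip R w' (act R (fst i) r)))))
         \<le> \<epsilon> * (hnorm R w * hnorm R w')"
proof -
  interpret R: unitary_rep G R by (rule R)
  obtain R0 :: "'g rep" and \<xi>0 :: "nat \<Rightarrow> 'g \<times> nat \<Rightarrow> complex" where R0: "unitary_rep G R0" "\<And>n. \<xi>0 n \<in> vecs R0"
    and ip0: "\<And>x y n m. \<lbrakk>x \<in> carrier G; y \<in> carrier G\<rbrakk> \<Longrightarrow> ip R0 (act R0 x (\<xi>0 n)) (act R0 y (\<xi>0 m))
        = ip R (act R x r) (act R y r) * cnj (ip R (act R x r) (act R y r))"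
    and dense: "\<And>f \<epsilon>. \<lbrakk>f \<in> vecs R0; \<epsilon> > 0\<rbrakk> \<Longrightarrow> \<exists>F c. finite F \<and> F \<subseteq> carrier G \<times> UNIV \<and>
        hnorm R0 (f - (\<Sum>(x, n)\<in>F. cscale (c (x, n)) (act R0 x (\<xi>0 n)))) < \<epsilon>"
  proof (rule tensor_rep[of R "\<lambda>_. r" "\<lambda>_. r", OF R r r], goal_cases)
    case (1 R0 \<xi>0)
    show ?case by (rule that[of R0 \<xi>0]) (assumption | rule 1)+
  qed
  interpret R0: unitary_rep G R0 by (rule R0)
  obtain p0 where p0: "p0 \<in> fixed_vecs G R0" "ip R0 p0 p0 = ip R0 (\<xi>0 0) p0"
    "\<And>u. u \<in> vecs R0 \<Longrightarrow> (\<lambda>n. avg (T n) (\<lambda>\<gamma>. ip R0 u (act R0 \<gamma> (\<xi>0 0)))) \<longlonglongrightarrow> ip R0 u p0"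
  proof (rule ergodic_mean[OF R0(1) R0(2)[of 0]], goal_cases)
    case (1 p0)
    show ?case by (rule that[of p0]) (assumption | rule 1)+
  qed
  define \<theta> where "\<theta> = tmean R r r r r"
  define K where "K i j = ip R (act R (fst i) r) (act R (fst j) r) * cnj (ip R (act R (fst i) r) (act R (fst j) r))"
    for i j :: "'g \<times> nat"
  have \<theta>_lim: "(\<lambda>n. avg (T n) (\<lambda>\<gamma>. ip R r (act R \<gamma> r) * cnj (ip R r (act R \<gamma> r)))) \<longlonglongrightarrow> \<theta>"
    unfolding \<theta>_def by (rule tmean_tendsto[OF R r r r r])
  have \<theta>0: "ip R0 (\<xi>0 n) p0 = \<theta>" for n
  proof (rule LIMSEQ_unique[OF p0(3)[OF R0(2)]])
    have "avg (T k) (\<lambda>\<gamma>. ip R0 (\<xi>0 n) (act R0 \<gamma> (\<xi>0 0)))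
        = avg (T k) (\<lambda>\<gamma>. ip R r (act R \<gamma> r) * cnj (ip R r (act R \<gamma> r)))" for k
      using ip0[OF one_closed] r R0(2) by (intro avg_cong) (simp add: R0.act_one R.act_one T_carrier)
    then show "(\<lambda>k. avg (T k) (\<lambda>\<gamma>. ip R0 (\<xi>0 n) (act R0 \<gamma> (\<xi>0 0)))) \<longlonglongrightarrow> \<theta>"
      using \<theta>_lim by simp
  qed
  obtain F c where F: "finite F" "F \<subseteq> carrier G \<times> UNIV"
    and near: "hnorm R0 (p0 - (\<Sum>(x, n)\<in>F. cscale (c (x, n)) (act R0 x (\<xi>0 n)))) < \<epsilon>"
    using dense[OF fixed_vecs_vecs[OF p0(1)] \<epsilon>] by blast
  have FG: "fst i \<in> carrier G" if "i \<in> F" for i using F that by auto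
  define dist2 where "dist2 = Re \<theta> - 2 * Re (\<Sum>i\<in>F. cnj (c i) * \<theta>) + Re (\<Sum>i\<in>F. \<Sum>j\<in>F. cnj (c i) * (c j * K i j))"
  have "(hnorm R0 (p0 - (\<Sum>i\<in>F. cscale (c i) (act R0 (fst i) (\<xi>0 (snd i))))))\<^sup>2 = dist2"
    unfolding dist2_def
  proof (rule R0.hnorm_diff_combination[OF F(1)])
    show "ip R0 (act R0 (fst i) (\<xi>0 (snd i))) p0 = \<theta>" if "i \<in> F" for i
      using ip_act_fixed[OF R0(1) p0(1) FG[OF that] R0(2)] \<theta>0 by simp
    show "ip R0 p0 p0 = \<theta>" using p0(2) \<theta>0 by simp
  qed (use p0(1) FG R0(2) in \<open>auto simp: fixed_vecs_vecs R0.act_closed ip0 K_def\<close>)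
  moreover have "(\<Sum>i\<in>F. cscale (c i) (act R0 (fst i) (\<xi>0 (snd i)))) = (\<Sum>(x, n)\<in>F. cscale (c (x, n)) (act R0 x (\<xi>0 n)))"
    by (intro sum.cong refl) auto
  moreover have "0 \<le> hnorm R0 (p0 - (\<Sum>i\<in>F. cscale (c i) (act R0 (fst i) (\<xi>0 (snd i)))))"
    using p0(1) FG R0(2) by (intro R0.nrm_nonneg R0.V_diff R0.V_sum) (auto simp: fixed_vecs_vecs R0.act_closed)
  ultimately have dist2: "dist2 < \<epsilon>\<^sup>2"
    using near power_strict_mono[of "hnorm R0 (p0 - (\<Sum>i\<in>F. cscale (c i) (act R0 (fst i) (\<xi>0 (snd i)))))" \<epsilon> 2]
    by simp
  show ?thesis
  proof (rule that[OF F])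
    fix w w' assume w: "w \<in> vecs R" "w' \<in> vecs R"
    define a where "a n = (if n = 0 then r else w)" for n :: nat
    define b where "b n = (if n = 0 then r else w')" for n :: nat
    have ab: "a n \<in> vecs R" "b n \<in> vecs R" for n using r w by (auto simp: a_def b_def)
    obtain R' :: "'g rep" and \<xi> where R': "unitary_rep G R'" "\<And>n. \<xi> n \<in> vecs R'"
      and ip': "\<And>x y n m. \<lbrakk>x \<in> carrier G; y \<in> carrier G\<rbrakk> \<Longrightarrow> ip R' (act R' x (\<xi> n)) (act R' y (\<xi> m))
          = ip R (act R x (a n)) (act R y (a m)) * cnj (ip R (act R x (b n)) (act R y (b m)))"
    proof (rule tensor_rep[of R a b, OF R ab], goal_cases)
      case (1 R' \<xi>)
      show ?case by (rule that[of R' \<xi>]) (assumption | rule 1)+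
    qed
    interpret R': unitary_rep G R' by (rule R')
    obtain p where p: "p \<in> fixed_vecs G R'" "ip R' p p = ip R' (\<xi> 0) p"
      "\<And>u. u \<in> vecs R' \<Longrightarrow> (\<lambda>n. avg (T n) (\<lambda>\<gamma>. ip R' u (act R' \<gamma> (\<xi> 0)))) \<longlonglongrightarrow> ip R' u p"
    proof (rule ergodic_mean[OF R'(1) R'(2)[of 0]], goal_cases)
      case (1 p)
      show ?case by (rule that[of p]) (assumption | rule 1)+
    qed
    have pV: "p \<in> vecs R'" using p(1) by (rule fixed_vecs_vecs)
    have ip1: "ip R' (\<xi> n) (act R' y (\<xi> m)) = ip R (a n) (act R y (a m)) * cnj (ip R (b n) (act R y (b m)))"
      if "y \<in> carrier G" for y n m
      using ip'[OF one_closed that, of n m] ab R'(2) by (simp add: R'.act_one R.act_one)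
    have \<theta>1: "ip R' (\<xi> 0) p = \<theta>"
    proof (rule LIMSEQ_unique[OF p(3)[OF R'(2)]])
      have "avg (T k) (\<lambda>\<gamma>. ip R' (\<xi> 0) (act R' \<gamma> (\<xi> 0)))
          = avg (T k) (\<lambda>\<gamma>. ip R r (act R \<gamma> r) * cnj (ip R r (act R \<gamma> r)))" for k
        by (intro avg_cong) (simp add: ip1 T_carrier a_def b_def)
      then show "(\<lambda>k. avg (T k) (\<lambda>\<gamma>. ip R' (\<xi> 0) (act R' \<gamma> (\<xi> 0)))) \<longlonglongrightarrow> \<theta>"
        using \<theta>_lim by simp
    qed
    have t: "ip R' (\<xi> 1) p = tmean R r r w w'"
    proof (rule LIMSEQ_unique[OF p(3)[OF R'(2)]])
      have "avg (T k) (\<lambda>\<gamma>. ip R' (\<xi> 1) (act R' \<gamma> (\<xi> 0)))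
          = avg (T k) (\<lambda>\<gamma>. ip R w (act R \<gamma> r) * cnj (ip R w' (act R \<gamma> r)))" for k
        by (intro avg_cong) (simp add: ip1 T_carrier a_def b_def)
      then show "(\<lambda>k. avg (T k) (\<lambda>\<gamma>. ip R' (\<xi> 1) (act R' \<gamma> (\<xi> 0)))) \<longlonglongrightarrow> tmean R r r w w'"
        using tmean_tendsto[OF R r r w] by simp
    qed
    define s where "s = (\<Sum>i\<in>F. cscale (c i) (act R' (fst i) (\<xi> 0)))"
    have sV: "s \<in> vecs R'" unfolding s_def using FG R'(2) by (intro R'.V_sum) (auto simp: R'.act_closed)
    have "(hnorm R' (p - s))\<^sup>2 = dist2"
      unfolding dist2_def s_def
    proof (rule R'.hnorm_diff_combination[OF F(1)])
      show "ip R' (act R' (fst i) (\<xi> 0)) p = \<theta>" if "i \<in> F" for i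
        using ip_act_fixed[OF R'(1) p(1) FG[OF that] R'(2)] \<theta>1 by simp
      show "ip R' p p = \<theta>" using p(2) \<theta>1 by simp
    qed (use pV FG R'(2) in \<open>auto simp: R'.act_closed ip' K_def a_def b_def\<close>)
    then have "(hnorm R' (p - s))\<^sup>2 < \<epsilon>\<^sup>2" using dist2 by simp
    then have near': "hnorm R' (p - s) \<le> \<epsilon>"
      using \<epsilon> by (meson less_imp_le power2_less_imp_less)
    have "(hnorm R' (\<xi> 1))\<^sup>2 = (hnorm R w * hnorm R w')\<^sup>2"
    proof -
      have "complex_of_real ((hnorm R' (\<xi> 1))\<^sup>2) = ip R' (\<xi> 1) (act R' \<one> (\<xi> 1))"
        using R'(2) by (simp add: R'.s_self_nrm R'.act_one)
      also have "\<dots> = ip R w w * cnj (ip R w' w')"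
        unfolding ip1[OF one_closed] using w by (simp add: a_def b_def R.act_one)
      also have "\<dots> = complex_of_real ((hnorm R w * hnorm R w')\<^sup>2)"
        using w by (simp add: R.s_self_nrm power_mult_distrib)
      finally show ?thesis by (simp only: of_real_eq_iff)
    qed
    then have norm1: "hnorm R' (\<xi> 1) = hnorm R w * hnorm R w'"
      by (rule power2_eq_imp_eq) (use R'(2) w in auto)
    have "ip R' (\<xi> 1) s = (\<Sum>i\<in>F. c i * (ip R w (act R (fst i) r) * cnj (ip R w' (act R (fst i) r))))"
    proof -
      have "ip R' (\<xi> 1) s = (\<Sum>i\<in>F. c i * ip R' (\<xi> 1) (act R' (fst i) (\<xi> 0)))"
        unfolding s_def using FG R'(2)
        by (subst R'.s_sum_right) (auto simp: R'.act_closed R'.s_scale_right)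
      also have "\<dots> = (\<Sum>i\<in>F. c i * (ip R w (act R (fst i) r) * cnj (ip R w' (act R (fst i) r))))"
        using FG by (intro sum.cong refl) (simp add: ip1 a_def b_def)
      finally show ?thesis .
    qed
    then have "tmean R r r w w' - (\<Sum>i\<in>F. c i * (ip R w (act R (fst i) r) * cnj (ip R w' (act R (fst i) r))))
        = ip R' (\<xi> 1) (p - s)"
      using t sV pV R'(2) by (simp add: R'.s_diff_right)
    also have "cmod \<dots> \<le> hnorm R' (\<xi> 1) * hnorm R' (p - s)"
      using sV pV R'(2) by (intro R'.cauchy_schwarz) auto
    also have "\<dots> \<le> (hnorm R w * hnorm R w') * \<epsilon>"
      unfolding norm1 using near' w by (intro mult_left_mono) auto
    finally show "cmod (tmean R r r w w' - (\<Sum>i\<in>F. c i * (ip R w (act R (fst i) r) * cnj (ip R w' (act R (fst i) r)))))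
         \<le> \<epsilon> * (hnorm R w * hnorm R w')" by (simp add: mult_ac)
  qed
qed

end

section \<open>Compact invariant forms\<close>

context complex_hilbert
begin

lemma top_eigenvector:
  assumes t: "semi_ip (vecs H) t"
    and bound: "\<And>w. w \<in> vecs H \<Longrightarrow> Re (t w w) \<le> C * (hnorm H w)\<^sup>2"
    and compact: "\<And>X :: nat \<Rightarrow> 'i \<Rightarrow> complex. \<lbrakk>\<And>n. X n \<in> vecs H; \<And>n. hnorm H (X n) \<le> 1\<rbrakk> \<Longrightarrow>
      \<exists>\<sigma>. strict_mono (\<sigma> :: nat \<Rightarrow> nat) \<and> (\<forall>\<epsilon>>0. \<exists>N. \<forall>m\<ge>N. \<forall>n\<ge>N. Re (t (X (\<sigma> m) - X (\<sigma> n)) (X (\<sigma> m) - X (\<sigma> n))) < \<epsilon>)"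
    and pos: "w0 \<in> vecs H" "Re (t w0 w0) > 0"
  obtains \<mu> f where "\<mu> > 0" "f \<in> vecs H" "hnorm H f = 1"
    "\<And>w. w \<in> vecs H \<Longrightarrow> t w f = of_real \<mu> * ip H w f"
    "\<And>w. w \<in> vecs H \<Longrightarrow> Re (t w w) \<le> \<mu> * (hnorm H w)\<^sup>2"
proof -
  interpret t: semi_ip "vecs H" t by (rule t)
  define U where "U = {f \<in> vecs H. hnorm H f = 1}"
  define \<mu> where "\<mu> = Sup ((\<lambda>f. Re (t f f)) ` U)"
  have bdd: "bdd_above ((\<lambda>f. Re (t f f)) ` U)"
    using bound by (intro bdd_aboveI2[of _ _ C]) (force simp: U_def)
  have upper: "Re (t f f) \<le> \<mu>" if "f \<in> U" for f
    unfolding \<mu>_def using bdd that by (intro cSup_upper) auto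
  have scaled: "\<exists>f\<in>U. w = cscale (of_real (hnorm H w)) f" if w: "w \<in> vecs H" "w \<noteq> 0" for w
  proof -
    have n: "hnorm H w > 0" using w hnorm_eq_0[of w] nrm_nonneg[of w] by linarith
    define f where "f = cscale (1 / of_real (hnorm H w)) w"
    have 1: "hnorm H f = 1" unfolding f_def using w n by (subst nrm_scale) (auto simp: norm_divide)
    have 2: "w = cscale (of_real (hnorm H w)) f" using n by (simp add: f_def)
    have "f \<in> vecs H" using w by (simp add: f_def)
    with 1 have "f \<in> U" by (simp add: U_def)
    show ?thesis by (rule bexI[of _ f]) (fact 2, fact \<open>f \<in> U\<close>)
  qed
  have tscale: "Re (t (cscale (of_real x) f) (cscale (of_real x) f)) = x\<^sup>2 * Re (t f f)" if "f \<in> vecs H" for x f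
    using that by (simp add: t.s_scale_left t.s_scale_right power2_eq_square)
  have le: "Re (t w w) \<le> \<mu> * (hnorm H w)\<^sup>2" if w: "w \<in> vecs H" for w
  proof (cases "w = 0")
    case True
    then show ?thesis using w by simp
  next
    case False
    obtain f where f: "f \<in> U" "w = cscale (of_real (hnorm H w)) f" using scaled[OF w False] by blast
    have "Re (t w w) = (hnorm H w)\<^sup>2 * Re (t f f)"
      using tscale[of f "hnorm H w"] f unfolding U_def by auto
    also have "\<dots> \<le> (hnorm H w)\<^sup>2 * \<mu>" using upper[OF f(1)] by (intro mult_left_mono) auto
    finally show ?thesis by (simp add: mult.commute)
  qed
  have "w0 \<noteq> 0" using pos t.s_zero_right[of 0] by auto
  then have lpos: "\<mu> > 0"
    using le[OF pos(1)] pos(2) by (meson less_le_trans linorder_not_le mult_nonpos_nonneg zero_le_power2)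
  have Une: "U \<noteq> {}" using scaled[OF pos(1) \<open>w0 \<noteq> 0\<close>] by blast
  define q where "q u v = of_real \<mu> * ip H u v - t u v" for u v
  interpret q: semi_ip "vecs H" q
  proof
    show "0 \<le> Re (q v v)" if "v \<in> vecs H" for v
      using le[OF that] that by (simp add: q_def nrm_sq)
    show "q v u = cnj (q u v)" if "u \<in> vecs H" "v \<in> vecs H" for u v
      using that ip_cnj[of u v] t.s_cnj[of u v] by (simp add: q_def)
  qed (auto simp: q_def subspace_vecs s_add_right s_scale_right t.s_add_right t.s_scale_right algebra_simps)
  have split: "\<mu> * (hnorm H u)\<^sup>2 = (q.nrm u)\<^sup>2 + Re (t u u)" if "u \<in> vecs H" for u
    using that by (simp add: q.nrm_sq q_def nrm_sq)
  have "\<exists>f\<in>U. \<mu> - inverse (real (Suc n)) < Re (t f f)" for n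
  proof -
    have "\<mu> - inverse (real (Suc n)) < \<mu>" by simp
    then show ?thesis
      unfolding \<mu>_def using Une bdd by (subst (asm) less_cSup_iff) auto
  qed
  then obtain X where X: "\<And>n. X n \<in> U" "\<And>n. \<mu> - inverse (real (Suc n)) < Re (t (X n) (X n))" by metis
  have XV: "X n \<in> vecs H" and X1: "hnorm H (X n) = 1" for n using X(1) by (auto simp: U_def)
  have qX: "(\<lambda>n. q.nrm (X n)) \<longlonglongrightarrow> 0"
  proof -
    have "(q.nrm (X n))\<^sup>2 \<le> inverse (real (Suc n))" for n
      using split[OF XV[of n]] X(2)[of n] X1[of n] by simp
    then have "(\<lambda>n. (q.nrm (X n))\<^sup>2) \<longlonglongrightarrow> 0"
      by (intro Lim_null_comparison[OF _ LIMSEQ_inverse_real_of_nat]) (auto intro: always_eventually)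
    from tendsto_real_sqrt[OF this] show ?thesis using XV by (simp add: real_sqrt_abs)
  qed
  obtain \<sigma> where \<sigma>: "strict_mono (\<sigma> :: nat \<Rightarrow> nat)"
    and tc: "\<And>\<epsilon>. \<epsilon> > 0 \<Longrightarrow> \<exists>N. \<forall>m\<ge>N. \<forall>n\<ge>N. Re (t (X (\<sigma> m) - X (\<sigma> n)) (X (\<sigma> m) - X (\<sigma> n))) < \<epsilon>"
    using compact[of X] XV X1 by auto
  define Y where "Y n = X (\<sigma> n)" for n
  have YV: "Y n \<in> vecs H" and Y1: "hnorm H (Y n) = 1" for n using XV X1 by (auto simp: Y_def)
  have qY: "(\<lambda>n. q.nrm (Y n)) \<longlonglongrightarrow> 0"
    using LIMSEQ_subseq_LIMSEQ[OF qX \<sigma>] by (simp add: Y_def o_def)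
  have "\<forall>e>0. \<exists>N. \<forall>m\<ge>N. \<forall>n\<ge>N. hnorm H (Y m - Y n) < e"
  proof (intro allI impI)
    fix e :: real assume e: "e > 0"
    define d where "d = \<mu> * e\<^sup>2 / 2"
    have d: "d > 0" using e lpos by (simp add: d_def)
    obtain N where N: "\<And>m n. m \<ge> N \<Longrightarrow> n \<ge> N \<Longrightarrow> Re (t (Y m - Y n) (Y m - Y n)) < d"
      using tc[OF d] by (auto simp: Y_def)
    have "sqrt d / 2 > 0" using d by simp
    from LIMSEQ_D[OF qY this] obtain M where M: "\<And>n. n \<ge> M \<Longrightarrow> q.nrm (Y n) < sqrt d / 2"
      using YV by auto
    have "hnorm H (Y m - Y n) < e" if mn: "m \<ge> max M N" "n \<ge> max M N" for m n
    proof -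
      have "q.nrm (Y m - Y n) \<le> q.nrm (Y m) + q.nrm (Y n)"
        using q.nrm_triangle[of "Y m" "- Y n"] q.nrm_minus_commute[of 0 "Y n"] YV by simp
      also have "\<dots> < sqrt d" using M[of m] M[of n] mn by simp
      finally have "(q.nrm (Y m - Y n))\<^sup>2 < d"
        using YV d power_strict_mono[of "q.nrm (Y m - Y n)" "sqrt d" 2] by simp
      then have "\<mu> * (hnorm H (Y m - Y n))\<^sup>2 < d + d"
        unfolding split[OF V_diff[OF YV YV]] using N[of m n] mn by (intro add_strict_mono) auto
      then have "\<mu> * (hnorm H (Y m - Y n))\<^sup>2 < \<mu> * e\<^sup>2" by (simp add: d_def)
      then have "(hnorm H (Y m - Y n))\<^sup>2 < e\<^sup>2" using lpos by simp
      then show ?thesis by (rule power2_less_imp_less) (use e in simp)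
    qed
    then show "\<exists>N. \<forall>m\<ge>N. \<forall>n\<ge>N. hnorm H (Y m - Y n) < e" by blast
  qed
  with complete[of Y] YV obtain f where f: "f \<in> vecs H" "(\<lambda>n. hnorm H (Y n - f)) \<longlonglongrightarrow> 0" by blast
  have f1: "hnorm H f = 1"
    using hnorm_tendsto[OF YV f] Y1 by (simp add: LIMSEQ_const_iff)
  have qf: "q.nrm f = 0"
  proof -
    have "q.nrm f \<le> sqrt \<mu> * hnorm H (Y n - f) + q.nrm (Y n)" for n
    proof -
      have "q.nrm f \<le> q.nrm (f - Y n) + q.nrm (Y n)"
        using q.nrm_triangle[of "f - Y n" "Y n"] YV f by simp
      moreover have "(q.nrm (f - Y n))\<^sup>2 \<le> (sqrt \<mu> * hnorm H (f - Y n))\<^sup>2"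
        using split[of "f - Y n"] t.s_nonneg[of "f - Y n"] YV f lpos by (simp add: power_mult_distrib)
      then have "q.nrm (f - Y n) \<le> sqrt \<mu> * hnorm H (f - Y n)"
        by (rule power2_le_imp_le) (use YV f lpos in simp)
      ultimately show ?thesis using nrm_minus_commute[OF f(1) YV] by simp
    qed
    moreover have "(\<lambda>n. sqrt \<mu> * hnorm H (Y n - f) + q.nrm (Y n)) \<longlonglongrightarrow> sqrt \<mu> * 0 + 0"
      by (intro tendsto_intros f qY)
    ultimately have "q.nrm f \<le> sqrt \<mu> * 0 + 0"
      by (intro tendsto_lowerbound[of "\<lambda>n. sqrt \<mu> * hnorm H (Y n - f) + q.nrm (Y n)"])
        (auto intro: always_eventually)
    then show ?thesis using q.nrm_nonneg[OF f(1)] by simp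
  qed
  have "t w f = of_real \<mu> * ip H w f" if "w \<in> vecs H" for w
    using q.cauchy_schwarz[OF that f(1)] qf by (simp add: q_def)
  then show ?thesis using that lpos f(1) f1 le by blast
qed

lemma form_compact_if_tail_bound:
  fixes X :: "nat \<Rightarrow> 'i \<Rightarrow> complex"
  assumes "\<And>\<epsilon>. \<epsilon> > 0 \<Longrightarrow> \<exists>h. h \<longlonglongrightarrow> (0::real) \<and> (\<forall>m n. Re (t (X m - X n) (X m - X n)) \<le> \<epsilon> + h m + h n)"
    and "\<epsilon> > 0"
  shows "\<exists>N. \<forall>m\<ge>N. \<forall>n\<ge>N. Re (t (X m - X n) (X m - X n)) < \<epsilon>"
proof -
  obtain h where h: "h \<longlonglongrightarrow> 0" "\<And>m n. Re (t (X m - X n) (X m - X n)) \<le> \<epsilon> / 2 + h m + h n"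
    using assms(1)[of "\<epsilon> / 2"] assms(2) by auto
  obtain N where N: "\<And>n. n \<ge> N \<Longrightarrow> \<bar>h n\<bar> < \<epsilon> / 4"
    using LIMSEQ_D[OF h(1), of "\<epsilon> / 4"] assms(2) by auto
  have "Re (t (X m - X n) (X m - X n)) < \<epsilon>" if "m \<ge> N" "n \<ge> N" for m n
    using h(2)[of m n] N[OF that(1)] N[OF that(2)] by linarith
  then show ?thesis by blast
qed

end

lemma cmod_diff_sq_le:
  "(cmod (a - b))\<^sup>2 \<le> 2 * (cmod (a - l))\<^sup>2 + 2 * (cmod (b - l))\<^sup>2"
proof -
  have "cmod (a - b) \<le> cmod (a - l) + cmod (b - l)"
    using norm_triangle_ineq4[of "a - l" "b - l"] by simp
  then have "(cmod (a - b))\<^sup>2 \<le> (cmod (a - l) + cmod (b - l))\<^sup>2" by (intro power_mono) auto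
  also have "\<dots> \<le> 2 * (cmod (a - l))\<^sup>2 + 2 * (cmod (b - l))\<^sup>2"
    using sum_squares_bound[of "cmod (a - l)" "cmod (b - l)"] by (simp add: power2_sum)
  finally show ?thesis .
qed

context ergodic_seq
begin

lemma tmean_compact:
  fixes R :: "('g, 'i) urep"
  assumes R: "unitary_rep G R" and r: "r \<in> vecs R"
    and X: "\<And>n. X n \<in> vecs R" "\<And>n. hnorm R (X n) \<le> 1"
  shows "\<exists>\<sigma>. strict_mono (\<sigma> :: nat \<Rightarrow> nat) \<and>
    (\<forall>\<epsilon>>0. \<exists>N. \<forall>m\<ge>N. \<forall>n\<ge>N. Re (tmean R r r (X (\<sigma> m) - X (\<sigma> n)) (X (\<sigma> m) - X (\<sigma> n))) < \<epsilon>)"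
proof -
  interpret R: unitary_rep G R by (rule R)
  define good where "good \<epsilon> F c \<longleftrightarrow> finite F \<and> F \<subseteq> carrier G \<times> UNIV \<and>
    (\<forall>w\<in>vecs R. \<forall>w'\<in>vecs R.
       cmod (tmean R r r w w' - (\<Sum>i\<in>F. c i * (ip R w (act R (fst i) r) * cnj (ip R w' (act R (fst i) r)))))
         \<le> \<epsilon> * (hnorm R w * hnorm R w'))" for \<epsilon> and F :: "('g \<times> nat) set" and c
  have "\<exists>F c. good (inverse (real (Suc k))) F c" for k
  proof -
    have "inverse (real (Suc k)) > 0" by simp
    then show ?thesis
    proof (rule tmean_finite_rank_approx[OF R r], goal_cases)
      case (1 F c)
      then show ?case unfolding good_def by blast
    qed
  qed
  then obtain F c where Fc: "\<And>k. good (inverse (real (Suc k))) (F k) (c k)" by metis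
  define S where "S = (\<Union>k. fst ` F k)"
  have S: "countable S" unfolding S_def using Fc by (auto simp: good_def intro: countable_finite)
  have SG: "x \<in> carrier G" if "x \<in> S" for x using that Fc unfolding good_def S_def by fastforce
  have b: "cmod (ip R (X n) (act R x r)) \<le> hnorm R r" if "x \<in> S" for n x
  proof -
    have "cmod (ip R (X n) (act R x r)) \<le> hnorm R (X n) * hnorm R (act R x r)"
      using SG[OF that] X r by (intro R.cauchy_schwarz) (auto simp: R.act_closed)
    also have "\<dots> \<le> 1 * hnorm R r" using SG[OF that] r mult_right_mono[OF X(2)[of n], of "hnorm R r"] by simp
    finally show ?thesis by simp
  qed
  obtain \<sigma> where \<sigma>: "strict_mono (\<sigma> :: nat \<Rightarrow> nat)"
    and conv: "\<And>x. x \<in> S \<Longrightarrow> \<exists>l. (\<lambda>n. ip R (X (\<sigma> n)) (act R x r)) \<longlonglongrightarrow> l"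
    using function_convergent_subsequence[of S "\<lambda>n x. ip R (X n) (act R x r)" "hnorm R r", OF S b] by metis
  then obtain l where l: "\<And>x. x \<in> S \<Longrightarrow> (\<lambda>n. ip R (X (\<sigma> n)) (act R x r)) \<longlonglongrightarrow> l x" by metis
  have "\<exists>N. \<forall>m\<ge>N. \<forall>n\<ge>N. Re (tmean R r r (X (\<sigma> m) - X (\<sigma> n)) (X (\<sigma> m) - X (\<sigma> n))) < \<epsilon>" if "\<epsilon> > 0" for \<epsilon>
  proof (rule R.form_compact_if_tail_bound[of "tmean R r r" "\<lambda>n. X (\<sigma> n)", OF _ that])
    fix \<epsilon> :: real assume "\<epsilon> > 0"
    then obtain k where k: "inverse (real (Suc k)) < \<epsilon> / 4"
      using reals_Archimedean[of "\<epsilon> / 4"] by auto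
    have Fk: "finite (F k)" "F k \<subseteq> carrier G \<times> UNIV" using Fc[of k] by (auto simp: good_def)
    have FS: "fst i \<in> S" if "i \<in> F k" for i using that by (auto simp: S_def)
    define h where "h n = (\<Sum>i\<in>F k. cmod (c k i) * (2 * (cmod (ip R (X (\<sigma> n)) (act R (fst i) r) - l (fst i)))\<^sup>2))" for n
    have "h \<longlonglongrightarrow> (\<Sum>i\<in>F k. cmod (c k i) * (2 * (cmod (l (fst i) - l (fst i)))\<^sup>2))"
      unfolding h_def using FS by (intro tendsto_intros l) auto
    then have "h \<longlonglongrightarrow> 0" by simp
    moreover have "Re (tmean R r r (X (\<sigma> m) - X (\<sigma> n)) (X (\<sigma> m) - X (\<sigma> n))) \<le> \<epsilon> + h m + h n" for m n
    proof -
      define u where "u = X (\<sigma> m) - X (\<sigma> n)"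
      have uV: "u \<in> vecs R" using X by (simp add: u_def)
      have u2: "hnorm R u \<le> 2"
        using R.nrm_triangle[of "X (\<sigma> m)" "- X (\<sigma> n)"] R.nrm_minus_commute[of 0 "X (\<sigma> n)"]
          X(1) X(2)[of "\<sigma> m"] X(2)[of "\<sigma> n"] by (simp add: u_def)
      define K where "K = (\<Sum>i\<in>F k. c k i * (ip R u (act R (fst i) r) * cnj (ip R u (act R (fst i) r))))"
      have "cmod (tmean R r r u u - K) \<le> inverse (real (Suc k)) * (hnorm R u * hnorm R u)"
        using Fc[of k] uV unfolding good_def K_def by blast
      also have "\<dots> \<le> (\<epsilon> / 4) * (2 * 2)"
        using k u2 uV \<open>\<epsilon> > 0\<close> by (intro mult_mono) auto
      finally have 1: "cmod (tmean R r r u u - K) \<le> \<epsilon>" by simp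
      have "cmod K \<le> (\<Sum>i\<in>F k. cmod (c k i * (ip R u (act R (fst i) r) * cnj (ip R u (act R (fst i) r)))))"
        unfolding K_def by (rule norm_sum)
      also have "\<dots> = (\<Sum>i\<in>F k. cmod (c k i) * (cmod (ip R (X (\<sigma> m)) (act R (fst i) r) - ip R (X (\<sigma> n)) (act R (fst i) r)))\<^sup>2)"
        using Fk X r by (intro sum.cong refl)
          (auto simp: u_def norm_mult power2_eq_square R.s_diff_left R.act_closed)
      also have "\<dots> \<le> (\<Sum>i\<in>F k. cmod (c k i) * (2 * (cmod (ip R (X (\<sigma> m)) (act R (fst i) r) - l (fst i)))\<^sup>2
            + 2 * (cmod (ip R (X (\<sigma> n)) (act R (fst i) r) - l (fst i)))\<^sup>2))"
        by (intro sum_mono mult_left_mono cmod_diff_sq_le) auto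
      also have "\<dots> = h m + h n" unfolding h_def by (simp add: sum.distrib distrib_left)
      finally have 2: "cmod K \<le> h m + h n" .
      have "Re (tmean R r r u u) \<le> cmod (tmean R r r u u - K) + cmod K"
        using complex_Re_le_cmod[of "tmean R r r u u"] norm_triangle_ineq[of "tmean R r r u u - K" K] by simp
      then show ?thesis using 1 2 by (simp add: u_def)
    qed
    ultimately show "\<exists>h. h \<longlonglongrightarrow> 0 \<and> (\<forall>m n. Re (tmean R r r (X (\<sigma> m) - X (\<sigma> n)) (X (\<sigma> m) - X (\<sigma> n))) \<le> \<epsilon> + h m + h n)"
      by blast
  qed
  then show ?thesis using \<sigma> by blast
qed

text \<open>The top eigenspace of the form is invariant, and it is finite-dimensional by the trace bound.\<close>

lemma tmean_top_eigenspace: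
  fixes R :: "('g, 'i) urep"
  assumes R: "unitary_rep G R" and r: "r \<in> vecs R"
  obtains \<mu> E where "invariant_frame G R E"
    "\<And>w. w \<in> vecs R \<Longrightarrow> Re (tmean R r r w w) \<le> \<mu> * (hnorm R w)\<^sup>2"
    "\<mu> \<le> (hnorm R (proj R E r))\<^sup>2"
    "\<And>v e. \<lbrakk>v \<in> vecs R; \<And>\<gamma>. \<gamma> \<in> carrier G \<Longrightarrow> ip R v (act R \<gamma> r) = 0; e \<in> E\<rbrakk> \<Longrightarrow> ip R v e = 0"
proof (cases "\<exists>w\<in>vecs R. Re (tmean R r r w w) > 0")
  case False
  interpret R: unitary_rep G R by (rule R)
  have "invariant_frame G R {}" by (auto simp: invariant_frame_def orthonormal_def)
  then show ?thesis using that[of "{}" 0] False by (auto simp: not_less)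
next
  case True
  then obtain w0 where w0: "w0 \<in> vecs R" "Re (tmean R r r w0 w0) > 0" by blast
  interpret R: unitary_rep G R by (rule R)
  interpret t: semi_ip "vecs R" "tmean R r r" by (rule semi_ip_tmean[OF R r])
  obtain \<mu> f where l: "\<mu> > 0" and f: "f \<in> vecs R" "hnorm R f = 1"
    and eig: "\<And>w. w \<in> vecs R \<Longrightarrow> tmean R r r w f = of_real \<mu> * ip R w f"
    and le: "\<And>w. w \<in> vecs R \<Longrightarrow> Re (tmean R r r w w) \<le> \<mu> * (hnorm R w)\<^sup>2"
  proof (rule R.top_eigenvector[OF semi_ip_tmean[OF R r] _ _ w0])
    show "Re (tmean R r r w w) \<le> (hnorm R r)\<^sup>2 * (hnorm R w)\<^sup>2" if "w \<in> vecs R" for w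
      using tmean_bound[OF R r that] by (simp add: mult.commute)
    show "\<exists>\<sigma>. strict_mono (\<sigma> :: nat \<Rightarrow> nat) \<and>
        (\<forall>\<epsilon>>0. \<exists>N. \<forall>m\<ge>N. \<forall>n\<ge>N. Re (tmean R r r (X (\<sigma> m) - X (\<sigma> n)) (X (\<sigma> m) - X (\<sigma> n))) < \<epsilon>)"
      if "\<And>n. X n \<in> vecs R" "\<And>n. hnorm R (X n) \<le> 1" for X
      using that by (rule tmean_compact[OF R r])
  qed (rule that)
  define W where "W = {f \<in> vecs R. \<forall>w\<in>vecs R. tmean R r r w f = of_real \<mu> * ip R w f}"
  have W: "cvs.subspace W" "W \<subseteq> vecs R"
    by (auto simp: W_def R.s_add_right R.s_scale_right t.s_add_right t.s_scale_right distrib_left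
        intro!: cvs.subspaceI)
  have fW: "f \<in> W" using f eig by (simp add: W_def)
  have trace: "real (card E) * \<mu> \<le> (hnorm R r)\<^sup>2" if E: "orthonormal R E" "E \<subseteq> W" for E
  proof -
    have "real (card E) * \<mu> = (\<Sum>e\<in>E. Re (tmean R r r e e))"
      using E by (subst sum.cong[OF refl, of _ _ "\<lambda>_. \<mu>"])
        (auto simp: W_def subset_iff R.orthonormal_ip)
    also have "\<dots> \<le> (hnorm R r)\<^sup>2"
      by (rule sum_tmean_le[OF R r E(1)])
    finally show ?thesis .
  qed
  have "card E \<le> nat \<lceil>(hnorm R r)\<^sup>2 / \<mu>\<rceil>" if "orthonormal R E" "E \<subseteq> W" for E
  proof -
    have "real (card E) \<le> (hnorm R r)\<^sup>2 / \<mu>" using trace[OF that] l by (simp add: field_simps)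
    then show ?thesis by linarith
  qed
  from R.ex_orthonormal_basis[OF W this] obtain E where E: "orthonormal R E" "cvs.span E = W" by blast
  have inv: "invariant_frame G R E"
    unfolding invariant_frame_def E(2)
  proof (intro conjI E ballI)
    fix g v assume g: "g \<in> carrier G" and v: "v \<in> W"
    have vV: "v \<in> vecs R" using v W by blast
    have "tmean R r r w (act R g v) = of_real \<mu> * ip R w (act R g v)" if w: "w \<in> vecs R" for w
    proof -
      let ?w = "act R (inv g) w"
      have wV: "?w \<in> vecs R" using g w by (simp add: R.act_closed)
      have "tmean R r r w (act R g v) = tmean R r r (act R g ?w) (act R g v)" using g w by simp
      also have "\<dots> = tmean R r r ?w v" by (rule tmean_invariant[OF R r r wV vV g])
      also have "\<dots> = of_real \<mu> * ip R ?w v" using v wV by (simp add: W_def)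
      also have "ip R ?w v = ip R w (act R g v)" using R.ip_act_left[of "inv g" w v] g w vV by simp
      finally show ?thesis .
    qed
    then show "act R g v \<in> W" using g vV by (simp add: W_def R.act_closed)
  qed
  have "\<mu> \<le> (hnorm R (proj R E r))\<^sup>2"
  proof -
    have "Re (tmean R r r f f) = \<mu>" using eig[OF f(1)] f R.s_self_nrm[OF f(1)] by simp
    moreover have "Re (tmean R r r f f) \<le> (hnorm R (proj R E r))\<^sup>2"
    proof (rule tendsto_upperbound[OF tendsto_Re[OF tmean_tendsto[OF R r r f(1) f(1)]]])
      have "Re (avg (T n) (\<lambda>\<gamma>. ip R f (act R \<gamma> r) * cnj (ip R f (act R \<gamma> r)))) \<le> (hnorm R (proj R E r))\<^sup>2" for n
      proof (rule order_trans[OF complex_Re_le_cmod cmod_avg_le])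
        fix \<gamma> assume "\<gamma> \<in> T n"
        then have g: "\<gamma> \<in> carrier G" by (rule T_carrier)
        let ?f = "act R (inv \<gamma>) f"
        have fE: "?f \<in> cvs.span E" using R.frame_act[OF inv] g fW E by simp
        have fV: "?f \<in> vecs R" using g f by (simp add: R.act_closed)
        have "ip R f (act R \<gamma> r) = ip R ?f r" using R.ip_act_left[of "inv \<gamma>" f r] g f r by simp
        also have "\<dots> = ip R ?f (proj R E r)"
          using R.proj_orth[OF E(1) r fE] fV r R.proj_vecs[OF E(1)] by (simp add: R.s_diff_right)
        finally have "cmod (ip R f (act R \<gamma> r)) \<le> hnorm R ?f * hnorm R (proj R E r)"
          using R.cauchy_schwarz[OF fV R.proj_vecs[OF E(1)]] by simp
        then have "cmod (ip R f (act R \<gamma> r)) \<le> hnorm R (proj R E r)" using g f by simp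
        then show "cmod (ip R f (act R \<gamma> r) * cnj (ip R f (act R \<gamma> r))) \<le> (hnorm R (proj R E r))\<^sup>2"
          unfolding norm_mult complex_mod_cnj power2_eq_square
            using R.nrm_nonneg[OF R.proj_vecs[OF E(1)]] by (intro mult_mono) auto
      qed simp
      then show "\<forall>\<^sub>F n in sequentially. Re (avg (T n) (\<lambda>\<gamma>. ip R f (act R \<gamma> r) * cnj (ip R f (act R \<gamma> r)))) \<le> (hnorm R (proj R E r))\<^sup>2"
        by (intro always_eventually allI)
    qed simp
    ultimately show ?thesis by simp
  qed
  moreover have "ip R v e = 0"
    if v: "v \<in> vecs R" and z: "\<And>\<gamma>. \<gamma> \<in> carrier G \<Longrightarrow> ip R v (act R \<gamma> r) = 0" and e: "e \<in> E" for v e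
  proof -
    have eW: "e \<in> W" using e E cvs.span_base by blast
    have "avg (T n) (\<lambda>\<gamma>. ip R v (act R \<gamma> r) * cnj (ip R e (act R \<gamma> r))) = 0" for n
      by (subst avg_cong[of _ _ "\<lambda>_. 0"]) (auto simp: z T_carrier avg_def)
    then have "tmean R r r v e = 0"
      using tmean_tendsto[OF R r r v, of e] eW W by (auto simp: LIMSEQ_const_iff)
    then show ?thesis using eW v l by (auto simp: W_def)
  qed
  ultimately show ?thesis using that[OF inv le] by blast
qed

text \<open>
  Enlarging an invariant frame that nearly maximises the norm of the projection of \<open>\<xi>\<close> by the top
  eigenspace for the residual shows that the top eigenvalue is small.
\<close>

lemma almost_periodic_approx:
  fixes R :: "('g, 'i) urep"
  assumes R: "unitary_rep G R" and \<xi>: "\<xi> \<in> vecs R" and \<delta>: "\<delta> > 0"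
  obtains E where "invariant_frame G R E"
    "\<And>w. w \<in> vecs R \<Longrightarrow> Re (tmean R (\<xi> - proj R E \<xi>) (\<xi> - proj R E \<xi>) w w) \<le> \<delta> * (hnorm R w)\<^sup>2"
proof -
  interpret R: unitary_rep G R by (rule R)
  define P where "P = (\<lambda>E. (hnorm R (proj R E \<xi>))\<^sup>2) ` {E. invariant_frame G R E}"
  have "invariant_frame G R {}" by (auto simp: invariant_frame_def orthonormal_def)
  then have ne: "P \<noteq> {}" by (auto simp: P_def)
  have bdd: "bdd_above P"
    unfolding P_def using R.bessel[OF R.frame_orthonormal \<xi>] R.hnorm_proj_sq[OF R.frame_orthonormal]
    by (intro bdd_aboveI2[of _ _ "(hnorm R \<xi>)\<^sup>2"]) auto
  have "Sup P - \<delta> < Sup P" using \<delta> by simp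
  then obtain y where "y \<in> P" "Sup P - \<delta> < y" using less_cSup_iff[OF ne bdd] by blast
  then obtain E where E: "invariant_frame G R E" and near: "Sup P - \<delta> < (hnorm R (proj R E \<xi>))\<^sup>2"
    by (auto simp: P_def)
  note onE = R.frame_orthonormal[OF E]
  define r where "r = \<xi> - proj R E \<xi>"
  have rV: "r \<in> vecs R" using \<xi> R.proj_vecs[OF onE] by (simp add: r_def)
  obtain \<mu> E' where E': "invariant_frame G R E'"
    and le: "\<And>w. w \<in> vecs R \<Longrightarrow> Re (tmean R r r w w) \<le> \<mu> * (hnorm R w)\<^sup>2"
    and lam: "\<mu> \<le> (hnorm R (proj R E' r))\<^sup>2"
    and orth: "\<And>v e. \<lbrakk>v \<in> vecs R; \<And>\<gamma>. \<gamma> \<in> carrier G \<Longrightarrow> ip R v (act R \<gamma> r) = 0; e \<in> E'\<rbrakk> \<Longrightarrow> ip R v e = 0"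
    by (rule tmean_top_eigenspace[OF R rV]) blast
  note onE' = R.frame_orthonormal[OF E']
  have orthE: "ip R v (act R \<gamma> r) = 0" if "v \<in> cvs.span E" "\<gamma> \<in> carrier G" for v \<gamma>
  proof -
    have "act R (inv \<gamma>) v \<in> cvs.span E" using R.frame_act[OF E] that by simp
    then have "ip R (act R (inv \<gamma>) v) r = 0" unfolding r_def using R.proj_orth[OF onE \<xi>] by blast
    then show ?thesis
      using R.ip_act_left[of "inv \<gamma>" v r] that rV R.orthonormal_span_vecs[OF onE] by simp
  qed
  have EE': "ip R e e' = 0" if "e \<in> E" "e' \<in> E'" for e e'
  proof (rule orth[OF R.orthonormal_vecs[OF onE that(1)] _ that(2)])
    show "ip R e (act R \<gamma> r) = 0" if "\<gamma> \<in> carrier G" for \<gamma>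
      using cvs.span_base[OF \<open>e \<in> E\<close>] that by (rule orthE)
  qed
  note un = R.orthonormal_Un[OF onE onE' EE']
  have inv: "invariant_frame G R (E \<union> E')"
  proof (rule R.invariant_frameI[OF un(1)])
    fix g e assume g: "g \<in> carrier G" and e: "e \<in> E \<union> E'"
    have "cvs.span E \<subseteq> cvs.span (E \<union> E')" "cvs.span E' \<subseteq> cvs.span (E \<union> E')"
      by (intro cvs.span_mono; simp)+
    moreover have "act R g e \<in> cvs.span E \<or> act R g e \<in> cvs.span E'"
      using e R.frame_act[OF E g cvs.span_base] R.frame_act[OF E' g cvs.span_base] by auto
    ultimately show "act R g e \<in> cvs.span (E \<union> E')" by auto
  qed
  have "(hnorm R (proj R (E \<union> E') \<xi>))\<^sup>2 = (hnorm R (proj R E \<xi>))\<^sup>2 + (hnorm R (proj R E' r))\<^sup>2"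
  proof -
    have "ip R e r = ip R e \<xi>" if "e \<in> E'" for e
    proof -
      have eV: "e \<in> vecs R" using onE' that by (rule R.orthonormal_vecs)
      have "ip R e (proj R E \<xi>) = (\<Sum>e'\<in>E. ip R e' \<xi> * ip R e e')"
        unfolding proj_def using eV R.orthonormal_vecs[OF onE]
        by (simp add: R.s_sum_right R.s_scale_right)
      also have "\<dots> = 0"
      proof (rule sum.neutral, rule ballI)
        fix e' assume e': "e' \<in> E"
        then show "ip R e' \<xi> * ip R e e' = 0"
          using EE'[OF e' that] R.ip_cnj[OF R.orthonormal_vecs[OF onE e'] eV] by simp
      qed
      finally show ?thesis using eV \<xi> R.proj_vecs[OF onE] by (simp add: r_def R.s_diff_right)
    qed
    then show ?thesis
      using un(2) R.orthonormal_finite[OF onE] R.orthonormal_finite[OF onE']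
      by (simp add: R.hnorm_proj_sq[OF un(1)] R.hnorm_proj_sq[OF onE] R.hnorm_proj_sq[OF onE'] sum.union_disjoint)
  qed
  moreover have "(hnorm R (proj R (E \<union> E') \<xi>))\<^sup>2 \<le> Sup P"
    using inv bdd by (intro cSup_upper) (auto simp: P_def)
  ultimately have "\<mu> \<le> \<delta>" using near lam by simp
  then have "Re (tmean R r r w w) \<le> \<delta> * (hnorm R w)\<^sup>2" if "w \<in> vecs R" for w
    using le[OF that] mult_right_mono[of \<mu> \<delta> "(hnorm R w)\<^sup>2"] by simp
  then show ?thesis using that[OF E] by (simp add: r_def)
qed

end

section \<open>Schur's lemma and orthogonality relations\<close>

lemma (in semi_ip) nrm_sum_le: "(\<And>i. i \<in> I \<Longrightarrow> f i \<in> V) \<Longrightarrow> nrm (\<Sum>i\<in>I. f i) \<le> (\<Sum>i\<in>I. nrm (f i))"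
proof (induction I rule: infinite_finite_induct)
  case (insert x F)
  have "nrm (\<Sum>i\<in>insert x F. f i) = nrm (f x + (\<Sum>i\<in>F. f i))"
    using insert(1,2) by (subst sum.insert) auto
  also have "\<dots> \<le> nrm (f x) + nrm (\<Sum>i\<in>F. f i)" using insert by (intro nrm_triangle V_sum) auto
  also have "\<dots> \<le> nrm (f x) + (\<Sum>i\<in>F. nrm (f i))" using insert by simp
  also have "\<dots> = (\<Sum>i\<in>insert x F. nrm (f i))" using insert(1,2) by simp
  finally show ?case .
qed auto

context complex_hilbert
begin

lemma fd_top_eigenvector:
  assumes E: "orthonormal H E" "vecs H = cvs.span E"
    and t: "semi_ip (vecs H) t" and pos: "w0 \<in> vecs H" "Re (t w0 w0) > 0"
  obtains \<mu> f where "\<mu> > 0" "f \<in> vecs H" "hnorm H f = 1"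
    "\<And>w. w \<in> vecs H \<Longrightarrow> t w f = of_real \<mu> * ip H w f"
    "\<And>w. w \<in> vecs H \<Longrightarrow> Re (t w w) \<le> \<mu> * (hnorm H w)\<^sup>2"
proof -
  interpret t: semi_ip "vecs H" t by (rule t)
  have EV: "e \<in> vecs H" if "e \<in> E" for e using E that orthonormal_vecs by blast
  define C where "C = (\<Sum>e\<in>E. t.nrm e)\<^sup>2"
  have C0: "C \<ge> 0" by (simp add: C_def)
  have bound: "Re (t w w) \<le> C * (hnorm H w)\<^sup>2" if w: "w \<in> vecs H" for w
  proof -
    have "w = (\<Sum>e\<in>E. cscale (ip H e w) e)"
      using proj_id[OF E(1), of w] w E(2) by (simp add: proj_def)
    then have "t.nrm w = t.nrm (\<Sum>e\<in>E. cscale (ip H e w) e)" by simp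
    also have "\<dots> \<le> (\<Sum>e\<in>E. t.nrm (cscale (ip H e w) e))"
      using EV by (intro t.nrm_sum_le) auto
    also have "\<dots> = (\<Sum>e\<in>E. cmod (ip H e w) * t.nrm e)"
      using EV by (intro sum.cong refl) (auto simp: t.nrm_scale)
    also have "\<dots> \<le> (\<Sum>e\<in>E. hnorm H w * t.nrm e)"
    proof (intro sum_mono mult_right_mono)
      fix e assume "e \<in> E"
      then show "cmod (ip H e w) \<le> hnorm H w" "0 \<le> t.nrm e"
        using cauchy_schwarz[OF EV w, of e] orthonormal_hnorm[OF E(1)] EV by auto
    qed
    finally have "t.nrm w \<le> (\<Sum>e\<in>E. t.nrm e) * hnorm H w" by (simp add: sum_distrib_left mult.commute)
    then have "(t.nrm w)\<^sup>2 \<le> ((\<Sum>e\<in>E. t.nrm e) * hnorm H w)\<^sup>2" using w by (intro power_mono) auto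
    then show ?thesis using w by (simp add: C_def power_mult_distrib t.nrm_sq)
  qed
  have compact: "\<exists>\<sigma>. strict_mono (\<sigma> :: nat \<Rightarrow> nat) \<and>
      (\<forall>\<epsilon>>0. \<exists>N. \<forall>m\<ge>N. \<forall>n\<ge>N. Re (t (X (\<sigma> m) - X (\<sigma> n)) (X (\<sigma> m) - X (\<sigma> n))) < \<epsilon>)"
    if X: "\<And>n. X n \<in> vecs H" "\<And>n. hnorm H (X n) \<le> 1" for X
  proof -
    have b: "cmod (ip H e (X n)) \<le> 1" if "e \<in> E" for e n
      using cauchy_schwarz[OF EV[OF that] X(1)[of n]] orthonormal_hnorm[OF E(1) that] X(2)[of n] by simp
    have "countable E" using orthonormal_finite[OF E(1)] by (rule countable_finite)
    from function_convergent_subsequence[of E "\<lambda>n e. ip H e (X n)" 1, OF this b]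
    obtain \<sigma> where \<sigma>: "strict_mono (\<sigma> :: nat \<Rightarrow> nat)"
      and conv: "\<And>e. e \<in> E \<Longrightarrow> \<exists>l. (\<lambda>n. ip H e (X (\<sigma> n))) \<longlonglongrightarrow> l" by blast
    then obtain l where l: "\<And>e. e \<in> E \<Longrightarrow> (\<lambda>n. ip H e (X (\<sigma> n))) \<longlonglongrightarrow> l e" by metis
    have "\<exists>N. \<forall>m\<ge>N. \<forall>n\<ge>N. Re (t (X (\<sigma> m) - X (\<sigma> n)) (X (\<sigma> m) - X (\<sigma> n))) < \<epsilon>" if "\<epsilon> > 0" for \<epsilon>
    proof (rule form_compact_if_tail_bound[of t "\<lambda>n. X (\<sigma> n)", OF _ that])
      fix \<epsilon> :: real assume "\<epsilon> > 0"
      define h where "h n = C * (\<Sum>e\<in>E. 2 * (cmod (ip H e (X (\<sigma> n)) - l e))\<^sup>2)" for n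
      have "h \<longlonglongrightarrow> C * (\<Sum>e\<in>E. 2 * (cmod (l e - l e))\<^sup>2)"
        unfolding h_def by (intro tendsto_intros l) auto
      then have "h \<longlonglongrightarrow> 0" by simp
      moreover have "Re (t (X (\<sigma> m) - X (\<sigma> n)) (X (\<sigma> m) - X (\<sigma> n))) \<le> \<epsilon> + h m + h n" for m n
      proof -
        have u: "X (\<sigma> m) - X (\<sigma> n) \<in> vecs H" using X by simp
        have "Re (t (X (\<sigma> m) - X (\<sigma> n)) (X (\<sigma> m) - X (\<sigma> n))) \<le> C * (hnorm H (X (\<sigma> m) - X (\<sigma> n)))\<^sup>2"
          by (rule bound[OF u])
        also have "(hnorm H (X (\<sigma> m) - X (\<sigma> n)))\<^sup>2 = (\<Sum>e\<in>E. (cmod (ip H e (X (\<sigma> m)) - ip H e (X (\<sigma> n))))\<^sup>2)"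
          using u EV X unfolding E(2) by (subst hnorm_span_sq[OF E(1)]) (auto simp: E(2)[symmetric] s_diff_right)
        also have "C * \<dots> \<le> C * (\<Sum>e\<in>E. 2 * (cmod (ip H e (X (\<sigma> m)) - l e))\<^sup>2 + 2 * (cmod (ip H e (X (\<sigma> n)) - l e))\<^sup>2)"
          using C0 by (intro mult_left_mono sum_mono cmod_diff_sq_le) auto
        also have "\<dots> = h m + h n" by (simp add: h_def sum.distrib distrib_left)
        finally have "Re (t (X (\<sigma> m) - X (\<sigma> n)) (X (\<sigma> m) - X (\<sigma> n))) \<le> h m + h n" .
        then show ?thesis using \<open>\<epsilon> > 0\<close> by linarith
      qed
      ultimately show "\<exists>h. h \<longlonglongrightarrow> 0 \<and> (\<forall>m n. Re (t (X (\<sigma> m) - X (\<sigma> n)) (X (\<sigma> m) - X (\<sigma> n))) \<le> \<epsilon> + h m + h n)"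
        by blast
    qed
    then show ?thesis using \<sigma> by blast
  qed
  show ?thesis
  proof (rule top_eigenvector[OF t _ _ pos])
    show "Re (t w w) \<le> C * (hnorm H w)\<^sup>2" if "w \<in> vecs H" for w
      using that by (rule bound)
    show "\<exists>\<sigma>. strict_mono (\<sigma> :: nat \<Rightarrow> nat) \<and>
        (\<forall>\<epsilon>>0. \<exists>N. \<forall>m\<ge>N. \<forall>n\<ge>N. Re (t (X (\<sigma> m) - X (\<sigma> n)) (X (\<sigma> m) - X (\<sigma> n))) < \<epsilon>)"
      if "\<And>n. X n \<in> vecs H" "\<And>n. hnorm H (X n) \<le> 1" for X
      using that by (rule compact)
  qed (rule that)
qed

end

context unitary_rep
begin

lemma irreducible_frame_invariant: "irreducible_frame G R E \<Longrightarrow> invariant_frame G R E"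
  by (simp add: irreducible_frame_def)

lemma irreducible_subspace:
  assumes "irreducible_frame G R E" "cvs.subspace W" "W \<subseteq> cvs.span E"
    and "\<And>g v. \<lbrakk>g \<in> carrier G; v \<in> W\<rbrakk> \<Longrightarrow> act R g v \<in> W" and "w \<in> W" "w \<noteq> 0"
  shows "W = cvs.span E"
  using assms unfolding irreducible_frame_def by blast

lemma schur_scalar:
  assumes E: "irreducible_frame G R E" and t: "semi_ip (cvs.span E) t"
    and inv: "\<And>g v w. \<lbrakk>g \<in> carrier G; v \<in> cvs.span E; w \<in> cvs.span E\<rbrakk> \<Longrightarrow> t (act R g v) (act R g w) = t v w"
  obtains c where "c \<ge> 0" "\<And>v w. \<lbrakk>v \<in> cvs.span E; w \<in> cvs.span E\<rbrakk> \<Longrightarrow> t v w = of_real c * ip R v w"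
proof (cases "\<exists>w\<in>cvs.span E. Re (t w w) > 0")
  case False
  interpret t: semi_ip "cvs.span E" t by (rule t)
  have "t.nrm w = 0" if "w \<in> cvs.span E" for w
    using False that t.s_nonneg[OF that] by (force simp: t.nrm_def)
  then have "t v w = 0" if "v \<in> cvs.span E" "w \<in> cvs.span E" for v w
    using t.cauchy_schwarz[OF that] that by simp
  then show ?thesis using that[of 0] by simp
next
  case True
  then obtain w0 where w0: "w0 \<in> cvs.span E" "Re (t w0 w0) > 0" by blast
  note invE = irreducible_frame_invariant[OF E]
  note onE = frame_orthonormal[OF invE]
  interpret t: semi_ip "cvs.span E" t by (rule t)
  interpret S: unitary_rep G "subrep R E" by (rule unitary_rep_subrep[OF invE])
  have onS: "orthonormal (subrep R E) E" using onE by (auto simp: orthonormal_def intro: cvs.span_base)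
  obtain \<mu> f where mu: "\<mu> > 0" and f: "f \<in> cvs.span E" "hnorm R f = 1"
    and eig: "\<And>w. w \<in> cvs.span E \<Longrightarrow> t w f = of_real \<mu> * ip R w f"
    and "\<And>w. w \<in> cvs.span E \<Longrightarrow> Re (t w w) \<le> \<mu> * (hnorm R w)\<^sup>2"
    using S.fd_top_eigenvector[of E t w0] onS t w0 by auto
  define W where "W = {f \<in> cvs.span E. \<forall>w\<in>cvs.span E. t w f = of_real \<mu> * ip R w f}"
  have V: "v \<in> vecs R" if "v \<in> cvs.span E" for v using onE that by (rule orthonormal_span_vecs)
  have "W = cvs.span E"
  proof (rule irreducible_subspace[OF E])
    show "cvs.subspace W"
      by (auto simp: W_def s_add_right s_scale_right t.s_add_right t.s_scale_right distrib_left V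
          intro!: cvs.subspaceI)
    show "f \<in> W" using f eig by (simp add: W_def)
    show "f \<noteq> 0" using f by auto
    show "act R g v \<in> W" if g: "g \<in> carrier G" and v: "v \<in> W" for g v
    proof -
      have vE: "v \<in> cvs.span E" using v by (simp add: W_def)
      have "t w (act R g v) = of_real \<mu> * ip R w (act R g v)" if w: "w \<in> cvs.span E" for w
      proof -
        let ?w = "act R (inv\<^bsub>G\<^esub> g) w"
        have wE: "?w \<in> cvs.span E" using frame_act[OF invE _ w] g by simp
        have "t w (act R g v) = t (act R g ?w) (act R g v)" using g V[OF w] by simp
        also have "\<dots> = t ?w v" by (rule inv[OF g wE vE])
        also have "\<dots> = of_real \<mu> * ip R ?w v" using v wE by (simp add: W_def)
        also have "ip R ?w v = ip R w (act R g v)"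
          using ip_act_left[of "inv\<^bsub>G\<^esub> g" w v] g V[OF w] V[OF vE] by simp
        finally show ?thesis .
      qed
      then show ?thesis using frame_act[OF invE g vE] by (simp add: W_def)
    qed
  qed (simp add: W_def)
  then have "t v w = of_real \<mu> * ip R v w" if "v \<in> cvs.span E" "w \<in> cvs.span E" for v w
    using that by (auto simp: W_def)
  then show ?thesis using that[of \<mu>] mu by simp
qed

lemma schur_equivalent:
  assumes E: "irreducible_frame G R E" and F: "irreducible_frame G R F"
    and add_right: "\<And>u v w. \<lbrakk>u \<in> cvs.span E; v \<in> cvs.span F; w \<in> cvs.span F\<rbrakk> \<Longrightarrow> b u (v + w) = b u v + b u w"
    and scale_right: "\<And>c u v. \<lbrakk>u \<in> cvs.span E; v \<in> cvs.span F\<rbrakk> \<Longrightarrow> b u (cscale c v) = c * b u v"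
    and add_left: "\<And>u v w. \<lbrakk>u \<in> cvs.span E; v \<in> cvs.span E; w \<in> cvs.span F\<rbrakk> \<Longrightarrow> b (u + v) w = b u w + b v w"
    and scale_left: "\<And>c u v. \<lbrakk>u \<in> cvs.span E; v \<in> cvs.span F\<rbrakk> \<Longrightarrow> b (cscale c u) v = cnj c * b u v"
    and inv: "\<And>g u v. \<lbrakk>g \<in> carrier G; u \<in> cvs.span E; v \<in> cvs.span F\<rbrakk> \<Longrightarrow> b (act R g u) (act R g v) = b u v"
    and x0: "x0 \<in> cvs.span E" and y0: "y0 \<in> cvs.span F" and nz: "b x0 y0 \<noteq> 0"
  shows "unitarily_equivalent G (subrep R F) (subrep R E)"
proof -
  note invE = irreducible_frame_invariant[OF E] and invF = irreducible_frame_invariant[OF F]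
  note onE = frame_orthonormal[OF invE] and onF = frame_orthonormal[OF invF]
  have VE: "v \<in> vecs R" if "v \<in> cvs.span E" for v using onE that by (rule orthonormal_span_vecs)
  have VF: "v \<in> vecs R" if "v \<in> cvs.span F" for v using onF that by (rule orthonormal_span_vecs)
  define A where "A y = (\<Sum>e\<in>E. cscale (b e y) e)" for y
  have AE: "A y \<in> cvs.span E" for y
    unfolding A_def by (intro cvs.span_sum cvs.span_scale cvs.span_base)
  have b_sum: "finite I \<Longrightarrow> (\<And>i. i \<in> I \<Longrightarrow> h i \<in> cvs.span E) \<Longrightarrow> y \<in> cvs.span F \<Longrightarrow>
      b (\<Sum>i\<in>I. h i) y = (\<Sum>i\<in>I. b (h i) y)" for I :: "('b \<Rightarrow> complex) set" and h y
  proof (induction I rule: finite_induct)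
    case empty
    have "b (cscale 0 0) y = cnj 0 * b 0 y" by (rule scale_left[OF cvs.span_zero empty(2)])
    then have "b 0 y = 0" by (simp only: cvs.scale_zero_left complex_cnj_zero mult_zero_left)
    then show ?case by (simp only: sum.empty)
  next
    case (insert x I)
    have "b (\<Sum>i\<in>insert x I. h i) y = b (h x + (\<Sum>i\<in>I. h i)) y"
      using insert(1,2) by (subst sum.insert) auto
    also have "\<dots> = b (h x) y + b (\<Sum>i\<in>I. h i) y"
    proof (rule add_left)
      show "h x \<in> cvs.span E" by (rule insert.prems(1)) (rule insertI1)
      show "(\<Sum>i\<in>I. h i) \<in> cvs.span E"
        by (rule cvs.span_sum, rule insert.prems(1), erule insertI2)
      show "y \<in> cvs.span F" by (rule insert.prems(2))
    qed
    also have "b (\<Sum>i\<in>I. h i) y = (\<Sum>i\<in>I. b (h i) y)"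
      by (rule insert.IH, rule insert.prems(1), erule insertI2, rule insert.prems(2))
    also have "b (h x) y + (\<Sum>i\<in>I. b (h i) y) = (\<Sum>i\<in>insert x I. b (h i) y)"
      using insert(1,2) by (subst sum.insert) auto
    finally show ?case .
  qed
  have ipA: "ip R w (A y) = b w y" if w: "w \<in> cvs.span E" and y: "y \<in> cvs.span F" for w y
  proof -
    have "b w y = b (\<Sum>e\<in>E. cscale (ip R e w) e) y"
      using proj_id[OF onE w] by (simp add: proj_def)
    also have "\<dots> = (\<Sum>e\<in>E. b (cscale (ip R e w) e) y)"
      by (rule b_sum[OF orthonormal_finite[OF onE] cvs.span_scale[OF cvs.span_base] y])
    also have "\<dots> = (\<Sum>e\<in>E. b e y * ip R w e)"
      using VE[OF w] orthonormal_vecs[OF onE] y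
      by (intro sum.cong refl) (simp add: scale_left cvs.span_base ip_cnj[of _ w])
    also have "\<dots> = ip R w (A y)"
      unfolding A_def using VE[OF w] orthonormal_vecs[OF onE]
      by (subst s_sum_right) (auto simp: s_scale_right)
    finally show ?thesis by simp
  qed
  have ext: "u = v" if "u \<in> cvs.span E" "v \<in> cvs.span E" "\<And>w. w \<in> cvs.span E \<Longrightarrow> ip R w u = ip R w v" for u v
  proof -
    have "u - v \<in> cvs.span E" using that by (intro cvs.span_diff)
    then have "ip R (u - v) (u - v) = 0" using that VE by (simp add: s_diff_right)
    then have "u - v = 0" using ip_pos[of "u - v"] VE that by force
    then show ?thesis by simp
  qed
  have A_add: "A (u + v) = A u + A v" if "u \<in> cvs.span F" "v \<in> cvs.span F" for u v
    using that AE VE by (intro ext) (auto simp: ipA add_right s_add_right cvs.span_add)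
  have A_scale: "A (cscale c u) = cscale c (A u)" if "u \<in> cvs.span F" for c u
    using that AE VE by (intro ext) (auto simp: ipA scale_right s_scale_right cvs.span_scale)
  have A_act: "A (act R g u) = act R g (A u)" if g: "g \<in> carrier G" and u: "u \<in> cvs.span F" for g u
  proof (rule ext[OF AE frame_act[OF invE g AE]])
    fix w assume w: "w \<in> cvs.span E"
    let ?w = "act R (inv\<^bsub>G\<^esub> g) w"
    have wE: "?w \<in> cvs.span E" using frame_act[OF invE _ w] g by simp
    have "ip R w (A (act R g u)) = b w (act R g u)" using frame_act[OF invF g u] w by (simp add: ipA)
    also have "\<dots> = b (act R g ?w) (act R g u)" using g VE[OF w] by simp
    also have "\<dots> = b ?w u" by (rule inv[OF g wE u])
    also have "\<dots> = ip R ?w (A u)" using wE u by (simp add: ipA)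
    also have "\<dots> = ip R w (act R g (A u))"
      using ip_act_left[of "inv\<^bsub>G\<^esub> g" w "A u"] g VE[OF w] VE[OF AE] by simp
    finally show "ip R w (A (act R g u)) = ip R w (act R g (A u))" .
  qed
  have "semi_ip (cvs.span F) (\<lambda>u v. ip R (A u) (A v))"
  proof
    show "ip R (A v) (A u) = cnj (ip R (A u) (A v))" for u v by (rule ip_cnj[OF VE[OF AE] VE[OF AE]])
  qed (auto simp: A_add A_scale s_add_right s_scale_right VE[OF AE] s_nonneg)
  moreover have "ip R (A (act R g v)) (A (act R g w)) = ip R (A v) (A w)"
    if "g \<in> carrier G" "v \<in> cvs.span F" "w \<in> cvs.span F" for g v w
    using that by (simp add: A_act act_ip VE[OF AE])
  ultimately obtain c where c: "c \<ge> 0"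
    and iso: "\<And>v w. \<lbrakk>v \<in> cvs.span F; w \<in> cvs.span F\<rbrakk> \<Longrightarrow> ip R (A v) (A w) = of_real c * ip R v w"
    using schur_scalar[OF F, of "\<lambda>u v. ip R (A u) (A v)"] by blast
  have Ay0: "A y0 \<noteq> 0"
    using ipA[OF x0 y0] nz VE[OF x0] by auto
  have "c \<noteq> 0"
  proof
    assume "c = 0"
    then have "ip R (A y0) (A y0) = 0" using iso[OF y0 y0] by simp
    then show False using ip_pos[OF VE[OF AE] Ay0] by simp
  qed
  then have cpos: "c > 0" using c by simp
  define U where "U y = cscale (of_real (1 / sqrt c)) (A y)" for y
  have UE: "U y \<in> cvs.span E" for y unfolding U_def by (intro cvs.span_scale AE)
  have U_ip: "ip R (U v) (U w) = ip R v w" if "v \<in> cvs.span F" "w \<in> cvs.span F" for v w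
  proof -
    have "complex_of_real (1 / sqrt c) * complex_of_real (1 / sqrt c) * of_real c = of_real (1 / sqrt c * (1 / sqrt c) * c)"
      by (simp only: of_real_mult)
    also have "1 / sqrt c * (1 / sqrt c) * c = 1" using cpos by simp
    finally show ?thesis
      using iso[OF that] VE[OF AE]
      by (simp add: U_def s_scale_left s_scale_right mult.assoc[symmetric] del: of_real_divide)
  qed
  have U_add: "U (u + v) = U u + U v" if "u \<in> cvs.span F" "v \<in> cvs.span F" for u v
    unfolding U_def A_add[OF that] by (rule cvs.scale_right_distrib)
  have U_scale: "U (cscale c u) = cscale c (U u)" if "u \<in> cvs.span F" for c u
    unfolding U_def A_scale[OF that] by (simp add: mult.commute)
  have U_act: "U (act R g u) = act R g (U u)" if "g \<in> carrier G" "u \<in> cvs.span F" for g u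
    unfolding U_def A_act[OF that] using that VE[OF AE] by (simp add: act_scale)
  have "U ` cvs.span F = cvs.span E"
  proof (rule irreducible_subspace[OF E])
    show "cvs.subspace (U ` cvs.span F)"
    proof (rule cvs.subspaceI)
      show "0 \<in> U ` cvs.span F"
        using U_scale[OF cvs.span_zero, of 0] cvs.span_zero by (intro image_eqI[of _ _ 0]) auto
      show "x + y \<in> U ` cvs.span F" if "x \<in> U ` cvs.span F" "y \<in> U ` cvs.span F" for x y
        using that by (auto simp: U_add[symmetric] intro!: imageI cvs.span_add)
      show "cscale a x \<in> U ` cvs.span F" if "x \<in> U ` cvs.span F" for a x
        using that by (auto simp: U_scale[symmetric] intro!: imageI cvs.span_scale)
    qed
    show "act R g v \<in> U ` cvs.span F" if "g \<in> carrier G" "v \<in> U ` cvs.span F" for g v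
      using that by (auto simp: U_act[symmetric] intro!: imageI frame_act[OF invF])
    show "U y0 \<in> U ` cvs.span F" using y0 by simp
    show "U y0 \<noteq> 0"
    proof
      assume "U y0 = 0"
      then have "cscale (of_real (sqrt c)) (U y0) = 0" by simp
      then show False using cpos Ay0 by (simp add: U_def)
    qed
  qed (use UE in auto)
  moreover have "inj_on U (cvs.span F)"
  proof (rule inj_onI)
    fix u v assume uv: "u \<in> cvs.span F" "v \<in> cvs.span F" "U u = U v"
    have d: "u - v \<in> cvs.span F" using uv by (intro cvs.span_diff)
    have "u - v = u + cscale (-1) v" by simp
    then have "U (u - v) = U u + cscale (-1) (U v)"
      using U_add[OF uv(1) cvs.span_scale[OF uv(2), of "-1"]] U_scale[OF uv(2), of "-1"] by simp
    then have "U (u - v) = 0" using uv by simp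
    then have "ip R (u - v) (u - v) = 0" using U_ip[OF d d] by simp
    then have "u - v = 0" using ip_pos[OF VF[OF d]] by force
    then show "u = v" by simp
  qed
  ultimately have bij: "bij_betw U (cvs.span F) (cvs.span E)" by (simp add: bij_betw_def)
  show ?thesis
    unfolding unitarily_equivalent_def
    using bij U_add U_scale U_ip U_act by (intro exI[of _ U]) auto
qed

end

context ergodic_seq
begin

lemma tmean_inequivalent:
  fixes R :: "('g, 'i) urep"
  assumes R: "unitary_rep G R" and E: "irreducible_frame G R E" and F: "irreducible_frame G R F"
    and ne: "\<not> unitarily_equivalent G (subrep R F) (subrep R E)"
    and v: "v \<in> cvs.span E" "v' \<in> cvs.span F" and w: "w \<in> cvs.span E" "w' \<in> cvs.span F"
  shows "tmean R v v' w w' = 0"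
proof (rule ccontr)
  interpret R: unitary_rep G R by (rule R)
  note onE = R.frame_orthonormal[OF R.irreducible_frame_invariant[OF E]]
  note onF = R.frame_orthonormal[OF R.irreducible_frame_invariant[OF F]]
  have VE: "v \<in> vecs R" if "v \<in> cvs.span E" for v using onE that by (rule R.orthonormal_span_vecs)
  have VF: "v \<in> vecs R" if "v \<in> cvs.span F" for v using onF that by (rule R.orthonormal_span_vecs)
  note vV = VE[OF v(1)] VF[OF v(2)]
  assume nz: "tmean R v v' w w' \<noteq> 0"
  have "unitarily_equivalent G (subrep R F) (subrep R E)"
  proof (rule R.schur_equivalent[OF E F, of "tmean R v v'"])
    fix u x y assume "u \<in> cvs.span E" "x \<in> cvs.span F" "y \<in> cvs.span F"
    then show "tmean R v v' u (x + y) = tmean R v v' u x + tmean R v v' u y"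
      using VE VF by (intro tmean_add_right[OF R vV]) auto
  next
    fix c u x assume "u \<in> cvs.span E" "x \<in> cvs.span F"
    then show "tmean R v v' u (cscale c x) = c * tmean R v v' u x"
      using VE VF by (intro tmean_scale_right[OF R vV]) auto
  next
    fix u x y assume "u \<in> cvs.span E" "x \<in> cvs.span E" "y \<in> cvs.span F"
    then have V: "u \<in> vecs R" "x \<in> vecs R" "y \<in> vecs R" using VE VF by auto
    have "tmean R v v' (u + x) y = cnj (tmean R v' v y (u + x))"
      using V by (intro tmean_cnj[OF R vV(2,1)]) auto
    also have "tmean R v' v y (u + x) = tmean R v' v y u + tmean R v' v y x"
      using V by (intro tmean_add_right[OF R vV(2,1)])
    finally show "tmean R v v' (u + x) y = tmean R v v' u y + tmean R v v' x y"
      unfolding tmean_cnj[OF R vV(2,1) V(3,1)] tmean_cnj[OF R vV(2,1) V(3,2)] complex_cnj_add .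
  next
    fix c u y assume "u \<in> cvs.span E" "y \<in> cvs.span F"
    then have V: "u \<in> vecs R" "y \<in> vecs R" using VE VF by auto
    have "tmean R v v' (cscale c u) y = cnj (tmean R v' v y (cscale c u))"
      using V by (intro tmean_cnj[OF R vV(2,1)]) auto
    also have "tmean R v' v y (cscale c u) = c * tmean R v' v y u"
      using V by (intro tmean_scale_right[OF R vV(2,1)])
    finally show "tmean R v v' (cscale c u) y = cnj c * tmean R v v' u y"
      unfolding tmean_cnj[OF R vV(2,1) V(2,1)] complex_cnj_mult .
  next
    fix g u y assume g: "g \<in> carrier G" and "u \<in> cvs.span E" "y \<in> cvs.span F"
    then show "tmean R v v' (act R g u) (act R g y) = tmean R v v' u y"
      using VE VF by (intro tmean_invariant[OF R vV]) auto
  qed (use w nz in auto)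
  then show False using ne by simp
qed

lemma tmean_irreducible_le:
  fixes R :: "('g, 'i) urep"
  assumes R: "unitary_rep G R" and E: "irreducible_frame G R E"
    and v: "v \<in> cvs.span E" and w: "w \<in> cvs.span E"
  shows "real (card E) * Re (tmean R v v w w) \<le> (hnorm R v)\<^sup>2 * (hnorm R w)\<^sup>2"
proof -
  interpret R: unitary_rep G R by (rule R)
  note invE = R.irreducible_frame_invariant[OF E]
  note onE = R.frame_orthonormal[OF invE]
  have VE: "v \<in> vecs R" if "v \<in> cvs.span E" for v using onE that by (rule R.orthonormal_span_vecs)
  note vV = VE[OF v]
  interpret t: semi_ip "vecs R" "tmean R v v" by (rule semi_ip_tmean[OF R vV])
  have "semi_ip (cvs.span E) (tmean R v v)"
    by unfold_locales (auto simp: VE t.s_add_right t.s_scale_right t.s_nonneg intro: t.s_cnj)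
  moreover have "tmean R v v (act R g x) (act R g y) = tmean R v v x y"
    if "g \<in> carrier G" "x \<in> cvs.span E" "y \<in> cvs.span E" for g x y
    using that VE by (intro tmean_invariant[OF R vV vV]) auto
  ultimately obtain c where c: "c \<ge> 0"
    and t: "\<And>x y. \<lbrakk>x \<in> cvs.span E; y \<in> cvs.span E\<rbrakk> \<Longrightarrow> tmean R v v x y = of_real c * ip R x y"
    using R.schur_scalar[OF E, of "tmean R v v"] by blast
  have "real (card E) * c = (\<Sum>e\<in>E. Re (tmean R v v e e))"
    using onE by (subst sum.cong[OF refl, of _ _ "\<lambda>_. c"]) (auto simp: t cvs.span_base R.orthonormal_ip)
  also have "\<dots> \<le> (hnorm R v)\<^sup>2"
    by (rule sum_tmean_le[OF R vV onE])
  finally have "real (card E) * c * (hnorm R w)\<^sup>2 \<le> (hnorm R v)\<^sup>2 * (hnorm R w)\<^sup>2"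
    by (rule mult_right_mono) simp
  moreover have "Re (tmean R v v w w) = c * (hnorm R w)\<^sup>2"
    using t[OF w w] R.s_self_nrm[OF VE[OF w]] by simp
  ultimately show ?thesis by (simp add: mult.assoc)
qed

lemma mean_nontrivial_irreducible:
  fixes R :: "'g rep"
  assumes R: "unitary_rep G R" and E: "irreducible_frame G R E" and nt: "nontrivial_rep G (subrep R E)"
    and v: "v \<in> cvs.span E" and w: "w \<in> cvs.span E"
  shows "(\<lambda>n. avg (T n) (\<lambda>\<gamma>. ip R w (act R \<gamma> v))) \<longlonglongrightarrow> 0"
proof -
  interpret R: unitary_rep G R by (rule R)
  note invE = R.irreducible_frame_invariant[OF E]
  have S: "unitary_rep G (subrep R E)" by (rule R.unitary_rep_subrep[OF invE])
  interpret S: unitary_rep G "subrep R E" by (rule S)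
  have fixed: "fixed_vecs G (subrep R E) \<subseteq> {0}"
  proof (rule ccontr)
    assume "\<not> ?thesis"
    then obtain x where x: "x \<in> fixed_vecs G (subrep R E)" "x \<noteq> 0" by auto
    have "fixed_vecs G (subrep R E) = cvs.span E"
      by (rule R.irreducible_subspace[OF E S.subspace_fixed_vecs _ _ x]) (auto simp: fixed_vecs_def)
    then show False using nt by (auto simp: nontrivial_rep_def fixed_vecs_def)
  qed
  have "v \<in> vecs (subrep R E)" "w \<in> vecs (subrep R E)" using v w by auto
  then obtain p where "p \<in> fixed_vecs G (subrep R E)"
    "(\<lambda>n. avg (T n) (\<lambda>\<gamma>. ip (subrep R E) w (act (subrep R E) \<gamma> v))) \<longlonglongrightarrow> ip (subrep R E) w p"
    using ergodic_mean[OF S, of v] by metis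
  then show ?thesis using fixed S.s_zero_right[of w] w by auto
qed

end

section \<open>Classes of irreducible representations\<close>

lemma unitarily_equivalent_refl: "unitarily_equivalent G R R"
  unfolding unitarily_equivalent_def by (intro exI[of _ id]) auto

lemma unitarily_equivalent_trans:
  assumes "unitary_rep G R" "unitarily_equivalent G R R'" "unitarily_equivalent G R' R''"
  shows "unitarily_equivalent G R R''"
proof -
  obtain U where U: "bij_betw U (vecs R) (vecs R')"
    "\<forall>v\<in>vecs R. \<forall>w\<in>vecs R. U (v + w) = U v + U w" "\<forall>c. \<forall>v\<in>vecs R. U (cscale c v) = cscale c (U v)"
    "\<forall>v\<in>vecs R. \<forall>w\<in>vecs R. ip R' (U v) (U w) = ip R v w"
    "\<forall>g\<in>carrier G. \<forall>v\<in>vecs R. U (act R g v) = act R' g (U v)"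
    using assms(2) unfolding unitarily_equivalent_def by blast
  obtain U' where U': "bij_betw U' (vecs R') (vecs R'')"
    "\<forall>v\<in>vecs R'. \<forall>w\<in>vecs R'. U' (v + w) = U' v + U' w" "\<forall>c. \<forall>v\<in>vecs R'. U' (cscale c v) = cscale c (U' v)"
    "\<forall>v\<in>vecs R'. \<forall>w\<in>vecs R'. ip R'' (U' v) (U' w) = ip R' v w"
    "\<forall>g\<in>carrier G. \<forall>v\<in>vecs R'. U' (act R' g v) = act R'' g (U' v)"
    using assms(3) unfolding unitarily_equivalent_def by blast
  have V: "U v \<in> vecs R'" if "v \<in> vecs R" for v using U(1) that by (rule bij_betwE[rule_format])
  show ?thesis
    unfolding unitarily_equivalent_def
  proof (intro exI[of _ "U' \<circ> U"] conjI)
    show "bij_betw (U' \<circ> U) (vecs R) (vecs R'')" using U(1) U'(1) by (rule bij_betw_trans)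
  qed (use U U' V in auto)
qed

lemma unitarily_equivalent_sym:
  assumes R: "unitary_rep G R" and eq: "unitarily_equivalent G R R'"
  shows "unitarily_equivalent G R' R"
proof -
  interpret R: unitary_rep G R by (rule R)
  obtain U where U: "bij_betw U (vecs R) (vecs R')"
    "\<forall>v\<in>vecs R. \<forall>w\<in>vecs R. U (v + w) = U v + U w" "\<forall>c. \<forall>v\<in>vecs R. U (cscale c v) = cscale c (U v)"
    "\<forall>v\<in>vecs R. \<forall>w\<in>vecs R. ip R' (U v) (U w) = ip R v w"
    "\<forall>g\<in>carrier G. \<forall>v\<in>vecs R. U (act R g v) = act R' g (U v)"
    using eq unfolding unitarily_equivalent_def by blast
  define W where "W = inv_into (vecs R) U"
  have W: "bij_betw W (vecs R') (vecs R)" unfolding W_def using U(1) by (rule bij_betw_inv_into)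
  have WV: "W x \<in> vecs R" if "x \<in> vecs R'" for x using W that by (rule bij_betwE[rule_format])
  have UW: "U (W x) = x" if "x \<in> vecs R'" for x
    unfolding W_def using U(1) that by (rule bij_betw_inv_into_right)
  have WU: "W (U x) = x" if "x \<in> vecs R" for x
    unfolding W_def using U(1) that by (rule bij_betw_inv_into_left)
  have 1: "W (x + y) = W x + W y" if "x \<in> vecs R'" "y \<in> vecs R'" for x y
  proof -
    have "U (W x + W y) = x + y" using that U(2) WV UW by simp
    then show ?thesis using WU[of "W x + W y"] WV that by simp
  qed
  have 2: "W (cscale c x) = cscale c (W x)" if "x \<in> vecs R'" for c x
  proof -
    have "U (cscale c (W x)) = cscale c x" using that U(3) WV UW by simp
    then show ?thesis using WU[of "cscale c (W x)"] WV that by simp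
  qed
  have 3: "ip R (W x) (W y) = ip R' x y" if "x \<in> vecs R'" "y \<in> vecs R'" for x y
    using that U(4) WV UW by metis
  have 4: "W (act R' g x) = act R g (W x)" if "g \<in> carrier G" "x \<in> vecs R'" for g x
  proof -
    have "U (act R g (W x)) = act R' g x" using that U(5) WV UW by simp
    then show ?thesis using WU[of "act R g (W x)"] R.act_closed WV that by simp
  qed
  show ?thesis
    unfolding unitarily_equivalent_def using W 1 2 3 4 by (intro exI[of _ W]) auto
qed

lemma fd_irreps_unitary_rep: "R \<in> fd_irreps G \<Longrightarrow> unitary_rep G R"
  by (simp add: fd_irreps_def)

lemma unitary_equiv_class_eq:
  assumes "(R, R') \<in> unitary_equiv_rel G"
  shows "unitary_equiv_rel G `` {R} = unitary_equiv_rel G `` {R'}"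
proof -
  have "equiv (fd_irreps G) (unitary_equiv_rel G)"
  proof (rule equivI)
    show "unitary_equiv_rel G \<subseteq> fd_irreps G \<times> fd_irreps G" by (auto simp: unitary_equiv_rel_def)
    show "refl_on (fd_irreps G) (unitary_equiv_rel G)"
      by (auto simp: refl_on_def unitary_equiv_rel_def unitarily_equivalent_refl)
    show "sym (unitary_equiv_rel G)"
      by (auto simp: sym_def unitary_equiv_rel_def intro: unitarily_equivalent_sym fd_irreps_unitary_rep)
    show "trans (unitary_equiv_rel G)"
      by (auto simp: trans_def unitary_equiv_rel_def intro: unitarily_equivalent_trans fd_irreps_unitary_rep)
  qed
  then show ?thesis using assms by (rule equiv_class_eq)
qed

lemma nontrivial_class:
  fixes R :: "'g rep"
  assumes R: "R \<in> fd_irreps G" and nt: "nontrivial_rep G R"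
  shows "unitary_equiv_rel G `` {R} \<noteq> trivial_class G"
proof
  assume eq: "unitary_equiv_rel G `` {R} = trivial_class G"
  have "R \<in> unitary_equiv_rel G `` {R}"
    using R by (auto simp: unitary_equiv_rel_def unitarily_equivalent_refl)
  then have "R \<in> trivial_class G" unfolding eq .
  then have "unitarily_equivalent G (trivial_rep G) R"
    by (auto simp: trivial_class_def unitary_equiv_rel_def)
  then obtain U where U: "bij_betw U (vecs (trivial_rep G)) (vecs R)"
    "\<forall>g\<in>carrier G. \<forall>v\<in>vecs (trivial_rep G). U (act (trivial_rep G) g v) = act R g (U v)"
    unfolding unitarily_equivalent_def by blast
  have "act R g x = x" if g: "g \<in> carrier G" and x: "x \<in> vecs R" for g x
  proof -
    obtain v where v: "v \<in> vecs (trivial_rep G)" "x = U v" using U(1) x by (auto simp: bij_betw_def)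
    then show ?thesis using U(2)[rule_format, OF g v(1)] by (simp add: trivial_rep_def)
  qed
  then show False using nt by (auto simp: nontrivial_rep_def)
qed

lemma irreducible_frame_fd_irreps:
  fixes R :: "'g rep"
  assumes R: "unitary_rep G R" and E: "irreducible_frame G R E"
  shows "subrep R E \<in> fd_irreps G"
proof -
  interpret R: unitary_rep G R by (rule R)
  note invE = R.irreducible_frame_invariant[OF E]
  note onE = R.frame_orthonormal[OF invE]
  obtain e where e: "e \<in> E" using E by (auto simp: irreducible_frame_def)
  have "e \<noteq> 0" using R.orthonormal_hnorm[OF onE e] by auto
  then have "cvs.span E \<noteq> {0}" using cvs.span_base[OF e] by auto
  then show ?thesis
    using E R.unitary_rep_subrep[OF invE] R.hdim_subrep[OF invE]
    by (auto simp: fd_irreps_def irreducible_frame_def)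
qed

section \<open>Averages over sets of positive density\<close>

locale dense_along = ergodic_seq G T
  for G :: "('g, 'm) monoid_scheme" (structure) and T :: "nat \<Rightarrow> 'g set" +
  fixes A :: "'g set" and \<alpha> :: real and s :: "nat \<Rightarrow> nat"
  assumes A_carrier: "A \<subseteq> carrier G" and alpha_pos: "\<alpha> > 0" and s_mono: "strict_mono s"
    and A_T_nonempty: "A \<inter> T (s k) \<noteq> {}"
    and density: "(\<lambda>k. real (card (A \<inter> T (s k))) / real (card (T (s k)))) \<longlonglongrightarrow> \<alpha>"
begin

definition ratio :: "nat \<Rightarrow> real" where
  "ratio k = real (card (A \<inter> T (s k))) / real (card (T (s k)))"

lemma T_nonempty: "T (s k) \<noteq> {}"
  using A_T_nonempty by blast

lemma ratio_tendsto: "ratio \<longlonglongrightarrow> \<alpha>"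
  using density by (simp add: ratio_def[abs_def])

lemma card_pos: "card (A \<inter> T (s k)) > 0" "card (T (s k)) > 0"
  using A_T_nonempty[of k] T_nonempty[of k] by (auto simp: card_gt_0_iff)

lemma ratio_pos: "ratio k > 0"
  using card_pos[of k] by (simp add: ratio_def)

lemma ratio_le_1: "ratio k \<le> 1"
  using card_mono[of "T (s k)" "A \<inter> T (s k)"] card_pos(2)[of k] by (simp add: ratio_def)

lemma alpha_le_1: "\<alpha> \<le> 1"
  by (rule tendsto_upperbound[OF ratio_tendsto]) (auto intro: always_eventually ratio_le_1)

lemma tendsto_s: "X \<longlonglongrightarrow> l \<Longrightarrow> (\<lambda>k. X (s k)) \<longlonglongrightarrow> l"
  using LIMSEQ_subseq_LIMSEQ[OF _ s_mono] by (simp add: o_def)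

lemma avg_restrict:
  "avg (T (s k)) (\<lambda>\<gamma>. of_bool (\<gamma> \<in> A) * F \<gamma>) = of_real (ratio k) * avg (A \<inter> T (s k)) F"
proof -
  have "(\<Sum>\<gamma>\<in>T (s k). of_bool (\<gamma> \<in> A) * F \<gamma>) = (\<Sum>\<gamma>\<in>T (s k). if \<gamma> \<in> A then F \<gamma> else 0)"
    by (intro sum.cong) auto
  also have "\<dots> = (\<Sum>\<gamma>\<in>T (s k) \<inter> A. F \<gamma>)" by (rule sum.inter_restrict[symmetric]) simp
  also have "\<dots> = (\<Sum>\<gamma>\<in>A \<inter> T (s k). F \<gamma>)" by (simp only: Int_commute)
  finally show ?thesis using card_pos[of k] by (simp add: avg_def ratio_def)
qed

lemma weak_mixing_error:
  fixes R :: "('g, 'i) urep"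
  assumes R: "unitary_rep G R" and r: "r \<in> vecs R" and w: "w \<in> vecs R"
    and small: "Re (tmean R r r w w) < \<alpha> * \<eta>\<^sup>2" and \<eta>: "\<eta> > 0"
  shows "\<forall>\<^sub>F k in sequentially. cmod (avg (A \<inter> T (s k)) (\<lambda>\<gamma>. ip R w (act R \<gamma> r))) < \<eta>"
proof -
  define F where "F \<gamma> = ip R w (act R \<gamma> r)" for \<gamma>
  define b where "b k = Re (avg (T (s k)) (\<lambda>\<gamma>. F \<gamma> * cnj (F \<gamma>)))" for k
  have "b \<longlonglongrightarrow> Re (tmean R r r w w)"
    unfolding b_def F_def by (intro tendsto_Re tendsto_s tmean_tendsto[OF R r r w w])
  then have "(\<lambda>k. b k / ratio k) \<longlonglongrightarrow> Re (tmean R r r w w) / \<alpha>"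
    using alpha_pos by (intro tendsto_divide ratio_tendsto) auto
  moreover have "Re (tmean R r r w w) / \<alpha> < \<eta>\<^sup>2" using small alpha_pos by (simp add: field_simps)
  ultimately have "\<forall>\<^sub>F k in sequentially. b k / ratio k < \<eta>\<^sup>2" by (rule order_tendstoD(2))
  then show ?thesis
  proof eventually_elim
    case (elim k)
    have "(cmod (avg (A \<inter> T (s k)) F))\<^sup>2 \<le> Re (avg (A \<inter> T (s k)) (\<lambda>\<gamma>. F \<gamma> * cnj (F \<gamma>)))"
      by (rule cmod_avg_sq_le)
    also have "\<dots> \<le> b k / ratio k"
    proof -
      have "ratio k * Re (avg (A \<inter> T (s k)) (\<lambda>\<gamma>. F \<gamma> * cnj (F \<gamma>)))
          = Re (avg (T (s k)) (\<lambda>\<gamma>. of_bool (\<gamma> \<in> A) * (F \<gamma> * cnj (F \<gamma>))))"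
        unfolding avg_restrict by simp
      also have "\<dots> \<le> b k"
        unfolding b_def Re_avg by (intro divide_right_mono sum_mono) (auto simp: complex_mult_cnj)
      finally show ?thesis using ratio_pos[of k] by (simp add: field_simps)
    qed
    also have "\<dots> < \<eta>\<^sup>2" by (rule elim)
    finally have "cmod (avg (A \<inter> T (s k)) F) < \<eta>" by (rule power2_less_imp_less) (use \<eta> in simp)
    then show ?case by (simp add: F_def[abs_def])
  qed
qed

text \<open>The right-hand side bounds the mean of \<open>|1\<^sub>A - \<alpha> - (\<Sum>j\<in>J. b j * c j)|\<^sup>2\<close>.\<close>

lemma bessel_density:
  fixes c :: "'j \<Rightarrow> 'g \<Rightarrow> complex" and b \<kappa> N :: "'j \<Rightarrow> real"
  assumes J: "finite J"
    and c0: "\<And>j. j \<in> J \<Longrightarrow> (\<lambda>n. avg (T n) (c j)) \<longlonglongrightarrow> 0"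
    and orth: "\<And>i j. \<lbrakk>i \<in> J; j \<in> J; i \<noteq> j\<rbrakk> \<Longrightarrow> (\<lambda>n. avg (T n) (\<lambda>\<gamma>. c i \<gamma> * cnj (c j \<gamma>))) \<longlonglongrightarrow> 0"
    and diag: "\<And>j. j \<in> J \<Longrightarrow> (\<lambda>n. avg (T n) (\<lambda>\<gamma>. c j \<gamma> * cnj (c j \<gamma>))) \<longlonglongrightarrow> m j"
    and N: "\<And>j. j \<in> J \<Longrightarrow> Re (m j) \<le> N j"
    and \<kappa>: "\<And>j. j \<in> J \<Longrightarrow> (\<lambda>k. avg (A \<inter> T (s k)) (c j)) \<longlonglongrightarrow> of_real (\<kappa> j)"
  shows "0 \<le> \<alpha> - \<alpha>\<^sup>2 - 2 * \<alpha> * (\<Sum>j\<in>J. b j * \<kappa> j) + (\<Sum>j\<in>J. (b j)\<^sup>2 * N j)"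
proof -
  define g where "g \<gamma> = (\<Sum>j\<in>J. of_real (b j) * c j \<gamma>)" for \<gamma>
  define u :: "'g \<Rightarrow> complex" where "u \<gamma> = of_bool (\<gamma> \<in> A) - of_real \<alpha>" for \<gamma>
  define S where "S k = T (s k)" for k
  have uu: "(\<lambda>k. avg (S k) (\<lambda>\<gamma>. u \<gamma> * u \<gamma>)) \<longlonglongrightarrow> of_real (\<alpha> - \<alpha>\<^sup>2)"
  proof -
    have "avg (S k) (\<lambda>\<gamma>. u \<gamma> * u \<gamma>) = of_real (ratio k) * of_real (1 - 2 * \<alpha>) + of_real (\<alpha>\<^sup>2)" for k
    proof -
      have "u \<gamma> * u \<gamma> = of_bool (\<gamma> \<in> A) * of_real (1 - 2 * \<alpha>) + of_real (\<alpha>\<^sup>2)" for \<gamma>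
        by (simp add: u_def algebra_simps power2_eq_square)
      then have "avg (S k) (\<lambda>\<gamma>. u \<gamma> * u \<gamma>)
          = avg (S k) (\<lambda>\<gamma>. of_bool (\<gamma> \<in> A) * of_real (1 - 2 * \<alpha>)) + avg (S k) (\<lambda>_. of_real (\<alpha>\<^sup>2))"
        by (simp only: avg_add)
      also have "avg (S k) (\<lambda>\<gamma>. of_bool (\<gamma> \<in> A) * of_real (1 - 2 * \<alpha>)) = of_real (ratio k) * of_real (1 - 2 * \<alpha>)"
        unfolding S_def avg_restrict using A_T_nonempty by (subst avg_const) auto
      also have "avg (S k) (\<lambda>_. of_real (\<alpha>\<^sup>2)) = of_real (\<alpha>\<^sup>2)"
        unfolding S_def using T_nonempty by (intro avg_const) auto
      finally show ?thesis .
    qed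
    moreover have "(\<lambda>k. of_real (ratio k) * of_real (1 - 2 * \<alpha>) + of_real (\<alpha>\<^sup>2) :: complex)
        \<longlonglongrightarrow> of_real \<alpha> * of_real (1 - 2 * \<alpha>) + of_real (\<alpha>\<^sup>2)"
      by (intro tendsto_intros tendsto_of_real ratio_tendsto)
    moreover have "of_real \<alpha> * of_real (1 - 2 * \<alpha>) + of_real (\<alpha>\<^sup>2) = (of_real (\<alpha> - \<alpha>\<^sup>2) :: complex)"
      by (simp add: algebra_simps power2_eq_square)
    ultimately show ?thesis by (simp only:)
  qed
  have ug: "(\<lambda>k. avg (S k) (\<lambda>\<gamma>. u \<gamma> * g \<gamma>)) \<longlonglongrightarrow> of_real (\<alpha> * (\<Sum>j\<in>J. b j * \<kappa> j))"
  proof -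
    have "avg (S k) (\<lambda>\<gamma>. u \<gamma> * g \<gamma>)
        = (\<Sum>j\<in>J. of_real (b j) * (of_real (ratio k) * avg (A \<inter> S k) (c j) - of_real \<alpha> * avg (S k) (c j)))" for k
    proof -
      have "u \<gamma> * g \<gamma> = (\<Sum>j\<in>J. of_real (b j) * (of_bool (\<gamma> \<in> A) * c j \<gamma> - of_real \<alpha> * c j \<gamma>))" for \<gamma>
        unfolding g_def sum_distrib_left by (intro sum.cong refl) (simp add: u_def algebra_simps)
      then show ?thesis
        by (simp only: avg_sum avg_mult_left avg_diff S_def avg_restrict)
    qed
    moreover have "(\<lambda>k. \<Sum>j\<in>J. of_real (b j) * (of_real (ratio k) * avg (A \<inter> S k) (c j) - of_real \<alpha> * avg (S k) (c j)))
        \<longlonglongrightarrow> (\<Sum>j\<in>J. of_real (b j) * (of_real \<alpha> * of_real (\<kappa> j) - of_real \<alpha> * 0))"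
      unfolding S_def by (intro tendsto_intros tendsto_of_real ratio_tendsto \<kappa> tendsto_s[OF c0])
    moreover have "(\<Sum>j\<in>J. of_real (b j) * (of_real \<alpha> * of_real (\<kappa> j) - of_real \<alpha> * 0))
        = (of_real (\<alpha> * (\<Sum>j\<in>J. b j * \<kappa> j)) :: complex)"
      by (simp add: sum_distrib_left mult_ac)
    ultimately show ?thesis by simp
  qed
  have gg: "(\<lambda>k. avg (S k) (\<lambda>\<gamma>. g \<gamma> * cnj (g \<gamma>))) \<longlonglongrightarrow> (\<Sum>j\<in>J. of_real ((b j)\<^sup>2) * m j)"
  proof -
    have "avg (S k) (\<lambda>\<gamma>. g \<gamma> * cnj (g \<gamma>))
        = (\<Sum>i\<in>J. \<Sum>j\<in>J. of_real (b i * b j) * avg (S k) (\<lambda>\<gamma>. c i \<gamma> * cnj (c j \<gamma>)))" for k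
    proof -
      have "g \<gamma> * cnj (g \<gamma>) = (\<Sum>i\<in>J. \<Sum>j\<in>J. of_real (b i * b j) * (c i \<gamma> * cnj (c j \<gamma>)))" for \<gamma>
        unfolding g_def cnj_sum sum_product by (intro sum.cong refl) (simp add: mult_ac)
      then show ?thesis by (simp only: avg_sum avg_mult_left)
    qed
    moreover have "(\<lambda>k. \<Sum>i\<in>J. \<Sum>j\<in>J. of_real (b i * b j) * avg (S k) (\<lambda>\<gamma>. c i \<gamma> * cnj (c j \<gamma>)))
        \<longlonglongrightarrow> (\<Sum>i\<in>J. \<Sum>j\<in>J. of_real (b i * b j) * (if i = j then m i else 0))"
      unfolding S_def
    proof (intro tendsto_sum tendsto_mult tendsto_const tendsto_s)
      fix i j assume "i \<in> J" "j \<in> J"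
      then show "(\<lambda>n. avg (T n) (\<lambda>\<gamma>. c i \<gamma> * cnj (c j \<gamma>))) \<longlonglongrightarrow> (if i = j then m i else 0)"
        using orth diag by auto
    qed
    moreover have "(\<Sum>i\<in>J. \<Sum>j\<in>J. of_real (b i * b j) * (if i = j then m i else 0)) = (\<Sum>j\<in>J. of_real ((b j)\<^sup>2) * m j)"
    proof (rule sum.cong[OF refl])
      fix i assume i: "i \<in> J"
      have "(\<Sum>j\<in>J. of_real (b i * b j) * (if i = j then m i else 0)) = (\<Sum>j\<in>J. if i = j then of_real ((b i)\<^sup>2) * m i else 0)"
        by (intro sum.cong) (auto simp: power2_eq_square)
      then show "(\<Sum>j\<in>J. of_real (b i * b j) * (if i = j then m i else 0)) = of_real ((b i)\<^sup>2) * m i"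
        using J i by simp
    qed
    ultimately show ?thesis by simp
  qed
  have "avg (S k) (\<lambda>\<gamma>. (u \<gamma> - g \<gamma>) * cnj (u \<gamma> - g \<gamma>))
      = avg (S k) (\<lambda>\<gamma>. u \<gamma> * u \<gamma>) - (cnj (avg (S k) (\<lambda>\<gamma>. u \<gamma> * g \<gamma>)) + avg (S k) (\<lambda>\<gamma>. u \<gamma> * g \<gamma>))
        + avg (S k) (\<lambda>\<gamma>. g \<gamma> * cnj (g \<gamma>))" for k
  proof -
    have "(u \<gamma> - g \<gamma>) * cnj (u \<gamma> - g \<gamma>) = u \<gamma> * u \<gamma> - (cnj (u \<gamma> * g \<gamma>) + u \<gamma> * g \<gamma>) + g \<gamma> * cnj (g \<gamma>)" for \<gamma>
      by (simp add: u_def algebra_simps)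
    then show ?thesis by (simp only: avg_add avg_diff avg_cnj)
  qed
  then have "(\<lambda>k. avg (S k) (\<lambda>\<gamma>. (u \<gamma> - g \<gamma>) * cnj (u \<gamma> - g \<gamma>)))
      \<longlonglongrightarrow> of_real (\<alpha> - \<alpha>\<^sup>2) - (cnj (of_real (\<alpha> * (\<Sum>j\<in>J. b j * \<kappa> j))) + of_real (\<alpha> * (\<Sum>j\<in>J. b j * \<kappa> j)))
          + (\<Sum>j\<in>J. of_real ((b j)\<^sup>2) * m j)"
    by (simp only:) (intro tendsto_intros uu ug gg)
  from tendsto_Re[OF this]
  have "0 \<le> Re (of_real (\<alpha> - \<alpha>\<^sup>2) - (cnj (of_real (\<alpha> * (\<Sum>j\<in>J. b j * \<kappa> j))) + of_real (\<alpha> * (\<Sum>j\<in>J. b j * \<kappa> j)))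
          + (\<Sum>j\<in>J. of_real ((b j)\<^sup>2) * m j))"
  proof (rule tendsto_lowerbound)
    have nn: "0 \<le> Re (z * cnj z)" for z by simp
    show "\<forall>\<^sub>F k in sequentially. 0 \<le> Re (avg (S k) (\<lambda>\<gamma>. (u \<gamma> - g \<gamma>) * cnj (u \<gamma> - g \<gamma>)))"
      unfolding Re_avg by (intro always_eventually allI divide_nonneg_nonneg sum_nonneg nn of_nat_0_le_iff)
  qed simp
  also have "\<dots> = \<alpha> - \<alpha>\<^sup>2 - 2 * \<alpha> * (\<Sum>j\<in>J. b j * \<kappa> j) + (\<Sum>j\<in>J. (b j)\<^sup>2 * Re (m j))"
    by (simp add: Re_divide_of_real algebra_simps)
  also have "\<dots> \<le> \<alpha> - \<alpha>\<^sup>2 - 2 * \<alpha> * (\<Sum>j\<in>J. b j * \<kappa> j) + (\<Sum>j\<in>J. (b j)\<^sup>2 * N j)"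
    using N by (intro add_left_mono sum_mono mult_left_mono) auto
  finally show ?thesis .
qed

end

section \<open>A group with an ergodic sequence is countable\<close>

lemma (in group) countable_generate:
  assumes H: "countable H" "H \<subseteq> carrier G"
  shows "countable (generate G H)"
proof -
  define K where "K = H \<union> m_inv G ` H"
  define f where "f xs = foldr (\<otimes>) xs \<one>" for xs
  have KG: "K \<subseteq> carrier G" using H by (auto simp: K_def)
  have f_closed: "f xs \<in> carrier G" if "set xs \<subseteq> carrier G" for xs
    using that by (induction xs) (auto simp: f_def)
  have f_append: "f (xs @ ys) = f xs \<otimes> f ys" if "set xs \<subseteq> carrier G" "set ys \<subseteq> carrier G" for xs ys
    using that f_closed by (induction xs) (auto simp: f_def m_assoc)
  have "generate G H \<subseteq> f ` lists K"
  proof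
    fix x assume "x \<in> generate G H"
    then show "x \<in> f ` lists K"
    proof (induction rule: generate.induct)
      case one
      then show ?case by (intro image_eqI[of _ _ "[]"]) (auto simp: f_def)
    next
      case (incl h)
      then show ?case using H by (intro image_eqI[of _ _ "[h]"]) (auto simp: f_def K_def)
    next
      case (inv h)
      then show ?case using H by (intro image_eqI[of _ _ "[inv h]"]) (auto simp: f_def K_def)
    next
      case (eng h1 h2)
      then obtain xs ys where "h1 = f xs" "h2 = f ys" "set xs \<subseteq> K" "set ys \<subseteq> K" by auto
      then show ?case using f_append KG by (intro image_eqI[of _ _ "xs @ ys"]) auto
    qed
  qed
  moreover have "countable K" using H by (simp add: K_def)
  ultimately show ?thesis using countable_lists countable_image countable_subset by metis
qed

text \<open>
  In the permutation representation on the cosets of the subgroup \<open>\<Lambda>\<close> generated by all \<open>T n\<close>, the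
  averages of the point mass at \<open>\<Lambda>\<close> are constant, so this point mass is fixed by the whole group.
\<close>

lemma (in dense_along) countable_carrier: "countable (carrier G)"
proof -
  define H where "H = (\<Union>n. T n)"
  define L where "L = generate G H"
  have HG: "H \<subseteq> carrier G" using T_carrier by (auto simp: H_def)
  have "countable H" unfolding H_def by (intro countable_UN) (auto intro: countable_finite)
  then have cL: "countable L" unfolding L_def using HG by (rule countable_generate)
  interpret L: subgroup L G unfolding L_def by (rule generate_is_subgroup[OF HG])
  define K where "K x = x <# L" for x
  have K_mult: "K (g \<otimes> x) = g <# K x" if "g \<in> carrier G" "x \<in> carrier G" for g x
    using that L.subset by (simp add: K_def lcos_m_assoc)
  have K_iff: "K (g \<otimes> x) = K (g \<otimes> y) \<longleftrightarrow> K x = K y" if "g \<in> carrier G" "x \<in> carrier G" "y \<in> carrier G" for g x y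
  proof
    assume "K (g \<otimes> x) = K (g \<otimes> y)"
    then have "K (inv g \<otimes> (g \<otimes> x)) = K (inv g \<otimes> (g \<otimes> y))" using that by (simp add: K_mult)
    then show "K x = K y" using that by (simp add: m_assoc[symmetric])
  qed (use that in \<open>simp add: K_mult\<close>)
  define a where "a \<kappa> i = (if fst i \<in> carrier G \<and> K (fst i) = \<kappa> then 1 else 0 :: complex)"
    for \<kappa> and i :: "'g \<times> nat"
  define k where "k i j = (if fst i \<in> carrier G \<and> fst j \<in> carrier G \<and> K (fst i) = K (fst j) then 1 else 0 :: complex)"
    for i j :: "'g \<times> nat"
  interpret k: invariant_kernel G k
  proof
    show "k j i = cnj (k i j)" for i j by (auto simp: k_def)
    show "0 \<le> Re (\<Sum>i\<in>F. \<Sum>j\<in>F. cnj (c i) * c j * k i j)" if F: "finite F" for F c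
    proof -
      define P where "P = (\<lambda>i. K (fst i)) ` F"
      have P: "finite P" using F by (simp add: P_def)
      have kP: "k i j = (\<Sum>\<kappa>\<in>P. a \<kappa> i * a \<kappa> j)" if "i \<in> F" "j \<in> F" for i j
      proof -
        have "(\<Sum>\<kappa>\<in>P. a \<kappa> i * a \<kappa> j) = (\<Sum>\<kappa>\<in>P. if \<kappa> = K (fst i) then a (K (fst i)) i * a (K (fst i)) j else 0)"
          by (intro sum.cong) (auto simp: a_def)
        also have "\<dots> = a (K (fst i)) i * a (K (fst i)) j" using P that by (simp add: P_def)
        also have "\<dots> = k i j" by (auto simp: a_def k_def)
        finally show ?thesis by simp
      qed
      have "(\<Sum>i\<in>F. \<Sum>j\<in>F. cnj (c i) * c j * k i j)
          = (\<Sum>i\<in>F. \<Sum>j\<in>F. \<Sum>\<kappa>\<in>P. (cnj (c i) * a \<kappa> i) * (c j * a \<kappa> j))"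
        by (intro sum.cong refl) (simp add: kP sum_distrib_left mult_ac)
      also have "\<dots> = (\<Sum>i\<in>F. \<Sum>\<kappa>\<in>P. \<Sum>j\<in>F. (cnj (c i) * a \<kappa> i) * (c j * a \<kappa> j))"
        by (intro sum.cong refl sum.swap)
      also have "\<dots> = (\<Sum>\<kappa>\<in>P. \<Sum>i\<in>F. \<Sum>j\<in>F. (cnj (c i) * a \<kappa> i) * (c j * a \<kappa> j))"
        by (rule sum.swap)
      also have "\<dots> = (\<Sum>\<kappa>\<in>P. cnj (\<Sum>i\<in>F. c i * a \<kappa> i) * (\<Sum>j\<in>F. c j * a \<kappa> j))"
        unfolding cnj_sum sum_product by (intro sum.cong refl) (auto simp: a_def)
      finally have eq: "(\<Sum>i\<in>F. \<Sum>j\<in>F. cnj (c i) * c j * k i j)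
          = (\<Sum>\<kappa>\<in>P. cnj (\<Sum>i\<in>F. c i * a \<kappa> i) * (\<Sum>j\<in>F. c j * a \<kappa> j))" .
      have "0 \<le> Re (cnj z * z)" for z by simp
      then show ?thesis unfolding eq Re_sum by (intro sum_nonneg)
    qed
    show "k (x, n) j = 0" if "x \<notin> carrier G" for x n j using that by (simp add: k_def)
    show "k (g \<otimes> x, n) (g \<otimes> y, m) = k (x, n) (y, m)"
      if "g \<in> carrier G" "x \<in> carrier G" "y \<in> carrier G" for g x y n m
      using that by (simp add: k_def K_iff)
  qed
  show ?thesis
  proof (rule k.rep_of_kernel)
    fix R :: "'g rep" and \<xi>
    assume R: "unitary_rep G R" and xiV: "\<And>n. \<xi> n \<in> vecs R"
      and ipR: "\<And>x y n m. \<lbrakk>x \<in> carrier G; y \<in> carrier G\<rbrakk> \<Longrightarrow> ip R (act R x (\<xi> n)) (act R y (\<xi> m)) = k (x, n) (y, m)"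
    interpret R: unitary_rep G R by (rule R)
    have ip1: "ip R (\<xi> 0) (act R y (\<xi> 0)) = (if K \<one> = K y then 1 else 0)" if "y \<in> carrier G" for y
      using ipR[OF one_closed that, of 0 0] that xiV by (simp add: R.act_one k_def)
    have fixed: "act R g (\<xi> 0) = \<xi> 0" if g: "g \<in> L" for g
    proof -
      have gG: "g \<in> carrier G" using g by simp
      have "K g = K \<one>" using g gG coset_join3[OF gG L.subgroup_axioms g] coset_join3[OF one_closed L.subgroup_axioms]
        by (simp add: K_def)
      then have "ip R (\<xi> 0) (act R g (\<xi> 0)) = 1" "ip R (\<xi> 0) (\<xi> 0) = 1"
        using ip1[OF gG] ip1[OF one_closed] xiV by (simp_all add: R.act_one)
      moreover have "ip R (act R g (\<xi> 0)) (act R g (\<xi> 0)) = 1"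
        using calculation(2) gG xiV by (simp add: R.act_ip)
      moreover have "ip R (act R g (\<xi> 0)) (\<xi> 0) = 1"
        using calculation(1) R.ip_cnj[of "\<xi> 0" "act R g (\<xi> 0)"] gG xiV by (simp add: R.act_closed)
      ultimately have "ip R (act R g (\<xi> 0) - \<xi> 0) (act R g (\<xi> 0) - \<xi> 0) = 0"
        using gG xiV by (simp add: R.s_diff_left R.s_diff_right R.act_closed)
      then have "act R g (\<xi> 0) - \<xi> 0 = 0"
        using R.ip_pos[of "act R g (\<xi> 0) - \<xi> 0"] gG xiV by (force simp: R.act_closed)
      then show ?thesis by simp
    qed
    obtain p where p: "p \<in> fixed_vecs G R"
      "\<And>v. v \<in> vecs R \<Longrightarrow> (\<lambda>n. avg (T n) (\<lambda>\<gamma>. ip R v (act R \<gamma> (\<xi> 0)))) \<longlonglongrightarrow> ip R v p"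
      using ergodic_mean[OF R xiV[of 0]] by metis
    have "\<xi> 0 = p"
    proof (rule R.ip_ext)
      fix v assume v: "v \<in> vecs R"
      have "avg (T (s n)) (\<lambda>\<gamma>. ip R v (act R \<gamma> (\<xi> 0))) = ip R v (\<xi> 0)" for n
      proof -
        have "\<gamma> \<in> L" if "\<gamma> \<in> T (s n)" for \<gamma>
          unfolding L_def using that by (intro generate.incl) (auto simp: H_def)
        then have "avg (T (s n)) (\<lambda>\<gamma>. ip R v (act R \<gamma> (\<xi> 0))) = avg (T (s n)) (\<lambda>_. ip R v (\<xi> 0))"
          by (intro avg_cong) (simp add: fixed)
        then show ?thesis using T_nonempty by (simp add: avg_const)
      qed
      then show "ip R v (\<xi> 0) = ip R v p"
        using tendsto_s[OF p(2)[OF v]] by (simp add: LIMSEQ_const_iff)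
    qed (use xiV p(1) in \<open>auto simp: fixed_vecs_def\<close>)
    then have "g \<in> L" if g: "g \<in> carrier G" for g
    proof -
      have "act R g (\<xi> 0) = \<xi> 0" using p(1) g \<open>\<xi> 0 = p\<close> by (simp add: fixed_vecs_def)
      then have "K \<one> = K g" using ip1[OF g] ip1[OF one_closed] xiV by (simp add: R.act_one split: if_splits)
      moreover have "g \<in> K g" using g L.one_closed by (force simp: K_def l_coset_def)
      moreover have "K \<one> = L" unfolding K_def by (rule coset_join3[OF one_closed L.subgroup_axioms L.one_closed])
      ultimately show ?thesis by simp
    qed
    then have "carrier G \<subseteq> L" by blast
    then show "countable (carrier G)" using cL by (rule countable_subset)
  qed
qed

section \<open>Seminorms and the counting of classes\<close>

lemma (in unitary_rep) rep_seminorm_bound: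
  assumes g: "g \<in> carrier G" and v: "v \<in> vecs R"
  shows "hnorm R (act R g v - v) \<le> rep_seminorm R g * hnorm R v"
proof (cases "v = 0")
  case False
  define X where "X = {hnorm R (act R g w - w) | w. w \<in> vecs R \<and> hnorm R w = 1}"
  have "x \<le> 2" if "x \<in> X" for x
  proof -
    obtain w where w: "w \<in> vecs R" "hnorm R w = 1" "x = hnorm R (act R g w - w)"
      using \<open>x \<in> X\<close> unfolding X_def by blast
    have "hnorm R (act R g w - w) \<le> hnorm R (act R g w - 0) + hnorm R (0 - w)"
      using g w by (intro nrm_triangle3) (auto simp: act_closed)
    also have "\<dots> = 2" using g w nrm_minus_commute[of 0 w] by simp
    finally show ?thesis using w by simp
  qed
  then have bdd: "bdd_above X" by (rule bdd_aboveI)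
  have n: "hnorm R v > 0" using v False hnorm_eq_0[OF v] nrm_nonneg[OF v] by linarith
  define w where "w = cscale (1 / of_real (hnorm R v)) v"
  have w: "w \<in> vecs R" "hnorm R w = 1"
    unfolding w_def using v n by (auto simp: nrm_scale norm_divide)
  have vw: "v = cscale (of_real (hnorm R v)) w" using n by (simp add: w_def)
  have "act R g v - v = cscale (of_real (hnorm R v)) (act R g w - w)"
    by (subst (1 2) vw) (simp only: act_scale[OF g w(1)] cvs.scale_right_diff_distrib)
  then have "hnorm R (act R g v - v) = hnorm R (cscale (of_real (hnorm R v)) (act R g w - w))" by (rule arg_cong)
  also have "\<dots> = hnorm R v * hnorm R (act R g w - w)"
    using g w n by (subst nrm_scale) (auto simp: act_closed)
  also have "hnorm R (act R g w - w) \<le> rep_seminorm R g"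
    unfolding rep_seminorm_def X_def[symmetric] using w bdd by (intro cSup_upper) (auto simp: X_def)
  finally show ?thesis using n by (simp add: mult.commute)
qed (use g in simp)

lemma min_nontrivial_dim_pos:
  fixes G :: "('a, 'm) monoid_scheme"
  assumes "min_nontrivial_dim G = enat d"
  shows "d > 0"
proof (rule ccontr)
  assume "\<not> d > 0"
  define X where "X = {hdim R | R :: 'a rep. unitary_rep G R \<and> nontrivial_rep G R}"
  have 0: "Inf X = 0"
    using assms \<open>\<not> d > 0\<close> by (simp add: min_nontrivial_dim_def X_def zero_enat_def)
  then obtain x where "x \<in> X" by (cases "X = {}") (auto simp: Inf_enat_def)
  then have "(LEAST x. x \<in> X) \<in> X" by (rule LeastI)
  then have "0 \<in> X" using 0 \<open>x \<in> X\<close> by (auto simp: Inf_enat_def split: if_splits)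
  then obtain R :: "'a rep" where R: "unitary_rep G R" "nontrivial_rep G R" "hdim R = 0"
    unfolding X_def by auto
  interpret R: unitary_rep G R by (rule R)
  obtain B where B: "finite B" "cvs.span B = vecs R" "cvs.dim (vecs R) = 0"
    using R(3) by (auto simp: hdim_def zero_enat_def split: if_splits)
  obtain E where E: "orthonormal R E" "cvs.span E = vecs R"
    using R.ex_orthonormal_basis_span[of B "vecs R"] B R.subspace_vecs cvs.span_superset[of B] by auto
  have "card E = 0" using R.dim_orthonormal[OF E(1)] E(2) B(3) by simp
  then have "vecs R = {0}" using E R.orthonormal_finite[OF E(1)] by simp
  then show False using R(2) by (auto simp: nontrivial_rep_def)
qed

context dense_along
begin

lemma class_count:
  fixes R :: "'g rep"
  assumes R: "unitary_rep G R" and K: "finite K" "\<And>F. F \<in> K \<Longrightarrow> irreducible_frame G R F"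
    and nt: "\<And>F. F \<in> K \<Longrightarrow> nontrivial_rep G (subrep R F)"
    and x: "\<And>F. F \<in> K \<Longrightarrow> x F \<in> cvs.span F" and y: "\<And>F. F \<in> K \<Longrightarrow> y F \<in> cvs.span F"
    and lim: "\<And>F. F \<in> K \<Longrightarrow> (\<lambda>k. avg (A \<inter> T (s k)) (\<lambda>a. ip R (y F) (act R a (x F)))) \<longlonglongrightarrow> of_real ((hnorm R (y F))\<^sup>2)"
    and big: "\<And>F. F \<in> K \<Longrightarrow> c * hnorm R (x F) < hnorm R (y F)" and c: "c > 0"
    and d: "d > 0" "\<And>F. F \<in> K \<Longrightarrow> d \<le> card F"
  shows "real (card ((\<lambda>F. unitary_equiv_rel G `` {subrep R F}) ` K)) * (real d * \<alpha>\<^sup>2 * c\<^sup>2) \<le> \<alpha> - \<alpha>\<^sup>2"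
proof -
  interpret R: unitary_rep G R by (rule R)
  define cls where "cls F = unitary_equiv_rel G `` {subrep R F}" for F
  obtain J where J: "J \<subseteq> K" "inj_on cls J" "cls ` K = cls ` J"
    using subset_image_inj[of "cls ` K" cls K] by auto
  have fJ: "finite J" using J K finite_subset by blast
  have V: "x F \<in> vecs R" "y F \<in> vecs R" if "F \<in> J" for F
    using x y R.orthonormal_span_vecs[OF R.frame_orthonormal[OF R.irreducible_frame_invariant[OF K(2)]]]
      that J by blast+
  have pos: "hnorm R (x F) > 0" if F: "F \<in> J" for F
  proof (rule ccontr)
    assume "\<not> ?thesis"
    then have x0: "x F = 0" using R.hnorm_eq_0[OF V(1)[OF F]] R.nrm_nonneg[OF V(1)[OF F]] by simp
    have FK: "F \<in> K" using F J by blast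
    have "avg (A \<inter> T (s k)) (\<lambda>a. ip R (y F) (act R a (x F))) = 0" for k
      using V(2)[OF F] A_carrier by (subst avg_cong[of _ _ "\<lambda>_. 0"]) (auto simp: x0 avg_def)
    then have "complex_of_real ((hnorm R (y F))\<^sup>2) = 0"
      using lim[OF FK] by (simp add: LIMSEQ_const_iff del: of_real_power)
    then have "hnorm R (y F) = 0" by simp
    then show False using big[OF FK] x0 by simp
  qed
  define b where "b F = \<alpha> * real d / (hnorm R (x F))\<^sup>2" for F
  define N where "N F = (hnorm R (x F))\<^sup>2 * (hnorm R (y F))\<^sup>2 / real d" for F
  have "0 \<le> \<alpha> - \<alpha>\<^sup>2 - 2 * \<alpha> * (\<Sum>F\<in>J. b F * (hnorm R (y F))\<^sup>2) + (\<Sum>F\<in>J. (b F)\<^sup>2 * N F)"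
  proof (rule bessel_density[OF fJ, where c = "\<lambda>F \<gamma>. ip R (y F) (act R \<gamma> (x F))"
        and m = "\<lambda>F. tmean R (x F) (x F) (y F) (y F)"])
    fix F assume F: "F \<in> J"
    then have FK: "F \<in> K" using J by blast
    show "(\<lambda>n. avg (T n) (\<lambda>\<gamma>. ip R (y F) (act R \<gamma> (x F)))) \<longlonglongrightarrow> 0"
      by (rule mean_nontrivial_irreducible[OF R K(2)[OF FK] nt[OF FK] x[OF FK] y[OF FK]])
    show "(\<lambda>n. avg (T n) (\<lambda>\<gamma>. ip R (y F) (act R \<gamma> (x F)) * cnj (ip R (y F) (act R \<gamma> (x F)))))
        \<longlonglongrightarrow> tmean R (x F) (x F) (y F) (y F)"
      by (intro tmean_tendsto R V F)
    have "real d * Re (tmean R (x F) (x F) (y F) (y F)) \<le> real (card F) * Re (tmean R (x F) (x F) (y F) (y F))"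
      using d(2)[OF FK] semi_ip.s_nonneg[OF semi_ip_tmean[OF R V(1)[OF F]] V(2)[OF F]]
      by (intro mult_right_mono) auto
    also have "\<dots> \<le> (hnorm R (x F))\<^sup>2 * (hnorm R (y F))\<^sup>2"
      by (rule tmean_irreducible_le[OF R K(2)[OF FK] x[OF FK] y[OF FK]])
    finally show "Re (tmean R (x F) (x F) (y F) (y F)) \<le> N F"
      using d(1) by (simp add: N_def field_simps)
    show "(\<lambda>k. avg (A \<inter> T (s k)) (\<lambda>a. ip R (y F) (act R a (x F)))) \<longlonglongrightarrow> of_real ((hnorm R (y F))\<^sup>2)"
      by (rule lim[OF FK])
  next
    fix E F assume EF: "E \<in> J" "F \<in> J" "E \<noteq> F"
    have EK: "E \<in> K" and FK: "F \<in> K" using EF J by blast+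
    have "\<not> unitarily_equivalent G (subrep R F) (subrep R E)"
    proof
      assume "unitarily_equivalent G (subrep R F) (subrep R E)"
      then have "(subrep R F, subrep R E) \<in> unitary_equiv_rel G"
        using irreducible_frame_fd_irreps[OF R K(2)[OF EK]] irreducible_frame_fd_irreps[OF R K(2)[OF FK]]
        by (simp add: unitary_equiv_rel_def)
      then have "cls F = cls E" unfolding cls_def by (rule unitary_equiv_class_eq)
      then show False using J(2) EF by (auto dest: inj_onD)
    qed
    then have "tmean R (x E) (x F) (y E) (y F) = 0"
      by (intro tmean_inequivalent[OF R K(2)[OF EK] K(2)[OF FK]] x y EK FK)
    then show "(\<lambda>n. avg (T n) (\<lambda>\<gamma>. ip R (y E) (act R \<gamma> (x E)) * cnj (ip R (y F) (act R \<gamma> (x F))))) \<longlonglongrightarrow> 0"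
      using tmean_tendsto[OF R V(1)[OF EF(1)] V(1)[OF EF(2)] V(2)[OF EF(1)] V(2)[OF EF(2)]] by simp
  qed
  also have "\<dots> = \<alpha> - \<alpha>\<^sup>2 - (\<Sum>F\<in>J. real d * \<alpha>\<^sup>2 * ((hnorm R (y F))\<^sup>2 / (hnorm R (x F))\<^sup>2))"
  proof -
    have 1: "2 * \<alpha> * (b F * (hnorm R (y F))\<^sup>2) - (b F)\<^sup>2 * N F
        = real d * \<alpha>\<^sup>2 * ((hnorm R (y F))\<^sup>2 / (hnorm R (x F))\<^sup>2)" if "F \<in> J" for F
      using pos[OF that] d(1) by (simp add: b_def N_def field_simps power2_eq_square)
    have "2 * \<alpha> * (\<Sum>F\<in>J. b F * (hnorm R (y F))\<^sup>2) - (\<Sum>F\<in>J. (b F)\<^sup>2 * N F)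
        = (\<Sum>F\<in>J. real d * \<alpha>\<^sup>2 * ((hnorm R (y F))\<^sup>2 / (hnorm R (x F))\<^sup>2))"
      unfolding sum_distrib_left sum_subtractf[symmetric] by (intro sum.cong refl 1)
    then show ?thesis by linarith
  qed
  finally have "(\<Sum>F\<in>J. real d * \<alpha>\<^sup>2 * ((hnorm R (y F))\<^sup>2 / (hnorm R (x F))\<^sup>2)) \<le> \<alpha> - \<alpha>\<^sup>2" by simp
  moreover have "(\<Sum>F\<in>J. real d * \<alpha>\<^sup>2 * c\<^sup>2) \<le> (\<Sum>F\<in>J. real d * \<alpha>\<^sup>2 * ((hnorm R (y F))\<^sup>2 / (hnorm R (x F))\<^sup>2))"
  proof (intro sum_mono mult_left_mono)
    fix F assume F: "F \<in> J"
    then have "c * hnorm R (x F) \<le> hnorm R (y F)" using big J by (meson less_imp_le subsetD)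
    then have "(c * hnorm R (x F))\<^sup>2 \<le> (hnorm R (y F))\<^sup>2" using c pos[OF F] by (intro power_mono) auto
    then show "c\<^sup>2 \<le> (hnorm R (y F))\<^sup>2 / (hnorm R (x F))\<^sup>2"
      using pos[OF F] by (simp add: power_mult_distrib field_simps)
  qed auto
  moreover have "card (cls ` K) = card J" unfolding J(3) by (rule card_image[OF J(2)])
  ultimately show ?thesis by (simp add: cls_def[abs_def])
qed

lemma dense_along_subseq:
  assumes "strict_mono \<sigma>"
  shows "dense_along G T A \<alpha> (s \<circ> \<sigma>)"
proof
  show "strict_mono (s \<circ> \<sigma>)" using s_mono assms by (rule strict_mono_o)
  show "(\<lambda>k. real (card (A \<inter> T ((s \<circ> \<sigma>) k))) / real (card (T ((s \<circ> \<sigma>) k)))) \<longlonglongrightarrow> \<alpha>"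
    using LIMSEQ_subseq_LIMSEQ[OF density assms] by (simp add: o_def)
qed (use A_carrier alpha_pos A_T_nonempty in auto)

end

section \<open>Measure preserving actions\<close>

context pmp_space
begin

lemma group_G: "group G"
  using group_hom by (rule group_hom.axioms(1))

lemma inv_carrier: "g \<in> carrier G \<Longrightarrow> inv\<^bsub>G\<^esub> g \<in> carrier G"
  by (rule group.inv_closed[OF group_G])

lemma image_eq_vimage:
  assumes g: "g \<in> carrier G" and D: "D \<subseteq> space M"
  shows "\<phi> g ` D = \<phi> (inv\<^bsub>G\<^esub> g) -` D \<inter> space M"
proof
  show "\<phi> g ` D \<subseteq> \<phi> (inv\<^bsub>G\<^esub> g) -` D \<inter> space M"
    using orbit_sym_aux[OF g] element_image[OF g] D by auto
  show "\<phi> (inv\<^bsub>G\<^esub> g) -` D \<inter> space M \<subseteq> \<phi> g ` D"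
  proof
    fix y assume y: "y \<in> \<phi> (inv\<^bsub>G\<^esub> g) -` D \<inter> space M"
    then have "\<phi> g (\<phi> (inv\<^bsub>G\<^esub> g) y) = y"
      using orbit_sym_aux[OF inv_carrier[OF g], of y] group.inv_inv[OF group_G g] by simp
    then show "y \<in> \<phi> g ` D" using y by (intro image_eqI[of _ _ "\<phi> (inv\<^bsub>G\<^esub> g) y"]) auto
  qed
qed

lemma image_sets:
  assumes g: "g \<in> carrier G" and D: "D \<in> sets M"
  shows "\<phi> g ` D \<in> sets M"
  unfolding image_eq_vimage[OF g sets.sets_into_space[OF D]]
  using measurable_act[OF inv_carrier[OF g]] D by (rule measurable_sets)

lemma measure_image:
  assumes g: "g \<in> carrier G" and D: "D \<in> sets M"
  shows "measure M (\<phi> g ` D) = measure M D"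
proof -
  have "measure M D = measure (distr M M (\<phi> (inv\<^bsub>G\<^esub> g))) D"
    using preserves_measure[OF inv_carrier[OF g]] by simp
  also have "\<dots> = measure M (\<phi> (inv\<^bsub>G\<^esub> g) -` D \<inter> space M)"
    using measurable_act[OF inv_carrier[OF g]] D by (rule measure_distr)
  finally show ?thesis by (simp add: image_eq_vimage[OF g sets.sets_into_space[OF D]])
qed

lemma image_mult:
  assumes "g \<in> carrier G" "h \<in> carrier G" "D \<subseteq> space M"
  shows "\<phi> (g \<otimes>\<^bsub>G\<^esub> h) ` D = \<phi> g ` \<phi> h ` D"
  using assms composition_rule by (force simp: image_image)

lemma image_one: "D \<subseteq> space M \<Longrightarrow> \<phi> \<one>\<^bsub>G\<^esub> ` D = D"
  unfolding id_eq_one[symmetric] by (auto simp: subset_iff image_iff)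

lemma image_Int:
  assumes "g \<in> carrier G" "D \<subseteq> space M" "D' \<subseteq> space M"
  shows "\<phi> g ` (D \<inter> D') = \<phi> g ` D \<inter> \<phi> g ` D'"
  using inj_on_image_Int[OF inj_prop[OF assms(1)] assms(2,3)] .

lemma sum_measure_Int_nonneg:
  fixes a :: "'i \<Rightarrow> real"
  assumes F: "finite F" and C: "\<And>i. i \<in> F \<Longrightarrow> C i \<in> sets M"
  shows "0 \<le> (\<Sum>i\<in>F. \<Sum>j\<in>F. a i * a j * measure M (C i \<inter> C j))"
proof -
  have int: "integrable M (\<lambda>x. a i * a j * indicator (C i \<inter> C j) x)" if "i \<in> F" "j \<in> F" for i j
    using C[OF that(1)] C[OF that(2)] by (intro integrable_mult_right integrable_real_indicator) (auto simp: emeasure_eq_measure)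
  have "(\<Sum>i\<in>F. \<Sum>j\<in>F. a i * a j * measure M (C i \<inter> C j))
      = (\<Sum>i\<in>F. \<Sum>j\<in>F. (\<integral>x. a i * a j * indicator (C i \<inter> C j) x \<partial>M))"
    using C by (intro sum.cong refl) (simp add: sets.Int)
  also have "\<dots> = (\<integral>x. (\<Sum>i\<in>F. \<Sum>j\<in>F. a i * a j * indicator (C i \<inter> C j) x) \<partial>M)"
    using int by (simp add: Bochner_Integration.integral_sum)
  also have "\<dots> = (\<integral>x. (\<Sum>i\<in>F. a i * indicator (C i) x)\<^sup>2 \<partial>M)"
    by (intro Bochner_Integration.integral_cong refl)
      (simp add: power2_eq_square sum_product indicator_inter_arith mult_ac)
  also have "\<dots> \<ge> 0" by (intro integral_nonneg_AE) auto
  finally show ?thesis .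
qed

lemma rep_of_sets:
  fixes D :: "nat \<Rightarrow> 'y set"
  assumes D: "\<And>n. D n \<in> sets M"
  obtains R :: "'g rep" and \<xi> where "unitary_rep G R" "\<And>n. \<xi> n \<in> vecs R"
    "\<And>x y n m. \<lbrakk>x \<in> carrier G; y \<in> carrier G\<rbrakk> \<Longrightarrow>
       ip R (act R x (\<xi> n)) (act R y (\<xi> m)) = of_real (measure M (\<phi> x ` D n \<inter> \<phi> y ` D m))"
proof -
  interpret group G by (rule group_G)
  define C where "C i = (if fst i \<in> carrier G then \<phi> (fst i) ` D (snd i) else {})" for i :: "'g \<times> nat"
  define k where "k i j = complex_of_real (measure M (C i \<inter> C j))" for i j
  have C: "C i \<in> sets M" for i using image_sets D by (auto simp: C_def)
  interpret k: invariant_kernel G k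
  proof
    show "k j i = cnj (k i j)" for i j by (simp add: k_def Int_commute)
    show "0 \<le> Re (\<Sum>i\<in>F. \<Sum>j\<in>F. cnj (c i) * c j * k i j)" if F: "finite F" for F c
    proof -
      have "Re (\<Sum>i\<in>F. \<Sum>j\<in>F. cnj (c i) * c j * k i j)
          = (\<Sum>i\<in>F. \<Sum>j\<in>F. Re (c i) * Re (c j) * measure M (C i \<inter> C j))
          + (\<Sum>i\<in>F. \<Sum>j\<in>F. Im (c i) * Im (c j) * measure M (C i \<inter> C j))"
        unfolding Re_sum sum.distrib[symmetric] by (intro sum.cong refl) (simp add: k_def algebra_simps)
      then show ?thesis
        using sum_measure_Int_nonneg[OF F C, of "\<lambda>i. Re (c i)"] sum_measure_Int_nonneg[OF F C, of "\<lambda>i. Im (c i)"] by simp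
    qed
    show "k (x, n) j = 0" if "x \<notin> carrier G" for x n j using that by (simp add: k_def C_def)
    show "k (g \<otimes>\<^bsub>G\<^esub> x, n) (g \<otimes>\<^bsub>G\<^esub> y, m) = k (x, n) (y, m)"
      if g: "g \<in> carrier G" "x \<in> carrier G" "y \<in> carrier G" for g x y n m
    proof -
      have S: "D i \<subseteq> space M" "C j \<subseteq> space M" for i j
        by (intro sets.sets_into_space D C)+
      have "C (g \<otimes>\<^bsub>G\<^esub> z, i) = \<phi> g ` C (z, i)" if "z \<in> carrier G" for z i
        using g that S by (simp add: C_def image_mult)
      then have "C (g \<otimes>\<^bsub>G\<^esub> x, n) \<inter> C (g \<otimes>\<^bsub>G\<^esub> y, m) = \<phi> g ` (C (x, n) \<inter> C (y, m))"
        using g S by (simp add: image_Int)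
      then show ?thesis using measure_image[OF g(1)] C by (simp add: k_def sets.Int)
    qed
  qed
  show ?thesis
  proof (rule k.rep_of_kernel)
    fix R :: "'g rep" and \<xi>
    assume *: "unitary_rep G R" "\<And>n. \<xi> n \<in> vecs R"
      "\<And>x y n m. \<lbrakk>x \<in> carrier G; y \<in> carrier G\<rbrakk> \<Longrightarrow> ip R (act R x (\<xi> n)) (act R y (\<xi> m)) = k (x, n) (y, m)"
    show thesis
    proof (rule that[OF *(1,2)])
      show "ip R (act R x (\<xi> n)) (act R y (\<xi> m)) = of_real (measure M (\<phi> x ` D n \<inter> \<phi> y ` D m))"
        if "x \<in> carrier G" "y \<in> carrier G" for x y n m
        using *(3)[OF that] that by (simp add: k_def C_def)
    qed
  qed
qed

end

section \<open>Product sets\<close>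

lemma Re_avg_le:
  assumes "finite S" "S \<noteq> {}" "\<And>\<gamma>. \<gamma> \<in> S \<Longrightarrow> Re (F \<gamma>) \<le> c"
  shows "Re (avg S F) \<le> c"
proof -
  have "(\<Sum>\<gamma>\<in>S. Re (F \<gamma>)) \<le> real (card S) * c"
    using sum_mono[of S "\<lambda>\<gamma>. Re (F \<gamma>)" "\<lambda>_. c"] assms(3) by simp
  then show ?thesis
    unfolding Re_avg using assms(1,2) by (simp add: card_gt_0_iff field_simps)
qed

locale product_set = dense_along G T A \<alpha> s + pmp_space G M \<phi>
  for G :: "('g, 'm) monoid_scheme" (structure) and T :: "nat \<Rightarrow> 'g set" and A \<alpha> s
    and M :: "'y measure" and \<phi> :: "'g \<Rightarrow> 'y \<Rightarrow> 'y" +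
  fixes B :: "'y set"
  assumes B_sets: "B \<in> sets M" and B_pos: "measure M B > 0"
begin

lemma translates_sets: "translates \<phi> A B \<in> sets M"
proof -
  have "countable A" using countable_carrier A_carrier countable_subset by blast
  then show ?thesis
    unfolding translates_def using A_carrier B_sets by (intro sets.countable_UN') (auto intro: image_sets)
qed

lemma translate_subset: "a \<in> A \<Longrightarrow> \<phi> a ` B \<subseteq> translates \<phi> A B"
  by (auto simp: translates_def)

lemma almost_periodic_part:
  fixes R :: "'g rep"
  assumes R: "unitary_rep G R" and \<xi>: "\<xi> \<in> vecs R" and \<eta>: "\<eta> > 0"
  obtains U where "invariant_frame G R U"
    "\<And>\<sigma> w. \<lbrakk>strict_mono \<sigma>; w \<in> vecs R; hnorm R w \<le> 1\<rbrakk> \<Longrightarrow>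
       \<forall>\<^sub>F k in sequentially. cmod (avg (A \<inter> T (s (\<sigma> k))) (\<lambda>\<gamma>. ip R w (act R \<gamma> (\<xi> - proj R U \<xi>)))) < \<eta>"
    "\<And>w. \<lbrakk>w \<in> vecs R; hnorm R w \<le> 1\<rbrakk> \<Longrightarrow>
       \<forall>\<^sub>F n in sequentially. cmod (avg (T n) (\<lambda>\<gamma>. ip R w (act R \<gamma> (\<xi> - proj R U \<xi>)))) < \<eta>"
proof -
  interpret R: unitary_rep G R by (rule R)
  define \<delta> where "\<delta> = \<alpha> * \<eta>\<^sup>2 / 2"
  have \<delta>: "\<delta> > 0" using alpha_pos \<eta> by (simp add: \<delta>_def)
  have \<delta>2: "\<delta> < \<alpha> * \<eta>\<^sup>2" using alpha_pos \<eta> by (simp add: \<delta>_def)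
  obtain U where U: "invariant_frame G R U"
    and small: "\<And>w. w \<in> vecs R \<Longrightarrow> Re (tmean R (\<xi> - proj R U \<xi>) (\<xi> - proj R U \<xi>) w w) \<le> \<delta> * (hnorm R w)\<^sup>2"
    by (rule almost_periodic_approx[OF R \<xi> \<delta>]) blast
  define r where "r = \<xi> - proj R U \<xi>"
  have rV: "r \<in> vecs R" using \<xi> R.proj_vecs[OF R.frame_orthonormal[OF U]] by (simp add: r_def)
  have small': "Re (tmean R r r w w) < \<alpha> * \<eta>\<^sup>2" if w: "w \<in> vecs R" "hnorm R w \<le> 1" for w
  proof -
    have "(hnorm R w)\<^sup>2 \<le> 1" using w by (simp add: power_le_one)
    then have "\<delta> * (hnorm R w)\<^sup>2 \<le> \<delta> * 1" using \<delta> by (intro mult_left_mono) auto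
    then show ?thesis using small[OF w(1)] \<delta>2 by (simp add: r_def)
  qed
  show ?thesis
  proof (rule that[OF U])
    fix \<sigma> :: "nat \<Rightarrow> nat" and w assume \<sigma>: "strict_mono \<sigma>" and w: "w \<in> vecs R" "hnorm R w \<le> 1"
    interpret D: dense_along G T A \<alpha> "s \<circ> \<sigma>" by (rule dense_along_subseq[OF \<sigma>])
    show "\<forall>\<^sub>F k in sequentially. cmod (avg (A \<inter> T (s (\<sigma> k))) (\<lambda>\<gamma>. ip R w (act R \<gamma> (\<xi> - proj R U \<xi>)))) < \<eta>"
      using D.weak_mixing_error[OF R rV w(1) small'[OF w] \<eta>] by (simp add: r_def)
  next
    fix w assume w: "w \<in> vecs R" "hnorm R w \<le> 1"
    have "\<alpha> * \<eta>\<^sup>2 \<le> 1 * \<eta>\<^sup>2" using alpha_le_1 by (intro mult_right_mono) auto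
    then have "Re (tmean R r r w w) < \<eta>\<^sup>2" using small'[OF w] by simp
    with tendsto_Re[OF tmean_tendsto[OF R rV rV w(1) w(1)]]
    have "\<forall>\<^sub>F n in sequentially. Re (avg (T n) (\<lambda>\<gamma>. ip R w (act R \<gamma> r) * cnj (ip R w (act R \<gamma> r)))) < \<eta>\<^sup>2"
      by (rule order_tendstoD(2))
    then show "\<forall>\<^sub>F n in sequentially. cmod (avg (T n) (\<lambda>\<gamma>. ip R w (act R \<gamma> (\<xi> - proj R U \<xi>)))) < \<eta>"
    proof eventually_elim
      case (elim n)
      have "(cmod (avg (T n) (\<lambda>\<gamma>. ip R w (act R \<gamma> r))))\<^sup>2 < \<eta>\<^sup>2"
        using cmod_avg_sq_le elim by (rule le_less_trans)
      then show ?case unfolding r_def by (rule power2_less_imp_less) (use \<eta> in simp)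
    qed
  qed
qed

lemma limit_vector:
  fixes R :: "'g rep"
  assumes R: "unitary_rep G R" and \<xi>: "\<xi> \<in> vecs R" "hnorm R \<xi> \<le> 1" and U: "invariant_frame G R U"
  obtains \<sigma> q where "strict_mono (\<sigma> :: nat \<Rightarrow> nat)" "q \<in> cvs.span U"
    "\<And>w. w \<in> vecs R \<Longrightarrow> (\<lambda>k. avg (A \<inter> T (s (\<sigma> k))) (\<lambda>a. ip R w (act R a (proj R U \<xi>)))) \<longlonglongrightarrow> ip R w q"
proof -
  interpret R: unitary_rep G R by (rule R)
  note onU = R.frame_orthonormal[OF U]
  have UV: "e \<in> vecs R" if "e \<in> U" for e using onU that by (rule R.orthonormal_vecs)
  have AG: "a \<in> carrier G" if "a \<in> A \<inter> X" for a X using that A_carrier by auto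
  have b: "cmod (avg (A \<inter> T (s k)) (\<lambda>a. ip R e (act R a \<xi>))) \<le> 1" if e: "e \<in> U" for k e
  proof (rule cmod_avg_le)
    fix a assume "a \<in> A \<inter> T (s k)"
    then have a: "a \<in> carrier G" by (rule AG)
    have "cmod (ip R e (act R a \<xi>)) \<le> hnorm R e * hnorm R (act R a \<xi>)"
      by (intro R.cauchy_schwarz UV e R.act_closed a \<xi>)
    also have "\<dots> \<le> 1" using R.orthonormal_hnorm[OF onU e] a \<xi> by simp
    finally show "cmod (ip R e (act R a \<xi>)) \<le> 1" .
  qed simp
  have "countable U" using R.orthonormal_finite[OF onU] by (rule countable_finite)
  from function_convergent_subsequence[of U "\<lambda>k e. avg (A \<inter> T (s k)) (\<lambda>a. ip R e (act R a \<xi>))" 1, OF this b]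
  obtain \<sigma> where \<sigma>: "strict_mono (\<sigma> :: nat \<Rightarrow> nat)"
    and "\<And>e. e \<in> U \<Longrightarrow> \<exists>l. (\<lambda>k. avg (A \<inter> T (s (\<sigma> k))) (\<lambda>a. ip R e (act R a \<xi>))) \<longlonglongrightarrow> l" by blast
  then obtain l where l: "\<And>e. e \<in> U \<Longrightarrow> (\<lambda>k. avg (A \<inter> T (s (\<sigma> k))) (\<lambda>a. ip R e (act R a \<xi>))) \<longlonglongrightarrow> l e"
    by metis
  define q where "q = (\<Sum>e\<in>U. cscale (l e) e)"
  show ?thesis
  proof (rule that[OF \<sigma>])
    show "q \<in> cvs.span U" unfolding q_def by (intro cvs.span_sum cvs.span_scale cvs.span_base)
    fix w assume w: "w \<in> vecs R"
    have "avg (A \<inter> T (s (\<sigma> k))) (\<lambda>a. ip R w (act R a (proj R U \<xi>)))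
        = (\<Sum>e\<in>U. ip R w e * avg (A \<inter> T (s (\<sigma> k))) (\<lambda>a. ip R e (act R a \<xi>)))" for k
    proof -
      have "ip R w (act R a (proj R U \<xi>)) = (\<Sum>e\<in>U. ip R w e * ip R e (act R a \<xi>))"
        if "a \<in> A \<inter> T (s (\<sigma> k))" for a
      proof -
        have "act R a (proj R U \<xi>) = proj R U (act R a \<xi>)"
          using R.proj_act[OF U AG[OF that] \<xi>(1)] by simp
        then show ?thesis
          unfolding proj_def using w UV by (simp add: R.s_sum_right R.s_scale_right mult.commute)
      qed
      then have "avg (A \<inter> T (s (\<sigma> k))) (\<lambda>a. ip R w (act R a (proj R U \<xi>)))
          = avg (A \<inter> T (s (\<sigma> k))) (\<lambda>a. \<Sum>e\<in>U. ip R w e * ip R e (act R a \<xi>))" by (rule avg_cong)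
      then show ?thesis by (simp only: avg_sum avg_mult_left)
    qed
    moreover have "(\<lambda>k. \<Sum>e\<in>U. ip R w e * avg (A \<inter> T (s (\<sigma> k))) (\<lambda>a. ip R e (act R a \<xi>)))
        \<longlonglongrightarrow> (\<Sum>e\<in>U. ip R w e * l e)"
      by (intro tendsto_sum tendsto_mult tendsto_const l)
    moreover have "(\<Sum>e\<in>U. ip R w e * l e) = ip R w q"
      unfolding q_def using w UV by (simp add: R.s_sum_right R.s_scale_right mult.commute)
    ultimately show "(\<lambda>k. avg (A \<inter> T (s (\<sigma> k))) (\<lambda>a. ip R w (act R a (proj R U \<xi>)))) \<longlonglongrightarrow> ip R w q"
      by simp
  qed
qed

theorem product_set_contains_bohr_set:
  assumes r: "0 \<le> r" "r < measure M B"
  defines "\<beta> \<equiv> measure M B"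
  obtains a S where "a \<in> A" "S \<subseteq> fd_dual G - {trivial_class G}" "finite S"
    "real (card S) \<le> (case min_nontrivial_dim G of
        enat d \<Rightarrow> 17 * (1 - \<alpha>\<^sup>2) / (real d * \<alpha>\<^sup>2 * (\<beta> - r)\<^sup>2) | \<infinity> \<Rightarrow> 0)"
    "a <# bohr_set G S ((\<beta> - r) / 2)
       \<subseteq> {\<gamma> \<in> carrier G. measure M (translates \<phi> A B \<inter> \<phi> \<gamma> ` B) > \<beta> * r}"
proof -
  have \<beta>: "0 < \<beta>" "\<beta> \<le> 1" "r < \<beta>" using B_pos r by (auto simp: \<beta>_def)
  define \<epsilon> where "\<epsilon> = (\<beta> - r) / 2"
  define \<eta> where "\<eta> = \<beta> * (\<beta> - r) / 16"
  have \<epsilon>: "\<epsilon> > 0" using \<beta> by (simp add: \<epsilon>_def)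
  have \<eta>: "\<eta> > 0" using \<beta> by (simp add: \<eta>_def)
  have \<eta>\<beta>: "\<eta> < \<beta>"
  proof -
    have "\<beta> * (\<beta> - r) \<le> \<beta> * 1" using \<beta> r by (intro mult_left_mono) auto
    then show ?thesis using \<beta> by (simp add: \<eta>_def)
  qed
  define D where "D n = (if n = 0 then B else space M)" for n :: nat
  have D: "D n \<in> sets M" for n using B_sets by (simp add: D_def)
  obtain R :: "'g rep" and \<zeta> where R: "unitary_rep G R" and \<zeta>: "\<And>n. \<zeta> n \<in> vecs R"
    and ipR: "\<And>x y n m. \<lbrakk>x \<in> carrier G; y \<in> carrier G\<rbrakk> \<Longrightarrow>
       ip R (act R x (\<zeta> n)) (act R y (\<zeta> m)) = of_real (measure M (\<phi> x ` D n \<inter> \<phi> y ` D m))"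
    by (rule rep_of_sets[of D, OF D]) blast
  interpret R: unitary_rep G R by (rule R)
  define \<xi> where "\<xi> = \<zeta> 0"
  define one where "one = \<zeta> 1"
  have \<xi>V: "\<xi> \<in> vecs R" and oV: "one \<in> vecs R" using \<zeta> by (simp_all add: \<xi>_def one_def)
  have BS: "B \<subseteq> space M" using B_sets by (rule sets.sets_into_space)
  have ip\<xi>: "ip R (act R g \<xi>) (act R h \<xi>) = of_real (measure M (\<phi> g ` B \<inter> \<phi> h ` B))"
    if "g \<in> carrier G" "h \<in> carrier G" for g h
    using ipR[OF that, of 0 0] by (simp add: \<xi>_def D_def)
  have ipo: "ip R one (act R h \<xi>) = of_real \<beta>" if h: "h \<in> carrier G" for h
  proof -
    have "\<phi> h ` B \<subseteq> space M" using image_sets[OF h B_sets] by (rule sets.sets_into_space)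
    then show ?thesis
      using ipR[OF one_closed h, of 1 0] oV h measure_image[OF h B_sets]
      by (simp add: \<xi>_def one_def D_def R.act_one image_one \<beta>_def Int_absorb1)
  qed
  have n\<xi>: "(hnorm R \<xi>)\<^sup>2 = \<beta>"
    using ip\<xi>[OF one_closed one_closed] \<xi>V by (simp add: R.nrm_sq R.act_one image_one BS \<beta>_def)
  then have \<xi>1: "hnorm R \<xi> \<le> 1"
    using \<beta>(2) power2_le_imp_le[of "hnorm R \<xi>" 1] by simp
  have no: "hnorm R one = 1"
    using ipR[OF one_closed one_closed, of 1 1] oV
    by (simp add: one_def D_def R.act_one image_one prob_space hnorm_def)
  obtain E where E: "invariant_frame G R E"
    and err': "\<And>\<sigma> w. \<lbrakk>strict_mono \<sigma>; w \<in> vecs R; hnorm R w \<le> 1\<rbrakk> \<Longrightarrow>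
       \<forall>\<^sub>F k in sequentially. cmod (avg (A \<inter> T (s (\<sigma> k))) (\<lambda>\<gamma>. ip R w (act R \<gamma> (\<xi> - proj R E \<xi>)))) < \<eta>"
    by (rule almost_periodic_part[OF R \<xi>V \<eta>]) blast
  note onE = R.frame_orthonormal[OF E]
  obtain \<E> where \<E>: "finite \<E>" "\<And>F. F \<in> \<E> \<Longrightarrow> irreducible_frame G R F" "disjoint \<E>"
    "orthonormal R (\<Union>\<E>)" "cvs.span (\<Union>\<E>) = cvs.span E"
    by (rule R.irreducible_decomposition[OF E]) blast
  define U where "U = \<Union>\<E>"
  have U: "invariant_frame G R U" using E \<E>(4,5) by (simp add: U_def invariant_frame_def)
  note onU = R.frame_orthonormal[OF U]
  have spanU: "v \<in> vecs R" if "v \<in> cvs.span U" for v using onU that by (rule R.orthonormal_span_vecs)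
  have projU: "proj R E \<xi> = proj R U \<xi>"
  proof (rule R.proj_unique[OF onE \<xi>V])
    show "proj R U \<xi> \<in> cvs.span E" using R.proj_span[of U \<xi>] \<E>(5) by (simp add: U_def)
    show "ip R e (\<xi> - proj R U \<xi>) = 0" if "e \<in> E" for e
      using cvs.span_base[OF that] \<E>(5) by (intro R.proj_orth[OF onU \<xi>V]) (simp add: U_def)
  qed
  define \<psi> where "\<psi> = proj R U \<xi>"
  have \<psi>V: "\<psi> \<in> vecs R" unfolding \<psi>_def by (rule R.proj_vecs[OF onU])
  obtain \<sigma> q where \<sigma>: "strict_mono (\<sigma> :: nat \<Rightarrow> nat)" and q: "q \<in> cvs.span U"
    and lim: "\<And>w. w \<in> vecs R \<Longrightarrow> (\<lambda>k. avg (A \<inter> T (s (\<sigma> k))) (\<lambda>a. ip R w (act R a \<psi>))) \<longlonglongrightarrow> ip R w q"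
    unfolding \<psi>_def by (rule limit_vector[OF R \<xi>V \<xi>1 U]) blast
  interpret D: dense_along G T A \<alpha> "s \<circ> \<sigma>" by (rule dense_along_subseq[OF \<sigma>])
  define P where "P k = A \<inter> T (s (\<sigma> k))" for k
  have P: "finite (P k)" "P k \<noteq> {}" "P k \<subseteq> A" for k using A_T_nonempty by (auto simp: P_def)
  have PG: "a \<in> carrier G" if "a \<in> P k" for a k using that P(3) A_carrier by auto
  have qV: "q \<in> vecs R" using q by (rule spanU)
  have err: "\<forall>\<^sub>F k in sequentially. cmod (avg (P k) (\<lambda>a. ip R w (act R a (\<xi> - \<psi>)))) < \<eta>"
    if "w \<in> vecs R" "hnorm R w \<le> 1" for w
    using err'[OF \<sigma> that] by (simp add: P_def \<psi>_def projU)
  have split: "avg (P k) (\<lambda>a. ip R w (act R a \<xi>))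
      = avg (P k) (\<lambda>a. ip R w (act R a \<psi>)) + avg (P k) (\<lambda>a. ip R w (act R a (\<xi> - \<psi>)))" if w: "w \<in> vecs R" for w k
    unfolding avg_add[symmetric]
  proof (rule avg_cong)
    fix a assume "a \<in> P k"
    then have a: "a \<in> carrier G" by (rule PG)
    show "ip R w (act R a \<xi>) = ip R w (act R a \<psi>) + ip R w (act R a (\<xi> - \<psi>))"
      using a w \<xi>V \<psi>V by (simp add: R.act_diff R.s_diff_right R.act_closed)
  qed
  have limP: "(\<lambda>k. avg (P k) (\<lambda>a. ip R w (act R a \<psi>))) \<longlonglongrightarrow> ip R w q" if "w \<in> vecs R" for w
    using lim[OF that] by (simp add: P_def)

  define f where "f \<gamma> = Re (ip R (act R \<gamma> \<xi>) q)" for \<gamma>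
  have lower: "f \<gamma> - \<eta> \<le> measure M (translates \<phi> A B \<inter> \<phi> \<gamma> ` B)" if \<gamma>: "\<gamma> \<in> carrier G" for \<gamma>
  proof -
    let ?m = "measure M (translates \<phi> A B \<inter> \<phi> \<gamma> ` B)"
    have w: "act R \<gamma> \<xi> \<in> vecs R" "hnorm R (act R \<gamma> \<xi>) \<le> 1" using \<gamma> \<xi>V \<xi>1 by (simp_all add: R.act_closed)
    have upper: "Re (avg (P k) (\<lambda>a. ip R (act R \<gamma> \<xi>) (act R a \<xi>))) \<le> ?m" for k
    proof (rule Re_avg_le[OF P(1,2)])
      fix a assume a: "a \<in> P k"
      have "measure M (\<phi> \<gamma> ` B \<inter> \<phi> a ` B) \<le> ?m"
        using translate_subset[of a] a P(3) translates_sets image_sets[OF \<gamma> B_sets]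
        by (intro finite_measure_mono) auto
      then show "Re (ip R (act R \<gamma> \<xi>) (act R a \<xi>)) \<le> ?m" using \<gamma> PG[OF a] by (simp add: ip\<xi>)
    qed
    have le: "Re (avg (P k) (\<lambda>a. ip R (act R \<gamma> \<xi>) (act R a \<psi>)))
        + Re (avg (P k) (\<lambda>a. ip R (act R \<gamma> \<xi>) (act R a (\<xi> - \<psi>)))) \<le> ?m" for k
      using upper[of k] by (simp only: split[OF w(1), of k] plus_complex.sel)
    have "\<forall>\<^sub>F k in sequentially. Re (avg (P k) (\<lambda>a. ip R (act R \<gamma> \<xi>) (act R a \<psi>))) \<le> ?m + \<eta>"
      using err[OF w]
    proof eventually_elim
      case (elim k)
      then show ?case
        using le[of k] abs_Re_le_cmod[of "avg (P k) (\<lambda>a. ip R (act R \<gamma> \<xi>) (act R a (\<xi> - \<psi>)))"] by linarith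
    qed
    then have "f \<gamma> \<le> ?m + \<eta>"
      unfolding f_def using tendsto_Re[OF limP[OF w(1)]] by (intro tendsto_upperbound) auto
    then show ?thesis by simp
  qed

  have q_norm: "\<beta> - \<eta> \<le> hnorm R q"
  proof -
    have const: "avg (P k) (\<lambda>a. ip R one (act R a \<xi>)) = of_real \<beta>" for k
    proof -
      have "avg (P k) (\<lambda>a. ip R one (act R a \<xi>)) = avg (P k) (\<lambda>_. of_real \<beta>)"
        by (rule avg_cong) (simp add: ipo PG)
      then show ?thesis using P by (simp add: avg_const)
    qed
    have eq: "of_real \<beta> = avg (P k) (\<lambda>a. ip R one (act R a \<psi>)) + avg (P k) (\<lambda>a. ip R one (act R a (\<xi> - \<psi>)))" for k
      by (simp only: split[OF oV, symmetric] const)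
    have "\<forall>\<^sub>F k in sequentially. \<beta> - \<eta> \<le> cmod (avg (P k) (\<lambda>a. ip R one (act R a \<psi>)))"
      using err[OF oV eq_refl[OF no]]
    proof eventually_elim
      case (elim k)
      have "cmod (of_real \<beta>) \<le> cmod (avg (P k) (\<lambda>a. ip R one (act R a \<psi>))) + cmod (avg (P k) (\<lambda>a. ip R one (act R a (\<xi> - \<psi>))))"
        unfolding eq[of k] by (rule norm_triangle_ineq)
      then show ?case using elim \<beta> by simp
    qed
    then have "\<beta> - \<eta> \<le> cmod (ip R one q)"
      using tendsto_norm[OF limP[OF oV]] by (intro tendsto_lowerbound) auto
    also have "\<dots> \<le> hnorm R one * hnorm R q" by (intro R.cauchy_schwarz oV qV)
    finally show ?thesis by (simp add: no)
  qed

  have ip_proj_q: "ip R q (act R a \<xi>) = ip R q (act R a \<psi>)" if a: "a \<in> carrier G" for a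
  proof -
    have "act R a \<psi> = proj R U (act R a \<xi>)" unfolding \<psi>_def using R.proj_act[OF U a \<xi>V] by simp
    then show ?thesis
      using R.proj_orth[OF onU R.act_closed[OF a \<xi>V] q] qV a \<xi>V R.proj_vecs[OF onU]
      by (simp add: R.s_diff_right R.act_closed)
  qed
  obtain a where a: "a \<in> A" "(hnorm R q)\<^sup>2 - \<eta> \<le> f a"
  proof -
    have "(\<lambda>k. Re (avg (P k) (\<lambda>a. ip R q (act R a \<psi>)))) \<longlonglongrightarrow> (hnorm R q)\<^sup>2"
      using tendsto_Re[OF limP[OF qV]] by (simp add: R.nrm_sq[OF qV])
    moreover have "(hnorm R q)\<^sup>2 - \<eta> < (hnorm R q)\<^sup>2" using \<eta> by simp
    ultimately have "\<forall>\<^sub>F k in sequentially. (hnorm R q)\<^sup>2 - \<eta> < Re (avg (P k) (\<lambda>a. ip R q (act R a \<psi>)))"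
      by (rule order_tendstoD(1))
    then obtain k where k: "(hnorm R q)\<^sup>2 - \<eta> < Re (avg (P k) (\<lambda>a. ip R q (act R a \<psi>)))"
      using eventually_happens'[OF sequentially_bot] by blast
    have "\<exists>a\<in>P k. (hnorm R q)\<^sup>2 - \<eta> < Re (ip R q (act R a \<psi>))"
    proof (rule ccontr)
      assume "\<not> ?thesis"
      then have "Re (avg (P k) (\<lambda>a. ip R q (act R a \<psi>))) \<le> (hnorm R q)\<^sup>2 - \<eta>"
        using P by (intro Re_avg_le) (auto simp: not_less)
      then show False using k by simp
    qed
    then obtain a where a: "a \<in> P k" "(hnorm R q)\<^sup>2 - \<eta> < Re (ip R q (act R a \<psi>))" by blast
    have "Re (ip R q (act R a \<psi>)) = f a"
      using ip_proj_q[OF PG[OF a(1)]] R.ip_cnj[OF qV R.act_closed[OF PG[OF a(1)] \<xi>V]] by (simp add: f_def)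
    then show ?thesis using that[of a] a P(3) by auto
  qed
  have aG: "a \<in> carrier G" using a A_carrier by auto

  define x where "x F = proj R F \<xi>" for F
  define y where "y F = proj R F q" for F
  have fr: "invariant_frame G R F" "orthonormal R F" if "F \<in> \<E>" for F
    using R.irreducible_frame_invariant[OF \<E>(2)[OF that]] R.frame_orthonormal by auto
  have FU: "cvs.span F \<subseteq> cvs.span U" if "F \<in> \<E>" for F
    unfolding U_def using that by (intro cvs.span_mono) auto
  have xy: "x F \<in> cvs.span F" "y F \<in> cvs.span F" "x F \<in> vecs R" "y F \<in> vecs R" if "F \<in> \<E>" for F
    using R.proj_span R.proj_vecs[OF fr(2)[OF that]] by (simp_all add: x_def y_def)
  have ip_F: "ip R v (act R g (x F)) = ip R v (act R g \<xi>)"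
    if F: "F \<in> \<E>" and g: "g \<in> carrier G" and v: "v \<in> cvs.span F" for F g v
  proof -
    have "act R g (x F) = proj R F (act R g \<xi>)" unfolding x_def using R.proj_act[OF fr(1)[OF F] g \<xi>V] by simp
    then show ?thesis
      using R.proj_orth[OF fr(2)[OF F] R.act_closed[OF g \<xi>V] v] R.orthonormal_span_vecs[OF fr(2)[OF F] v]
        g \<xi>V R.proj_vecs[OF fr(2)[OF F]]
      by (simp add: R.s_diff_right R.act_closed)
  qed
  have limF: "(\<lambda>k. avg (A \<inter> T ((s \<circ> \<sigma>) k)) (\<lambda>a. ip R (y F) (act R a (x F)))) \<longlonglongrightarrow> of_real ((hnorm R (y F))\<^sup>2)"
    if F: "F \<in> \<E>" for F
  proof -
    have "ip R (y F) (act R a (x F)) = ip R (y F) (act R a \<psi>)" if a: "a \<in> carrier G" for a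
    proof -
      have "act R a \<psi> = proj R U (act R a \<xi>)" unfolding \<psi>_def using R.proj_act[OF U a \<xi>V] by simp
      moreover have "y F \<in> cvs.span U" using xy(2)[OF F] FU[OF F] by blast
      ultimately show ?thesis
        using R.proj_orth[OF onU R.act_closed[OF a \<xi>V], of "y F"] xy(4)[OF F] a \<xi>V R.proj_vecs[OF onU]
          ip_F[OF F a xy(2)[OF F]]
        by (simp add: R.s_diff_right R.act_closed)
    qed
    then have "avg (A \<inter> T ((s \<circ> \<sigma>) k)) (\<lambda>a. ip R (y F) (act R a (x F))) = avg (P k) (\<lambda>a. ip R (y F) (act R a \<psi>))" for k
      unfolding P_def o_def by (intro avg_cong) (use A_carrier in auto)
    moreover have "ip R (y F) q = of_real ((hnorm R (y F))\<^sup>2)"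
    proof -
      have "ip R (y F) q = ip R (y F) (y F)"
        using R.proj_orth[OF fr(2)[OF F] qV xy(2)[OF F]] xy(4)[OF F] qV by (simp add: y_def R.s_diff_right)
      then show ?thesis using R.s_self_nrm[OF xy(4)[OF F]] by simp
    qed
    ultimately show ?thesis using limP[OF xy(4)[OF F]] by simp
  qed
  have yx: "hnorm R (y F) \<le> hnorm R (x F)" if F: "F \<in> \<E>" for F
  proof (cases "y F = 0")
    case False
    have pos: "hnorm R (y F) > 0"
      using False R.hnorm_eq_0[OF xy(4)[OF F]] R.nrm_nonneg[OF xy(4)[OF F]] by linarith
    have "cmod (of_real ((hnorm R (y F))\<^sup>2)) \<le> hnorm R (y F) * hnorm R (x F)"
    proof (rule tendsto_upperbound[OF tendsto_norm[OF limF[OF F]]])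
      have "cmod (avg (A \<inter> T ((s \<circ> \<sigma>) k)) (\<lambda>a. ip R (y F) (act R a (x F)))) \<le> hnorm R (y F) * hnorm R (x F)" for k
      proof (rule cmod_avg_le)
        fix a assume "a \<in> A \<inter> T ((s \<circ> \<sigma>) k)"
        then have "a \<in> carrier G" using A_carrier by auto
        then show "cmod (ip R (y F) (act R a (x F))) \<le> hnorm R (y F) * hnorm R (x F)"
          using R.cauchy_schwarz[OF xy(4)[OF F] R.act_closed[OF _ xy(3)[OF F]], of a] xy(3)[OF F] by simp
      qed (use xy[OF F] in simp)
      then show "\<forall>\<^sub>F k in sequentially. cmod (avg (A \<inter> T ((s \<circ> \<sigma>) k)) (\<lambda>a. ip R (y F) (act R a (x F)))) \<le> hnorm R (y F) * hnorm R (x F)"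
        by (intro always_eventually allI)
    qed simp
    then have "hnorm R (y F) * hnorm R (y F) \<le> hnorm R (y F) * hnorm R (x F)"
      by (simp add: power2_eq_square norm_mult)
    then show ?thesis using pos by simp
  qed (use xy[OF F] in simp)

  define K where "K = {F \<in> \<E>. nontrivial_rep G (subrep R F) \<and> \<epsilon> / 2 * hnorm R (x F) < hnorm R (y F)}"
  define cls where "cls F = unitary_equiv_rel G `` {subrep R F}" for F
  define S where "S = cls ` K"
  have K\<E>: "K \<subseteq> \<E>" by (auto simp: K_def)
  have fK: "finite K" using \<E>(1) K\<E> by (rule finite_subset[rotated])

  have S_dual: "S \<subseteq> fd_dual G - {trivial_class G}"
  proof
    fix \<tau> assume "\<tau> \<in> S"
    then obtain F where F: "F \<in> K" "\<tau> = cls F" by (auto simp: S_def)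
    have irr: "subrep R F \<in> fd_irreps G"
      using irreducible_frame_fd_irreps[OF R \<E>(2)] F(1) K\<E> by blast
    then have "\<tau> \<in> fd_dual G" unfolding F(2) cls_def fd_dual_def by (rule quotientI)
    moreover have "\<tau> \<noteq> trivial_class G"
      unfolding F(2) cls_def using F(1) by (intro nontrivial_class[OF irr]) (simp add: K_def)
    ultimately show "\<tau> \<in> fd_dual G - {trivial_class G}" by simp
  qed

  have min_le: "min_nontrivial_dim G \<le> enat (card F)" if F: "F \<in> K" for F
  proof -
    have F\<E>: "F \<in> \<E>" using F K\<E> by blast
    have "min_nontrivial_dim G \<le> hdim (subrep R F)"
      unfolding min_nontrivial_dim_def using R.unitary_rep_subrep[OF fr(1)[OF F\<E>]] F
      by (intro Inf_lower) (auto simp: K_def)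
    then show ?thesis using R.hdim_subrep[OF fr(1)[OF F\<E>]] by simp
  qed
  have S_card: "real (card S) \<le> (case min_nontrivial_dim G of
        enat d \<Rightarrow> 17 * (1 - \<alpha>\<^sup>2) / (real d * \<alpha>\<^sup>2 * (\<beta> - r)\<^sup>2) | \<infinity> \<Rightarrow> 0)"
  proof (cases "min_nontrivial_dim G")
    case (enat d)
    have d: "d > 0" using enat by (rule min_nontrivial_dim_pos)
    have "real (card S) * (real d * \<alpha>\<^sup>2 * (\<epsilon> / 2)\<^sup>2) \<le> \<alpha> - \<alpha>\<^sup>2"
      unfolding S_def cls_def
    proof (rule D.class_count[OF R fK])
      show "(\<lambda>k. avg (A \<inter> T ((s \<circ> \<sigma>) k)) (\<lambda>a. ip R (y F) (act R a (x F)))) \<longlonglongrightarrow> complex_of_real ((hnorm R (y F))\<^sup>2)"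
        if "F \<in> K" for F using that K\<E> by (intro limF) blast
      show "d \<le> card F" if "F \<in> K" for F using min_le[OF that] enat by simp
    qed (use d \<epsilon> xy \<E>(2) in \<open>auto simp: K_def\<close>)
    also have "\<alpha> - \<alpha>\<^sup>2 \<le> 1 - \<alpha>\<^sup>2" using alpha_le_1 by simp
    also have "real d * \<alpha>\<^sup>2 * (\<epsilon> / 2)\<^sup>2 = real d * \<alpha>\<^sup>2 * (\<beta> - r)\<^sup>2 / 16"
      by (simp add: \<epsilon>_def power_divide)
    finally have "real (card S) * (real d * \<alpha>\<^sup>2 * (\<beta> - r)\<^sup>2) \<le> 16 * (1 - \<alpha>\<^sup>2)" by simp
    also have "\<dots> \<le> 17 * (1 - \<alpha>\<^sup>2)"
      using alpha_le_1 alpha_pos by (intro mult_right_mono) (auto simp: power_le_one)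
    finally show ?thesis
      using d alpha_pos \<beta> enat by (simp add: pos_le_divide_eq)
  next
    case infinity
    then have "K = {}" using min_le by force
    then show ?thesis using infinity by (simp add: S_def)
  qed

  have osc: "f a - \<epsilon> * \<beta> \<le> f (a \<otimes> u)" if u: "u \<in> bohr_set G S \<epsilon>" for u
  proof -
    have uG: "u \<in> carrier G" using u by (simp add: bohr_set_def)
    define z where "z = act R (inv a) q"
    have zU: "z \<in> cvs.span U" unfolding z_def by (rule R.frame_act[OF U inv_closed[OF aG] q])
    have zV: "z \<in> vecs R" using zU by (rule spanU)
    define v where "v = act R u \<xi> - \<xi>"
    have vV: "v \<in> vecs R" using uG \<xi>V by (simp add: v_def R.act_closed)
    have term_le: "cmod (ip R v (proj R F z)) \<le> \<epsilon> * (hnorm R (x F))\<^sup>2" if F: "F \<in> \<E>" for F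
    proof -
      have pz: "proj R F z = act R (inv a) (y F)"
        unfolding z_def y_def by (rule R.proj_act[OF fr(1)[OF F] inv_closed[OF aG] qV])
      have pzV: "proj R F z \<in> vecs R" by (rule R.proj_vecs[OF fr(2)[OF F]])
      have nz: "hnorm R (proj R F z) = hnorm R (y F)" unfolding pz using aG xy[OF F] by simp
      have pv: "proj R F v = act R u (x F) - x F"
      proof (rule R.proj_unique[OF fr(2)[OF F] vV])
        show "act R u (x F) - x F \<in> cvs.span F"
          using R.frame_act[OF fr(1)[OF F] uG] xy[OF F] by (intro cvs.span_diff)
        fix e assume e: "e \<in> F"
        have eV: "e \<in> vecs R" using fr(2)[OF F] e by (rule R.orthonormal_vecs)
        have "ip R e (x F) = ip R e \<xi>" unfolding x_def using fr(2)[OF F] e by (rule R.ip_proj)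
        then show "ip R e (v - (act R u (x F) - x F)) = 0"
          using ip_F[OF F uG cvs.span_base[OF e]] eV uG \<xi>V xy[OF F]
          by (simp add: v_def R.s_diff_right R.act_closed)
      qed
      have "ip R (proj R F z) v = ip R (proj R F z) (proj R F v)"
        using R.proj_orth[OF fr(2)[OF F] vV R.proj_span] pzV vV R.proj_vecs[OF fr(2)[OF F]]
        by (simp add: R.s_diff_right)
      then have "cmod (ip R v (proj R F z)) = cmod (ip R (proj R F z) (proj R F v))"
        using R.ip_cnj[OF pzV vV] by simp
      also have "\<dots> \<le> hnorm R (y F) * hnorm R (act R u (x F) - x F)"
        using R.cauchy_schwarz[OF pzV R.proj_vecs[OF fr(2)[OF F], of v]] by (simp only: nz pv)
      also have "\<dots> \<le> \<epsilon> * (hnorm R (x F))\<^sup>2"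
      proof (cases "nontrivial_rep G (subrep R F)")
        case False
        then have "act R u (x F) = x F" using uG xy[OF F] by (auto simp: nontrivial_rep_def)
        then show ?thesis using \<epsilon> by simp
      next
        case nt: True
        show ?thesis
        proof (cases "F \<in> K")
          case True
          interpret S: unitary_rep G "subrep R F" by (rule R.unitary_rep_subrep[OF fr(1)[OF F]])
          have "subrep R F \<in> cls F"
            using irreducible_frame_fd_irreps[OF R \<E>(2)[OF F]]
            by (simp add: cls_def unitary_equiv_rel_def unitarily_equivalent_refl)
          then have "rep_seminorm (subrep R F) u < \<epsilon>"
            using u True by (auto simp: bohr_set_def S_def)
          then have "hnorm R (act R u (x F) - x F) \<le> \<epsilon> * hnorm R (x F)"
            using S.rep_seminorm_bound[OF uG, of "x F"] xy[OF F]
              mult_right_mono[of "rep_seminorm (subrep R F) u" \<epsilon> "hnorm R (x F)"] by simp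
          then have "hnorm R (y F) * hnorm R (act R u (x F) - x F) \<le> hnorm R (x F) * (\<epsilon> * hnorm R (x F))"
            using yx[OF F] xy[OF F] uG by (intro mult_mono) (auto simp: R.act_closed)
          then show ?thesis by (simp add: power2_eq_square mult_ac)
        next
          case False
          then have small: "hnorm R (y F) \<le> \<epsilon> / 2 * hnorm R (x F)" using F nt by (auto simp: K_def)
          have "hnorm R (act R u (x F) - x F) \<le> hnorm R (act R u (x F) - 0) + hnorm R (0 - x F)"
            using uG xy[OF F] by (intro R.nrm_triangle3) (auto simp: R.act_closed)
          also have "\<dots> = 2 * hnorm R (x F)"
            using uG xy[OF F] R.nrm_minus_commute[of 0 "x F"] by simp
          finally have "hnorm R (y F) * hnorm R (act R u (x F) - x F) \<le> (\<epsilon> / 2 * hnorm R (x F)) * (2 * hnorm R (x F))"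
            using small \<epsilon> xy[OF F] uG by (intro mult_mono) (auto simp: R.act_closed)
          then show ?thesis by (simp add: power2_eq_square mult_ac)
        qed
      qed
      finally show ?thesis .
    qed
    have sumF: "sum h U = (\<Sum>F\<in>\<E>. sum h F)" for h :: "('g \<times> nat \<Rightarrow> complex) \<Rightarrow> real"
      unfolding U_def using \<E>(1,3) fr(2) R.orthonormal_finite
      by (subst sum.Union_disjoint) (auto simp: disjoint_def)
    have "z = proj R U z" using R.proj_id[OF onU zU] by simp
    also have "\<dots> = (\<Sum>F\<in>\<E>. proj R F z)"
      unfolding proj_def U_def using \<E>(1,3) fr(2) R.orthonormal_finite
      by (subst sum.Union_disjoint) (auto simp: disjoint_def)
    finally have zsum: "z = (\<Sum>F\<in>\<E>. proj R F z)" .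
    have "ip R v z = ip R v (\<Sum>F\<in>\<E>. proj R F z)" using zsum by (rule arg_cong)
    also have "\<dots> = (\<Sum>F\<in>\<E>. ip R v (proj R F z))"
      using R.proj_vecs[OF fr(2)] by (intro R.s_sum_right vV) auto
    finally have "cmod (ip R v z) \<le> (\<Sum>F\<in>\<E>. \<epsilon> * (hnorm R (x F))\<^sup>2)"
      using term_le by (auto intro!: sum_norm_le)
    also have "\<dots> = \<epsilon> * (\<Sum>e\<in>U. (cmod (ip R e \<xi>))\<^sup>2)"
      unfolding sumF sum_distrib_left[symmetric]
      by (intro arg_cong[of _ _ "\<lambda>t. \<epsilon> * t"] sum.cong refl) (simp add: x_def R.hnorm_proj_sq fr)
    also have "\<dots> \<le> \<epsilon> * \<beta>"
      using R.bessel[OF onU \<xi>V] \<epsilon> n\<xi> by (intro mult_left_mono) auto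
    finally have bound: "cmod (ip R v z) \<le> \<epsilon> * \<beta>" .
    have "ip R (act R (a \<otimes> u) \<xi>) q - ip R (act R a \<xi>) q = ip R v z"
      using aG uG \<xi>V qV
      by (simp add: v_def z_def R.act_mult R.ip_act_left[of a] R.act_closed R.s_diff_left)
    then have "f (a \<otimes> u) - f a = Re (ip R v z)" by (simp add: f_def minus_complex.sel(1)[symmetric] del: minus_complex.sel)
    then show ?thesis using bound abs_Re_le_cmod[of "ip R v z"] by linarith
  qed

  show ?thesis
  proof (rule that[OF a(1) S_dual _ S_card])
    show "finite S" using fK by (simp add: S_def)
    show "a <# bohr_set G S ((\<beta> - r) / 2) \<subseteq> {\<gamma> \<in> carrier G. measure M (translates \<phi> A B \<inter> \<phi> \<gamma> ` B) > \<beta> * r}"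
    proof
      fix \<gamma> assume "\<gamma> \<in> a <# bohr_set G S ((\<beta> - r) / 2)"
      then obtain u where u: "u \<in> bohr_set G S \<epsilon>" "\<gamma> = a \<otimes> u" by (auto simp: l_coset_def \<epsilon>_def)
      have \<gamma>: "\<gamma> \<in> carrier G" using u aG by (simp add: bohr_set_def)
      have "(\<beta> - \<eta>)\<^sup>2 \<le> (hnorm R q)\<^sup>2" using q_norm \<eta>\<beta> by (intro power_mono) auto
      then have "(\<beta> - \<eta>)\<^sup>2 - \<eta> - \<epsilon> * \<beta> - \<eta> \<le> measure M (translates \<phi> A B \<inter> \<phi> \<gamma> ` B)"
        using a(2) osc[OF u(1)] lower[OF \<gamma>] u(2) by simp
      moreover have "\<beta> * r < (\<beta> - \<eta>)\<^sup>2 - \<eta> - \<epsilon> * \<beta> - \<eta>"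
      proof -
        have "\<beta> * \<eta> \<le> 1 * \<eta>" using \<beta> \<eta> by (intro mult_right_mono) auto
        moreover have "(\<beta> - \<eta>)\<^sup>2 = \<beta> * \<beta> - 2 * (\<beta> * \<eta>) + \<eta>\<^sup>2" by (simp add: power2_eq_square algebra_simps)
        moreover have "\<beta> * \<beta> - \<beta> * r = 16 * \<eta>" by (simp add: \<eta>_def algebra_simps)
        moreover have "\<epsilon> * \<beta> = 8 * \<eta>" by (simp add: \<epsilon>_def \<eta>_def)
        ultimately show ?thesis using \<eta> zero_le_power2[of \<eta>] by linarith
      qed
      ultimately show "\<gamma> \<in> {\<gamma> \<in> carrier G. measure M (translates \<phi> A B \<inter> \<phi> \<gamma> ` B) > \<beta> * r}"
        using \<gamma> by simp
    qed
  qed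
qed

end

context product_set
begin

lemma UN_translates_full:
  assumes erg: "ergodic_action G M \<phi>"
  shows "(\<Union>g\<in>carrier G. \<phi> g ` B) \<in> sets M" "measure M (\<Union>g\<in>carrier G. \<phi> g ` B) = 1"
proof -
  let ?E = "\<Union>g\<in>carrier G. \<phi> g ` B"
  have BS: "B \<subseteq> space M" using B_sets by (rule sets.sets_into_space)
  show E: "?E \<in> sets M"
    using countable_carrier B_sets by (intro sets.countable_UN') (auto intro: image_sets)
  have "\<phi> g ` ?E = ?E" if g: "g \<in> carrier G" for g
  proof
    show "\<phi> g ` ?E \<subseteq> ?E"
    proof
      fix y assume "y \<in> \<phi> g ` ?E"
      then obtain h where h: "h \<in> carrier G" "y \<in> \<phi> g ` \<phi> h ` B" by blast
      then have "y \<in> \<phi> (g \<otimes> h) ` B" using image_mult[OF g h(1) BS] by simp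
      then show "y \<in> ?E" using g h by blast
    qed
    show "?E \<subseteq> \<phi> g ` ?E"
    proof
      fix y assume "y \<in> ?E"
      then obtain h where h: "h \<in> carrier G" "y \<in> \<phi> h ` B" by blast
      have k: "inv g \<otimes> h \<in> carrier G" using g h by simp
      have "g \<otimes> (inv g \<otimes> h) = h" using g h by (simp add: m_assoc[symmetric])
      then have "y \<in> \<phi> g ` \<phi> (inv g \<otimes> h) ` B" using image_mult[OF g k BS] h by simp
      then show "y \<in> \<phi> g ` ?E" using k by blast
    qed
  qed
  then have "measure M ?E = 0 \<or> measure M ?E = 1"
    using erg E by (simp add: ergodic_action_def)
  moreover have "measure M B \<le> measure M ?E"
    using E image_one[OF BS] by (intro finite_measure_mono) auto
  ultimately show "measure M ?E = 1" using B_pos by linarith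
qed

lemma ex_translate_meets:
  assumes erg: "ergodic_action G M \<phi>" and C: "C \<in> sets M" "measure M C > 0"
  obtains g where "g \<in> carrier G" "measure M (C \<inter> \<phi> g ` B) > 0"
proof (rule ccontr)
  assume "\<not> thesis"
  then have "measure M (C \<inter> \<phi> g ` B) = 0" if "g \<in> carrier G" for g
    using that \<open>\<not> thesis\<close> measure_nonneg[of M "C \<inter> \<phi> g ` B"] \<open>\<And>g. \<lbrakk>g \<in> carrier G; 0 < measure M (C \<inter> \<phi> g ` B)\<rbrakk> \<Longrightarrow> thesis\<close>
    by (metis less_eq_real_def)
  then have "C \<inter> \<phi> g ` B \<in> null_sets M" if "g \<in> carrier G" for g
    using that C image_sets[OF that B_sets] by (auto simp: null_sets_def emeasure_eq_measure)
  then have "(\<Union>g\<in>carrier G. C \<inter> \<phi> g ` B) \<in> null_sets M"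
    using countable_carrier by (intro null_sets_UN') auto
  then have 0: "measure M (C \<inter> (\<Union>g\<in>carrier G. \<phi> g ` B)) = 0"
    by (auto simp: null_sets_def measure_def)
  note E = UN_translates_full[OF erg]
  have "measure M C = measure M (C \<inter> (\<Union>g\<in>carrier G. \<phi> g ` B)) + measure M (C - (\<Union>g\<in>carrier G. \<phi> g ` B))"
    using C(1) E(1) by (subst finite_measure_Union[symmetric]) (auto intro!: arg_cong[of _ _ "measure M"])
  moreover have "measure M (C - (\<Union>g\<in>carrier G. \<phi> g ` B)) \<le> measure M (space M - (\<Union>g\<in>carrier G. \<phi> g ` B))"
    using C(1) E(1) sets.sets_into_space[OF C(1)] by (intro finite_measure_mono) auto
  moreover have "measure M (space M - (\<Union>g\<in>carrier G. \<phi> g ` B)) = 0"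
    using prob_compl[OF E(1)] E(2) by simp
  ultimately show False using 0 C(2) by simp
qed

lemma mean_vanishes:
  fixes R :: "'g rep"
  assumes R: "unitary_rep G R" and \<xi>: "\<xi> \<in> vecs R" "hnorm R \<xi> \<le> 1" and c: "c \<in> vecs R" "hnorm R c \<le> 1"
    and zero: "\<And>a. a \<in> A \<Longrightarrow> ip R c (act R a \<xi>) = 0"
    and lim: "(\<lambda>n. avg (T n) (\<lambda>\<gamma>. ip R c (act R \<gamma> \<xi>))) \<longlonglongrightarrow> L"
    and cond: "min_nontrivial_dim G = \<infinity> \<or> \<alpha> = 1"
  shows "L = 0"
proof -
  interpret R: unitary_rep G R by (rule R)
  have lim_s: "(\<lambda>k. avg (T (s k)) (\<lambda>\<gamma>. ip R c (act R \<gamma> \<xi>))) \<longlonglongrightarrow> L" by (rule tendsto_s[OF lim])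
  show ?thesis
    using cond
  proof
    assume 1: "\<alpha> = 1"
    have bound: "cmod (avg (T (s k)) (\<lambda>\<gamma>. ip R c (act R \<gamma> \<xi>))) \<le> 1 - ratio k" for k
    proof -
      have le: "cmod (ip R c (act R \<gamma> \<xi>)) \<le> 1 - of_bool (\<gamma> \<in> A)" if "\<gamma> \<in> T (s k)" for \<gamma>
      proof (cases "\<gamma> \<in> A")
        case False
        have g: "\<gamma> \<in> carrier G" using that by (rule T_carrier)
        have "cmod (ip R c (act R \<gamma> \<xi>)) \<le> hnorm R c * hnorm R (act R \<gamma> \<xi>)"
          by (intro R.cauchy_schwarz c R.act_closed g \<xi>)
        also have "\<dots> \<le> 1 * 1" using c \<xi> g by (intro mult_mono) auto
        finally show ?thesis using False by simp
      qed (simp add: zero)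
      have "cmod (avg (T (s k)) (\<lambda>\<gamma>. ip R c (act R \<gamma> \<xi>)))
          \<le> (\<Sum>\<gamma>\<in>T (s k). cmod (ip R c (act R \<gamma> \<xi>))) / real (card (T (s k)))"
        by (simp add: avg_def norm_divide divide_right_mono norm_sum)
      also have "\<dots> \<le> (\<Sum>\<gamma>\<in>T (s k). 1 - of_bool (\<gamma> \<in> A)) / real (card (T (s k)))"
        by (intro divide_right_mono sum_mono le) auto
      also have "\<dots> = Re (avg (T (s k)) (\<lambda>\<gamma>. 1 - of_bool (\<gamma> \<in> A) * 1))"
      proof -
        have "Re (of_bool b) = of_bool b" for b by (cases b) auto
        then show ?thesis by (simp add: Re_avg)
      qed
      also have "\<dots> = 1 - ratio k"
        unfolding avg_diff avg_restrict using T_nonempty[of k] A_T_nonempty[of k] by (simp add: avg_const)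
      finally show ?thesis .
    qed
    have vanish: "(\<lambda>k. 1 - ratio k) \<longlonglongrightarrow> 0"
      using tendsto_diff[OF tendsto_const[of 1] ratio_tendsto] 1 by simp
    have "(\<lambda>k. avg (T (s k)) (\<lambda>\<gamma>. ip R c (act R \<gamma> \<xi>))) \<longlonglongrightarrow> 0"
    proof (rule Lim_null_comparison[OF _ vanish])
      show "\<forall>\<^sub>F k in sequentially. cmod (avg (T (s k)) (\<lambda>\<gamma>. ip R c (act R \<gamma> \<xi>))) \<le> 1 - ratio k"
        using bound by (intro always_eventually allI)
    qed
    with lim_s show "L = 0" by (rule LIMSEQ_unique)
  next
    assume inf: "min_nontrivial_dim G = \<infinity>"
    have "cmod L \<le> 2 * \<eta>" if \<eta>: "\<eta> > 0" for \<eta>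
    proof -
      obtain U where U: "invariant_frame G R U"
        and errA: "\<And>\<sigma> w. \<lbrakk>strict_mono \<sigma>; w \<in> vecs R; hnorm R w \<le> 1\<rbrakk> \<Longrightarrow>
           \<forall>\<^sub>F k in sequentially. cmod (avg (A \<inter> T (s (\<sigma> k))) (\<lambda>\<gamma>. ip R w (act R \<gamma> (\<xi> - proj R U \<xi>)))) < \<eta>"
        and errT: "\<And>w. \<lbrakk>w \<in> vecs R; hnorm R w \<le> 1\<rbrakk> \<Longrightarrow>
           \<forall>\<^sub>F n in sequentially. cmod (avg (T n) (\<lambda>\<gamma>. ip R w (act R \<gamma> (\<xi> - proj R U \<xi>)))) < \<eta>"
        by (rule almost_periodic_part[OF R \<xi>(1) \<eta>]) blast
      define \<psi> where "\<psi> = proj R U \<xi>"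
      have \<psi>U: "\<psi> \<in> cvs.span U" unfolding \<psi>_def by (rule R.proj_span)
      have \<psi>V: "\<psi> \<in> vecs R" unfolding \<psi>_def by (rule R.proj_vecs[OF R.frame_orthonormal[OF U]])
      have "\<not> nontrivial_rep G (subrep R U)"
      proof
        assume "nontrivial_rep G (subrep R U)"
        then have "min_nontrivial_dim G \<le> hdim (subrep R U)"
          unfolding min_nontrivial_dim_def using R.unitary_rep_subrep[OF U] by (intro Inf_lower) auto
        then show False using inf R.hdim_subrep[OF U] by simp
      qed
      then have inv: "act R g \<psi> = \<psi>" if "g \<in> carrier G" for g
        using that \<psi>U by (auto simp: nontrivial_rep_def)
      have split: "avg X (\<lambda>\<gamma>. ip R c (act R \<gamma> \<xi>)) = ip R c \<psi> + avg X (\<lambda>\<gamma>. ip R c (act R \<gamma> (\<xi> - \<psi>)))"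
        if X: "finite X" "X \<noteq> {}" "X \<subseteq> carrier G" for X
      proof -
        have "avg X (\<lambda>\<gamma>. ip R c (act R \<gamma> \<xi>)) = avg X (\<lambda>\<gamma>. ip R c \<psi> + ip R c (act R \<gamma> (\<xi> - \<psi>)))"
        proof (rule avg_cong)
          fix \<gamma> assume "\<gamma> \<in> X"
          then have g: "\<gamma> \<in> carrier G" using X by blast
          show "ip R c (act R \<gamma> \<xi>) = ip R c \<psi> + ip R c (act R \<gamma> (\<xi> - \<psi>))"
            using g c \<xi> \<psi>V by (simp add: R.act_diff R.s_diff_right R.act_closed inv)
        qed
        then show ?thesis by (simp only: avg_add avg_const[OF X(1,2)])
      qed
      have "\<forall>\<^sub>F k in sequentially. cmod (ip R c \<psi>) < \<eta>"
        using errA[OF strict_mono_id c]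
      proof eventually_elim
        case (elim k)
        have "avg (A \<inter> T (s k)) (\<lambda>\<gamma>. ip R c (act R \<gamma> \<xi>)) = avg (A \<inter> T (s k)) (\<lambda>_. 0)"
          by (rule avg_cong) (simp add: zero)
        then have "0 = ip R c \<psi> + avg (A \<inter> T (s k)) (\<lambda>\<gamma>. ip R c (act R \<gamma> (\<xi> - \<psi>)))"
          using split[of "A \<inter> T (s k)"] A_T_nonempty[of k] A_carrier by (simp add: avg_def le_infI1)
        then have "ip R c \<psi> = - avg (A \<inter> T (s k)) (\<lambda>\<gamma>. ip R c (act R \<gamma> (\<xi> - \<psi>)))"
          by (simp only: eq_neg_iff_add_eq_0)
        then have "cmod (ip R c \<psi>) = cmod (avg (A \<inter> T (s k)) (\<lambda>\<gamma>. ip R c (act R \<gamma> (\<xi> - \<psi>))))"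
          by (simp only: norm_minus_cancel)
        then show ?case using elim by (simp add: \<psi>_def)
      qed
      then have c\<psi>: "cmod (ip R c \<psi>) < \<eta>" by (auto dest: eventually_happens)
      have "\<forall>\<^sub>F k in sequentially. cmod (avg (T (s k)) (\<lambda>\<gamma>. ip R c (act R \<gamma> (\<xi> - \<psi>)))) < \<eta>"
        using eventually_compose_filterlim[OF errT[OF c] filterlim_subseq[OF s_mono]] by (simp add: \<psi>_def)
      then have "\<forall>\<^sub>F k in sequentially. cmod (avg (T (s k)) (\<lambda>\<gamma>. ip R c (act R \<gamma> \<xi>))) \<le> 2 * \<eta>"
      proof eventually_elim
        case (elim k)
        have "T (s k) \<subseteq> carrier G" using T_carrier by blast
        then have "cmod (avg (T (s k)) (\<lambda>\<gamma>. ip R c (act R \<gamma> \<xi>)))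
            = cmod (ip R c \<psi> + avg (T (s k)) (\<lambda>\<gamma>. ip R c (act R \<gamma> (\<xi> - \<psi>))))"
          using split[of "T (s k)"] T_nonempty[of k] by simp
        also have "\<dots> \<le> cmod (ip R c \<psi>) + cmod (avg (T (s k)) (\<lambda>\<gamma>. ip R c (act R \<gamma> (\<xi> - \<psi>))))"
          by (rule norm_triangle_ineq)
        finally show ?case using elim c\<psi> by linarith
      qed
      then show ?thesis by (intro tendsto_upperbound[OF tendsto_norm[OF lim_s]]) auto
    qed
    from this[of "cmod L / 4"] show "L = 0" by (cases "L = 0") auto
  qed
qed

text \<open>
  If the complement \<open>C\<close> of the product set had positive measure, some translate of \<open>C\<close> would meet \<open>B\<close>
  in a set \<open>D\<close> of positive measure. The mean of \<open>\<nu>(\<gamma>D \<inter> D)\<close> is at least \<open>\<nu>(D)\<^sup>2\<close>, but it is dominated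
  by the mean of \<open>\<nu>(\<gamma>B \<inter> C)\<close>, which vanishes.
\<close>

theorem product_set_full_measure:
  assumes erg: "ergodic_action G M \<phi>" and cond: "min_nontrivial_dim G = \<infinity> \<or> \<alpha> = 1"
  shows "measure M (translates \<phi> A B) = 1"
proof (rule ccontr)
  assume ne: "measure M (translates \<phi> A B) \<noteq> 1"
  define C where "C = space M - translates \<phi> A B"
  have C: "C \<in> sets M" using translates_sets by (auto simp: C_def)
  have CS: "C \<subseteq> space M" using C by (rule sets.sets_into_space)
  have BS: "B \<subseteq> space M" using B_sets by (rule sets.sets_into_space)
  have "measure M C > 0"
    unfolding C_def prob_compl[OF translates_sets]
    using ne prob_le_1[of "translates \<phi> A B"] by (simp add: less_le)
  then obtain g where g: "g \<in> carrier G" and meets: "measure M (C \<inter> \<phi> g ` B) > 0"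
    using ex_translate_meets[OF erg C] by blast
  define D where "D = B \<inter> \<phi> (inv g) ` C"
  have D_sets: "D \<in> sets M" unfolding D_def using B_sets image_sets[OF inv_closed[OF g] C] by (rule sets.Int)
  have "\<phi> g ` \<phi> (inv g) ` C = C"
    using image_mult[OF g inv_closed[OF g] CS] image_one[OF CS] g by simp
  then have "\<phi> g ` D = C \<inter> \<phi> g ` B"
    unfolding D_def using image_Int[OF g BS] image_sets[OF inv_closed[OF g] C] sets.sets_into_space by blast
  then have D_pos: "measure M D > 0" using meets measure_image[OF g D_sets] by simp
  define X where "X n = (if n = 0 then B else if n = 1 then C else if n = 2 then D else space M)" for n :: nat
  have X: "X n \<in> sets M" for n using B_sets C D_sets by (simp add: X_def)
  have XS: "X n \<subseteq> space M" for n using X by (rule sets.sets_into_space)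
  obtain R :: "'g rep" and \<zeta> where R: "unitary_rep G R" and \<zeta>: "\<And>n. \<zeta> n \<in> vecs R"
    and ipR: "\<And>x y n m. \<lbrakk>x \<in> carrier G; y \<in> carrier G\<rbrakk> \<Longrightarrow>
       ip R (act R x (\<zeta> n)) (act R y (\<zeta> m)) = of_real (measure M (\<phi> x ` X n \<inter> \<phi> y ` X m))"
    by (rule rep_of_sets[of X, OF X]) blast
  interpret R: unitary_rep G R by (rule R)
  have ip1: "ip R (\<zeta> n) (act R y (\<zeta> m)) = of_real (measure M (X n \<inter> \<phi> y ` X m))" if "y \<in> carrier G" for n y m
    using ipR[OF one_closed that, of n m] \<zeta> by (simp add: R.act_one image_one[OF XS])
  have n1: "hnorm R (\<zeta> n) \<le> 1" for n
    using ip1[OF one_closed, of n n] \<zeta> by (simp add: hnorm_def R.act_one image_one[OF XS])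
  obtain p where p: "p \<in> fixed_vecs G R"
    "\<And>v. v \<in> vecs R \<Longrightarrow> (\<lambda>n. avg (T n) (\<lambda>\<gamma>. ip R v (act R \<gamma> (\<zeta> 0)))) \<longlonglongrightarrow> ip R v p"
  proof (rule ergodic_mean[OF R \<zeta>[of 0]], goal_cases)
    case (1 p)
    show ?case by (rule that[of p]) (assumption | rule 1)+
  qed
  obtain q where q: "q \<in> fixed_vecs G R" "ip R q q = ip R (\<zeta> 2) q"
    "\<And>v. v \<in> vecs R \<Longrightarrow> (\<lambda>n. avg (T n) (\<lambda>\<gamma>. ip R v (act R \<gamma> (\<zeta> 2)))) \<longlonglongrightarrow> ip R v q"
  proof (rule ergodic_mean[OF R \<zeta>[of 2]], goal_cases)
    case (1 p)
    show ?case by (rule that[of p]) (assumption | rule 1)+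
  qed
  have qV: "q \<in> vecs R" using q(1) by (rule fixed_vecs_vecs)
  have "ip R (\<zeta> 1) p = 0"
  proof (rule mean_vanishes[OF R \<zeta> n1 \<zeta> n1 _ p(2)[OF \<zeta>] cond])
    fix a assume a: "a \<in> A"
    then have "C \<inter> \<phi> a ` B = {}" using translate_subset[OF a] by (auto simp: C_def)
    moreover have "a \<in> carrier G" using a A_carrier by blast
    ultimately show "ip R (\<zeta> 1) (act R a (\<zeta> 0)) = 0" by (simp add: ip1 X_def)
  qed
  then have 0: "ip R (act R (inv g) (\<zeta> 1)) p = 0"
    using ip_act_fixed[OF R p(1) inv_closed[OF g] \<zeta>] by simp
  have "Re (ip R (\<zeta> 2) q) \<le> Re (ip R (act R (inv g) (\<zeta> 1)) p)"
  proof (rule LIMSEQ_le[OF tendsto_Re[OF q(3)[OF \<zeta>]] tendsto_Re[OF p(2)[OF R.act_closed[OF inv_closed[OF g] \<zeta>]]]])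
    have "Re (avg (T n) (\<lambda>\<gamma>. ip R (\<zeta> 2) (act R \<gamma> (\<zeta> 2))))
        \<le> Re (avg (T n) (\<lambda>\<gamma>. ip R (act R (inv g) (\<zeta> 1)) (act R \<gamma> (\<zeta> 0))))" for n
      unfolding Re_avg
    proof (intro divide_right_mono sum_mono)
      fix \<gamma> assume "\<gamma> \<in> T n"
      then have \<gamma>: "\<gamma> \<in> carrier G" by (rule T_carrier)
      have "measure M (D \<inter> \<phi> \<gamma> ` D) \<le> measure M (\<phi> (inv g) ` C \<inter> \<phi> \<gamma> ` B)"
        using image_sets[OF inv_closed[OF g] C] image_sets[OF \<gamma> B_sets]
        by (intro finite_measure_mono) (auto simp: D_def)
      then show "Re (ip R (\<zeta> 2) (act R \<gamma> (\<zeta> 2))) \<le> Re (ip R (act R (inv g) (\<zeta> 1)) (act R \<gamma> (\<zeta> 0)))"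
        using ip1[OF \<gamma>, of 2 2] ipR[OF inv_closed[OF g] \<gamma>, of 1 0] by (simp add: X_def)
    qed simp
    then show "\<exists>N. \<forall>n\<ge>N. Re (avg (T n) (\<lambda>\<gamma>. ip R (\<zeta> 2) (act R \<gamma> (\<zeta> 2))))
        \<le> Re (avg (T n) (\<lambda>\<gamma>. ip R (act R (inv g) (\<zeta> 1)) (act R \<gamma> (\<zeta> 0))))" by blast
  qed
  then have "Re (ip R q q) \<le> 0" using 0 q(2) by simp
  then have "hnorm R q = 0" using R.s_nonneg[OF qV] by (simp add: hnorm_def)
  then have "ip R (\<zeta> 3) q = 0" using R.cauchy_schwarz[OF \<zeta>[of 3] qV] by simp
  moreover have "ip R (\<zeta> 3) q = of_real (measure M D)"
  proof (rule LIMSEQ_unique[OF tendsto_s[OF q(3)[OF \<zeta>]]])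
    have "avg (T (s k)) (\<lambda>\<gamma>. ip R (\<zeta> 3) (act R \<gamma> (\<zeta> 2))) = of_real (measure M D)" for k
    proof -
      have "ip R (\<zeta> 3) (act R \<gamma> (\<zeta> 2)) = of_real (measure M D)" if "\<gamma> \<in> T (s k)" for \<gamma>
      proof -
        have \<gamma>: "\<gamma> \<in> carrier G" using that by (rule T_carrier)
        have "\<phi> \<gamma> ` D \<subseteq> space M" using image_sets[OF \<gamma> D_sets] by (rule sets.sets_into_space)
        then show ?thesis using ip1[OF \<gamma>, of 3 2] measure_image[OF \<gamma> D_sets] by (simp add: X_def Int_absorb1)
      qed
      then have "avg (T (s k)) (\<lambda>\<gamma>. ip R (\<zeta> 3) (act R \<gamma> (\<zeta> 2))) = avg (T (s k)) (\<lambda>_. of_real (measure M D))"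
        by (rule avg_cong)
      then show ?thesis using T_nonempty by (simp add: avg_const)
    qed
    then show "(\<lambda>k. avg (T (s k)) (\<lambda>\<gamma>. ip R (\<zeta> 3) (act R \<gamma> (\<zeta> 2)))) \<longlonglongrightarrow> of_real (measure M D)" by simp
  qed
  ultimately show False using D_pos by simp
qed

end

lemma upper_density_subseq:
  assumes dens: "upper_density T A = ereal \<alpha>" and pos: "\<alpha> > 0"
  obtains s :: "nat \<Rightarrow> nat" where "strict_mono s" "\<And>k. A \<inter> T (s k) \<noteq> {}"
    "(\<lambda>k. real (card (A \<inter> T (s k))) / real (card (T (s k)))) \<longlonglongrightarrow> \<alpha>"
proof -
  define u where "u n = real (card (A \<inter> T n)) / real (card (T n))" for n
  obtain r where r: "strict_mono (r :: nat \<Rightarrow> nat)" "((\<lambda>n. ereal (u n)) \<circ> r) \<longlonglongrightarrow> ereal \<alpha>"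
    using limsup_subseq_lim[of "\<lambda>n. ereal (u n)"] dens by (auto simp: upper_density_def u_def)
  then have lim: "(\<lambda>k. u (r k)) \<longlonglongrightarrow> \<alpha>" by (simp add: o_def)
  then have "\<forall>\<^sub>F k in sequentially. 0 < u (r k)" using pos by (rule order_tendstoD(1))
  then obtain N where N: "\<And>k. k \<ge> N \<Longrightarrow> 0 < u (r k)" by (auto simp: eventually_sequentially)
  show ?thesis
  proof (rule that[of "\<lambda>k. r (k + N)"])
    show "strict_mono (\<lambda>k. r (k + N))" using r(1) by (auto simp: strict_mono_def)
    show "A \<inter> T (r (k + N)) \<noteq> {}" for k using N[of "k + N"] by (auto simp: u_def)
    show "(\<lambda>k. real (card (A \<inter> T (r (k + N)))) / real (card (T (r (k + N))))) \<longlonglongrightarrow> \<alpha>"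
      using LIMSEQ_ignore_initial_segment[OF lim, of N] by (simp add: u_def)
  qed
qed

theorem theorem1p3:
  fixes G :: "('g, 'm) monoid_scheme" and T :: "nat \<Rightarrow> 'g set"
    and M :: "'y measure" and \<phi> :: "'g \<Rightarrow> 'y \<Rightarrow> 'y"
    and A :: "'g set" and B :: "'y set" and \<alpha> \<beta> :: real
  assumes "group G"
    and "ergodic_sequence G T"
    and "pmp_space G M \<phi>"
    and "A \<subseteq> carrier G" and "B \<in> sets M"
    and "upper_density T A = ereal \<alpha>" and "\<alpha> > 0"
    and "measure M B = \<beta>" and "\<beta> > 0"
  shows "(\<forall>r. 0 \<le> r \<and> r < \<beta> \<longrightarrow>
           (\<exists>a\<in>A. \<exists>S. S \<subseteq> fd_dual G - {trivial_class G} \<and> finite S \<and>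
              real (card S) \<le>
                (case min_nontrivial_dim G of
                   enat d \<Rightarrow> 17 * (1 - \<alpha>\<^sup>2) / (real d * \<alpha>\<^sup>2 * (\<beta> - r)\<^sup>2)
                 | \<infinity> \<Rightarrow> 0) \<and>
              a <#\<^bsub>G\<^esub> bohr_set G S ((\<beta> - r) / 2)
                \<subseteq> {\<gamma> \<in> carrier G. measure M (translates \<phi> A B \<inter> \<phi> \<gamma> ` B) > \<beta> * r})) \<and>
         (ergodic_action G M \<phi> \<longrightarrow> min_nontrivial_dim G = \<infinity> \<or> \<alpha> = 1 \<longrightarrow>
            measure M (translates \<phi> A B) = 1)"
proof -
  obtain s :: "nat \<Rightarrow> nat" where s: "strict_mono s" "\<And>k. A \<inter> T (s k) \<noteq> {}"
    "(\<lambda>k. real (card (A \<inter> T (s k))) / real (card (T (s k)))) \<longlonglongrightarrow> \<alpha>"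
    by (rule upper_density_subseq[OF assms(6,7)]) blast
  interpret pmp_space G M \<phi> by (rule assms(3))
  interpret product_set G T A \<alpha> s M \<phi> B
  proof (intro product_set.intro dense_along.intro ergodic_seq.intro)
    show "group G" by (rule assms(1))
    show "ergodic_seq_axioms G T" by standard (rule assms(2))
    show "dense_along_axioms G T A \<alpha> s" by standard (use assms(4,7) s in auto)
    show "pmp_space G M \<phi>" by (rule assms(3))
    show "product_set_axioms M B" by standard (use assms(5,8,9) in auto)
  qed
  show ?thesis
  proof (intro conjI allI impI)
    fix r assume r: "0 \<le> r \<and> r < \<beta>"
    show "\<exists>a\<in>A. \<exists>S. S \<subseteq> fd_dual G - {trivial_class G} \<and> finite S \<and>
              real (card S) \<le>
                (case min_nontrivial_dim G of
                   enat d \<Rightarrow> 17 * (1 - \<alpha>\<^sup>2) / (real d * \<alpha>\<^sup>2 * (\<beta> - r)\<^sup>2)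
                 | \<infinity> \<Rightarrow> 0) \<and>
              a <#\<^bsub>G\<^esub> bohr_set G S ((\<beta> - r) / 2)
                \<subseteq> {\<gamma> \<in> carrier G. measure M (translates \<phi> A B \<inter> \<phi> \<gamma> ` B) > \<beta> * r}"
    proof (rule product_set_contains_bohr_set[of r, unfolded assms(8)])
      show "0 \<le> r" "r < \<beta>" using r by auto
    qed blast
  next
    assume "ergodic_action G M \<phi>" "min_nontrivial_dim G = \<infinity> \<or> \<alpha> = 1"
    then show "measure M (translates \<phi> A B) = 1" by (rule product_set_full_measure)
  qed
qed

end
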